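(* Let $F$ be either a superpythagorean field (and put $p=2$), or a $p$-rigid field containing a primitive $p$-th root of unity for an odd prime $p$. Let $P(n)$, $n\ge 1$, be the profinite groups associated with $F$ as defined in the context. Then for every $n\ge 1$, every $\gamma\in H^2(P(n),\mathbb{F}_p)$ fully decomposes in $H^2(P(n+1),\mathbb{F}_p)$ under the inflation map; that is, $\inf_{P(n)}^{P(n+1)}(\gamma)$ is a finite sum of cup products of elements of $H^1(P(n+1),\mathbb{F}_p)$.
   Context: A field $F$ is formally real if $-1$ is not a sum of squares in $F$. A superpythagorean field is a formally real field in which every subgroup of index $2$ in $F^\times$ not containing $-1$ defines an ordering on $F$ (i.e. is the set of positive elements of a field ordering). For a prime $p$, let $F^p=\{x^p:x\in F\}$. An element $a\in F\smallsetminus F^p$ is $p$-rigid if the image of the norm map $F(\sqrt[p]{a})\to F$ is contained in $\bigcup_{k=0}^{p-1}a^kF^p$. The field $F$ is $p$-rigid if all elements of $F\smallsetminus F^p$ are $p$-rigid. $G_F(p)$ denotes the Galois group over $F$ of the maximal $p$-extension $F(p)$ of $F$. $C_\ell$ is the cyclic group of order $\ell$. For $n,d\in\mathbb{N}$ let $A_2(n;d)=(C_{2^n})^d\rtimes C_2$, where $xyx^{-1}=y^{-1}$ for $y\in (C_{2^n})^d$ and $\langle x\rangle=C_2$. For an odd prime $p$, $n,d\in\mathbb{N}$ and $k\in\mathbb{N}\cup\{\infty\}$ ($k\ge 1$), let $B_p(n;d,k)=(C_{p^n})^d\rtimes C_{p^n}$, where $xyx^{-1}=y^{p^k+1}$ for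 $y\in (C_{p^n})^d$ and $x$ a fixed generator of the outer factor $C_{p^n}$; for $k=\infty$ this means $xyx^{-1}=y$. The groups $P(n)$: if $F$ is superpythagorean, it is known that for some index set $I$ one has $G_F(2)\cong \mathbb{Z}_2^I\rtimes C_2$ with the generator of $C_2$ acting by inversion; $P(n)$ is the inverse limit over finite subsets $J\subseteq I$ of the groups $A_2(n;|J|)$, i.e. $P(n)=\big(\prod_I C_{2^n}\big)\rtimes C_2$ with inversion action. If $F$ is $p$-rigid ($p$ odd, $F$ containing a primitive $p$-th root of unity), it is known that for some index set $I$ and some $k\in\mathbb{N}\cup\{\infty\}$ one has $G_F(p)\cong\mathbb{Z}_p^I\rtimes\mathbb{Z}_p$, with a topological generator $x$ of the outer factor acting by $xyx^{-1}=y^{p^k+1}$ (trivially if $k=\infty$); $P(n)$ is the inverse limit over finite $J\subseteq I$ of $B_p(n;|J|,k)$, i.e. $P(n)=\big(\prod_I C_{p^n}\big)\rtimes C_{p^n}$ with the corresponding action. (When $G_F(p)$ is finitely generated, $I$ is finite with $d$ elements and $P(n)=A_2(n;d)$, respectively $P(n)=B_p(n;d,k)$.) In both cases $G_F(p)=\varprojlim_n P(n)$, and inflation is along the natural surjection $P(n+1)\to P(n)$ induced by the natural surjections $C_{p^{n+1}}\to C_{p^n}$ (and the identity on the factor $C_2$ in the superpythagorean case). Cohomology is continuous, with trivial action on $\mathbb{F}_p$. *)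

theory Defs
  imports
    "HOL-Analysis.Function_Topology"
    "HOL-Analysis.Product_Topology"
    "HOL-Library.Extended_Nat"
    "HOL-Algebra.Algebraic_Closure_Type"
    "HOL-Algebra.Embedded_Algebras"
    "HOL-Algebra.Generated_Fields"
    "HOL-Algebra.Elementary_Groups"
    "HOL-Algebra.Product_Groups"
    "Jordan_Normal_Form.Determinant"
begin

section \<open>Topological groups\<close>

record 'a topological_group = "'a monoid" +
  topol :: "'a topology"

definition with_topology :: "('a, 'm) monoid_scheme \<Rightarrow> 'a topology \<Rightarrow> 'a topological_group" where
  "with_topology G T =
     \<lparr>carrier = carrier G, monoid.mult = monoid.mult G, one = one G, topol = T\<rparr>"

definition topological_group_isomorphic ::
    "('a, 'm) topological_group_scheme \<Rightarrow> ('b, 'n) topological_group_scheme \<Rightarrow> bool"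
    (infixr \<open>\<cong>\<^sub>t\<close> 60) where
  "G \<cong>\<^sub>t H \<longleftrightarrow> (\<exists>h \<in> iso G H. homeomorphic_map (topol G) (topol H) h)"

definition power_group :: "'i set \<Rightarrow> ('a, 'm) topological_group_scheme \<Rightarrow> ('i \<Rightarrow> 'a) topological_group"
  where
  "power_group I G =
     with_topology (product_group I (\<lambda>_. G)) (product_topology (\<lambda>_. topol G) I)"

text \<open>The pair \<open>(y, x)\<close> stands for the product \<open>yx\<close>, with \<open>y\<close> in the normal factor \<open>N\<close> and
  \<open>x\<close> in the outer factor \<open>C\<close>; thus \<open>x y x\<^sup>-\<^sup>1 = \<theta> x y\<close>.\<close>

definition semidirect_group ::
    "('a, 'm) topological_group_scheme \<Rightarrow> ('b, 'n) topological_group_scheme \<Rightarrow> ('b \<Rightarrow> 'a \<Rightarrow> 'a)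
      \<Rightarrow> ('a \<times> 'b) topological_group" where
  "semidirect_group N C \<theta> =
     \<lparr>carrier = carrier N \<times> carrier C,
      monoid.mult = (\<lambda>(y, x) (y', x'). (y \<otimes>\<^bsub>N\<^esub> \<theta> x y', x \<otimes>\<^bsub>C\<^esub> x')),
      one = (\<one>\<^bsub>N\<^esub>, \<one>\<^bsub>C\<^esub>),
      topol = prod_topology (topol N) (topol C)\<rparr>"

definition cyclic :: "nat \<Rightarrow> int topological_group" where
  "cyclic m = with_topology (integer_mod_group m) (discrete_topology (carrier (integer_mod_group m)))"

text \<open>The additive group of the \<open>p\<close>-adic integers, as the inverse limit of the groups
  \<open>\<int>/p\<^sup>m\<close>: an element is its sequence of residues modulo \<open>p\<^sup>m\<close>.\<close>

definition padic :: "nat \<Rightarrow> (nat \<Rightarrow> int) topological_group" where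
  "padic p =
     (let G = product_group UNIV (\<lambda>m. integer_mod_group (p ^ m));
          Z = {c \<in> carrier G. \<forall>m. c (Suc m) mod int (p ^ m) = c m}
      in with_topology (G\<lparr>carrier := Z\<rparr>)
           (subtopology (product_topology (\<lambda>m. topol (cyclic (p ^ m))) UNIV) Z))"


section \<open>Continuous cohomology with trivial coefficients \<open>\<int>/p\<close>\<close>

text \<open>Inhomogeneous cochains: \<open>\<int>/p\<close> is represented by \<open>{0..<p}\<close>, and an element of
  \<open>G\<^sup>m\<close> by an extensional function on \<open>{..<m}\<close>.\<close>

definition tuples :: "nat \<Rightarrow> ('g, 'm) topological_group_scheme \<Rightarrow> (nat \<Rightarrow> 'g) set" where
  "tuples m G = (\<Pi>\<^sub>E i \<in> {..<m}. carrier G)"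

definition cochain_group ::
    "nat \<Rightarrow> nat \<Rightarrow> ('g, 'm) topological_group_scheme \<Rightarrow> ((nat \<Rightarrow> 'g) \<Rightarrow> int) monoid" where
  "cochain_group p m G =
     \<lparr>carrier = {f \<in> extensional (tuples m G).
        continuous_map (product_topology (\<lambda>_. topol G) {..<m}) (discrete_topology {0..<int p}) f},
      monoid.mult = (\<lambda>f g. \<lambda>x \<in> tuples m G. (f x + g x) mod int p),
      one = (\<lambda>x \<in> tuples m G. 0)\<rparr>"

definition coboundary ::
    "nat \<Rightarrow> nat \<Rightarrow> ('g, 'm) topological_group_scheme \<Rightarrow> ((nat \<Rightarrow> 'g) \<Rightarrow> int) \<Rightarrow> (nat \<Rightarrow> 'g) \<Rightarrow> int"
  where
  "coboundary p m G f = (\<lambda>x \<in> tuples (Suc m) G.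
     (f (\<lambda>i \<in> {..<m}. x (Suc i))
      + (\<Sum>j<m. (-1) ^ Suc j *
           f (\<lambda>i \<in> {..<m}. if i < j then x i
                             else if i = j then x j \<otimes>\<^bsub>G\<^esub> x (Suc j)
                             else x (Suc i)))
      + (-1) ^ Suc m * f (\<lambda>i \<in> {..<m}. x i)) mod int p)"

definition cocycles ::
    "nat \<Rightarrow> nat \<Rightarrow> ('g, 'm) topological_group_scheme \<Rightarrow> ((nat \<Rightarrow> 'g) \<Rightarrow> int) set" where
  "cocycles p m G =
     {f \<in> carrier (cochain_group p m G). coboundary p m G f = \<one>\<^bsub>cochain_group p (Suc m) G\<^esub>}"

definition coboundaries ::
    "nat \<Rightarrow> nat \<Rightarrow> ('g, 'm) topological_group_scheme \<Rightarrow> ((nat \<Rightarrow> 'g) \<Rightarrow> int) set" where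
  "coboundaries p m G =
     (case m of 0 \<Rightarrow> {\<one>\<^bsub>cochain_group p 0 G\<^esub>}
      | Suc l \<Rightarrow> coboundary p l G ` carrier (cochain_group p l G))"

definition cohomology ::
    "nat \<Rightarrow> nat \<Rightarrow> ('g, 'm) topological_group_scheme \<Rightarrow> ((nat \<Rightarrow> 'g) \<Rightarrow> int) set monoid" where
  "cohomology p m G =
     (cochain_group p m G)\<lparr>carrier := cocycles p m G\<rparr> Mod coboundaries p m G"

definition cohomology_class ::
    "nat \<Rightarrow> nat \<Rightarrow> ('g, 'm) topological_group_scheme \<Rightarrow> ((nat \<Rightarrow> 'g) \<Rightarrow> int)
      \<Rightarrow> ((nat \<Rightarrow> 'g) \<Rightarrow> int) set" where
  "cohomology_class p m G f = coboundaries p m G #>\<^bsub>cochain_group p m G\<^esub> f"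

text \<open>Maps on classes are defined by taking the union over all representatives; for classes these
  unions range over one single coset.\<close>

definition cup ::
    "nat \<Rightarrow> nat \<Rightarrow> nat \<Rightarrow> ('g, 'm) topological_group_scheme \<Rightarrow> ((nat \<Rightarrow> 'g) \<Rightarrow> int) set
      \<Rightarrow> ((nat \<Rightarrow> 'g) \<Rightarrow> int) set \<Rightarrow> ((nat \<Rightarrow> 'g) \<Rightarrow> int) set" where
  "cup p i j G \<alpha> \<beta> = (\<Union>f\<in>\<alpha>. \<Union>g\<in>\<beta>. cohomology_class p (i + j) G
     (\<lambda>x \<in> tuples (i + j) G.
        (f (\<lambda>k \<in> {..<i}. x k) * g (\<lambda>k \<in> {..<j}. x (i + k))) mod int p))"

definition inflation ::
    "nat \<Rightarrow> nat \<Rightarrow> ('g, 'm) topological_group_scheme \<Rightarrow> ('g \<Rightarrow> 'h) \<Rightarrow> ((nat \<Rightarrow> 'h) \<Rightarrow> int) set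
      \<Rightarrow> ((nat \<Rightarrow> 'g) \<Rightarrow> int) set" where
  "inflation p m G \<pi> \<gamma> = (\<Union>f\<in>\<gamma>. cohomology_class p m G
     (\<lambda>x \<in> tuples m G. f (\<lambda>k \<in> {..<m}. \<pi> (x k))))"

definition fully_decomposes ::
    "nat \<Rightarrow> ('g, 'm) topological_group_scheme \<Rightarrow> ((nat \<Rightarrow> 'g) \<Rightarrow> int) set \<Rightarrow> bool" where
  "fully_decomposes p G \<gamma> \<longleftrightarrow>
     (\<exists>r (\<alpha> :: nat \<Rightarrow> _) \<beta>.
        (\<forall>j<r. \<alpha> j \<in> carrier (cohomology p 1 G) \<and> \<beta> j \<in> carrier (cohomology p 1 G)) \<and>
        \<gamma> = finprod (cohomology p 2 G) (\<lambda>j. cup p 1 1 G (\<alpha> j) (\<beta> j)) {..<r})"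


section \<open>The maximal \<open>p\<close>-extension and its Galois group\<close>

text \<open>A field \<open>F\<close> is a type \<open>'a\<close>; its algebraic extensions are taken inside the fixed algebraic
  closure \<open>'a alg_closure\<close>.\<close>

abbreviation closure_ring :: "'a::field alg_closure ring" where
  "closure_ring \<equiv> ring_of_type_algebra"

definition base :: "'a::field alg_closure set" where
  "base = range to_ac"

definition intermediate_field :: "'a::field alg_closure set \<Rightarrow> bool" where
  "intermediate_field K \<longleftrightarrow> subfield K closure_ring \<and> base \<subseteq> K"

text \<open>\<open>Gal(K/F)\<close> with the Krull topology. The generating open sets are the cosets
  \<open>\<sigma> Gal(K/L)\<close>, that is, the automorphisms agreeing with \<open>\<sigma>\<close> on \<open>L\<close>, for \<open>L/F\<close> finite.\<close>

definition field_automorphisms :: "'a::field alg_closure set \<Rightarrow> ('a alg_closure \<Rightarrow> 'a alg_closure) set"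
  where
  "field_automorphisms K =
     {\<sigma> \<in> extensional K.
        \<sigma> \<in> ring_iso (closure_ring\<lparr>carrier := K\<rparr>) (closure_ring\<lparr>carrier := K\<rparr>) \<and>
        (\<forall>a \<in> base. \<sigma> a = a)}"

definition galois_group ::
    "'a::field alg_closure set \<Rightarrow> ('a alg_closure \<Rightarrow> 'a alg_closure) topological_group" where
  "galois_group K =
     \<lparr>carrier = field_automorphisms K,
      monoid.mult = compose K,
      one = (\<lambda>x \<in> K. x),
      topol = topology_generated_by
        {{\<tau> \<in> field_automorphisms K. \<forall>x\<in>L. \<tau> x = \<sigma> x} | \<sigma> L.
           \<sigma> \<in> field_automorphisms K \<and> intermediate_field L \<and> L \<subseteq> K \<and>
           ring.finite_dimension closure_ring base L}\<rparr>"

definition finite_galois_p_extension :: "nat \<Rightarrow> 'a::field alg_closure set \<Rightarrow> bool" where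
  "finite_galois_p_extension p L \<longleftrightarrow>
     intermediate_field L \<and>
     (\<exists>m. ring.dimension closure_ring (p ^ m) base L) \<and>
     {x \<in> L. \<forall>\<sigma> \<in> field_automorphisms L. \<sigma> x = x} = base"

definition maximal_p_extension :: "nat \<Rightarrow> 'a::field alg_closure set" where
  "maximal_p_extension p =
     generate_field closure_ring (\<Union>{L. finite_galois_p_extension p L})"

definition max_pro_p_galois_group ::
    "'a::field itself \<Rightarrow> nat \<Rightarrow> ('a alg_closure \<Rightarrow> 'a alg_closure) topological_group" where
  "max_pro_p_galois_group F p = galois_group (maximal_p_extension p)"


section \<open>Superpythagorean and \<open>p\<close>-rigid fields\<close>

definition formally_real :: "'a::field itself \<Rightarrow> bool" where
  "formally_real F \<longleftrightarrow> (\<nexists>xs :: 'a list. (\<Sum>x\<leftarrow>xs. x ^ 2) = -1)"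

definition field_ordering :: "('a::field \<times> 'a) set \<Rightarrow> bool" where
  "field_ordering r \<longleftrightarrow>
     linear_order_on UNIV r \<and>
     (\<forall>x y z. (x, y) \<in> r \<longrightarrow> (x + z, y + z) \<in> r) \<and>
     (\<forall>x y. (0, x) \<in> r \<longrightarrow> (0, y) \<in> r \<longrightarrow> (0, x * y) \<in> r)"

definition superpythagorean :: "'a::field itself \<Rightarrow> bool" where
  "superpythagorean F \<longleftrightarrow>
     formally_real F \<and>
     (\<forall>T. subgroup T (units_of (ring_of_type_algebra :: 'a ring)) \<longrightarrow>
          card (rcosets\<^bsub>units_of (ring_of_type_algebra :: 'a ring)\<^esub> T) = 2 \<longrightarrow>
          -1 \<notin> T \<longrightarrow>
          (\<exists>r. field_ordering r \<and> T = {x. (0, x) \<in> r \<and> x \<noteq> 0}))"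

text \<open>\<open>has_norm K \<beta> c\<close>: the norm of \<open>\<beta>\<close> from the finite extension \<open>K\<close> to the base field is \<open>c\<close>,
  i.e. \<open>c\<close> is the determinant of multiplication by \<open>\<beta>\<close> on \<open>K\<close>.\<close>

definition has_norm :: "'a::field alg_closure set \<Rightarrow> 'a alg_closure \<Rightarrow> 'a \<Rightarrow> bool" where
  "has_norm K \<beta> c \<longleftrightarrow>
     (\<exists>Us A. ring.independent closure_ring base Us \<and> ring.Span closure_ring base Us = K \<and>
        A \<in> carrier_mat (length Us) (length Us) \<and>
        (\<forall>j < length Us. \<beta> * Us ! j = (\<Sum>i < length Us. to_ac (A $$ (i, j)) * Us ! i)) \<and>
        c = det A)"

definition pth_powers :: "nat \<Rightarrow> 'a::field set" where
  "pth_powers p = range (\<lambda>x. x ^ p)"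

text \<open>All choices of the root \<open>\<alpha>\<close> of \<open>X\<^sup>p - a\<close> give conjugate extensions, hence the same norm image.\<close>

definition p_rigid_element :: "nat \<Rightarrow> 'a::field \<Rightarrow> bool" where
  "p_rigid_element p a \<longleftrightarrow>
     a \<notin> pth_powers p \<and>
     (\<forall>\<alpha>. \<alpha> ^ p = to_ac a \<longrightarrow>
        (let K = generate_field closure_ring (insert \<alpha> base) in
         {c. \<exists>\<beta>\<in>K. has_norm K \<beta> c} \<subseteq> (\<Union>k<p. (\<lambda>y. a ^ k * y) ` pth_powers p)))"

definition p_rigid_field :: "'a::field itself \<Rightarrow> nat \<Rightarrow> bool" where
  "p_rigid_field F p \<longleftrightarrow> (\<forall>a :: 'a. a \<notin> pth_powers p \<longrightarrow> p_rigid_element p a)"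

definition has_primitive_root_of_unity :: "'a::field itself \<Rightarrow> nat \<Rightarrow> bool" where
  "has_primitive_root_of_unity F p \<longleftrightarrow>
     (\<exists>\<zeta> :: 'a. \<zeta> ^ p = 1 \<and> (\<forall>k\<in>{1..<p}. \<zeta> ^ k \<noteq> 1))"


section \<open>The groups \<open>P(n)\<close>\<close>

text \<open>\<open>action_exponent p k\<close> is the exponent \<open>p\<^sup>k + 1\<close> by which the generator \<open>1\<close> of the outer
  factor acts.\<close>

definition action_exponent :: "nat \<Rightarrow> enat \<Rightarrow> int" where
  "action_exponent p k = (case k of enat l \<Rightarrow> int p ^ l + 1 | \<infinity> \<Rightarrow> 1)"

text \<open>\<open>A\<^sub>2(n; I) = (\<Prod>\<^sub>I C\<^bsub>2^n\<^esub>) \<rtimes> C\<^sub>2\<close> and \<open>B\<^sub>p(n; I, k) = (\<Prod>\<^sub>I C\<^bsub>p^n\<^esub>) \<rtimes> C\<^bsub>p^n\<^esub>\<close>. The element \<open>x\<close> of the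
  outer factor is the \<open>x\<close>-th power of the generator.\<close>

definition A_group :: "'i set \<Rightarrow> nat \<Rightarrow> (('i \<Rightarrow> int) \<times> int) topological_group" where
  "A_group I n =
     (let N = power_group I (cyclic (2 ^ n))
      in semidirect_group N (cyclic 2) (\<lambda>x y. y [^]\<^bsub>N\<^esub> ((-1) ^ nat x :: int)))"

definition B_group ::
    "nat \<Rightarrow> 'i set \<Rightarrow> enat \<Rightarrow> nat \<Rightarrow> (('i \<Rightarrow> int) \<times> int) topological_group" where
  "B_group p I k n =
     (let N = power_group I (cyclic (p ^ n))
      in semidirect_group N (cyclic (p ^ n)) (\<lambda>x y. y [^]\<^bsub>N\<^esub> (action_exponent p k ^ nat x)))"

definition A_projection :: "'i set \<Rightarrow> nat \<Rightarrow> ('i \<Rightarrow> int) \<times> int \<Rightarrow> ('i \<Rightarrow> int) \<times> int" where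
  "A_projection I n = (\<lambda>(y, x). (\<lambda>i\<in>I. y i mod 2 ^ n, x))"

definition B_projection :: "nat \<Rightarrow> 'i set \<Rightarrow> nat \<Rightarrow> ('i \<Rightarrow> int) \<times> int \<Rightarrow> ('i \<Rightarrow> int) \<times> int" where
  "B_projection p I n = (\<lambda>(y, x). (\<lambda>i\<in>I. y i mod int p ^ n, x mod int p ^ n))"

text \<open>The profinite groups \<open>\<int>\<^sub>2\<^sup>I \<rtimes> C\<^sub>2\<close> and \<open>\<int>\<^sub>p\<^sup>I \<rtimes> \<int>\<^sub>p\<close>. In the latter, \<open>c \<in> \<int>\<^sub>p\<close> acts as
  multiplication by the \<open>p\<close>-adic number \<open>q\<^sup>c\<close>, where \<open>q = action_exponent p k\<close>. Its residue
  modulo \<open>p\<^sup>m\<close> is \<open>q\<close> to the power \<open>c m\<close>, because \<open>q \<equiv> 1\<close> modulo \<open>p\<close> (for \<open>k \<ge> 1\<close>) implies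
  that the order of \<open>q\<close> modulo \<open>p\<^sup>m\<close> divides \<open>p\<^sup>m\<close>.\<close>

definition A_limit :: "'i set \<Rightarrow> (('i \<Rightarrow> nat \<Rightarrow> int) \<times> int) topological_group" where
  "A_limit I =
     (let N = power_group I (padic 2)
      in semidirect_group N (cyclic 2) (\<lambda>x y. y [^]\<^bsub>N\<^esub> ((-1) ^ nat x :: int)))"

definition B_limit ::
    "nat \<Rightarrow> 'i set \<Rightarrow> enat \<Rightarrow> (('i \<Rightarrow> nat \<Rightarrow> int) \<times> (nat \<Rightarrow> int)) topological_group" where
  "B_limit p I k =
     semidirect_group (power_group I (padic p)) (padic p)
       (\<lambda>c y. \<lambda>i\<in>I. \<lambda>m. (action_exponent p k ^ nat (c m) * y i m) mod int (p ^ m))"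

text \<open>\<open>(P, \<pi>)\<close> is the tower of groups associated with the field \<open>F\<close> and the prime \<open>p\<close>, with
  surjections \<open>\<pi> n\<close> from \<open>P (n + 1)\<close> to \<open>P n\<close>.\<close>

definition superpythagorean_tower ::
    "'a::field itself \<Rightarrow> (nat \<Rightarrow> (('i \<Rightarrow> int) \<times> int) topological_group)
      \<Rightarrow> (nat \<Rightarrow> ('i \<Rightarrow> int) \<times> int \<Rightarrow> ('i \<Rightarrow> int) \<times> int) \<Rightarrow> bool" where
  "superpythagorean_tower F P \<pi> \<longleftrightarrow>
     (\<exists>I. max_pro_p_galois_group F 2 \<cong>\<^sub>t A_limit I \<and> P = A_group I \<and> \<pi> = A_projection I)"

definition rigid_tower ::
    "'a::field itself \<Rightarrow> nat \<Rightarrow> (nat \<Rightarrow> (('i \<Rightarrow> int) \<times> int) topological_group)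
      \<Rightarrow> (nat \<Rightarrow> ('i \<Rightarrow> int) \<times> int \<Rightarrow> ('i \<Rightarrow> int) \<times> int) \<Rightarrow> bool" where
  "rigid_tower F p P \<pi> \<longleftrightarrow>
     (\<exists>I k. 1 \<le> k \<and> max_pro_p_galois_group F p \<cong>\<^sub>t B_limit p I k \<and>
            P = B_group p I k \<and> \<pi> = B_projection p I)"

end

theory Submission
  imports Defs "HOL-Number_Theory.Cong"
begin

text \<open>
  All the groups \<open>P(n)\<close> have the form \<open>(\<Prod>\<^sub>I \<int>/M) \<rtimes> \<int>/L\<close>, where the generator \<open>x\<close> of the outer factor
  acts as multiplication by an integer \<open>q \<equiv> 1\<close> modulo \<open>p\<close>: for the superpythagorean tower \<open>q = -1\<close>,
  \<open>M = 2\<^sup>n\<close> and \<open>L = 2\<close>, for the rigid one \<open>q = p\<^sup>k + 1\<close> (or \<open>q = 1\<close>) and \<open>M = L = p\<^sup>n\<close>.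

  The idea is to write down a section. A class \<open>\<gamma>\<close> on \<open>P(n)\<close> is given by a continuous cocycle \<open>F\<close>.
  By compactness, \<open>F\<close> depends on finitely many coordinates \<open>J \<subseteq> I\<close> only. Let \<open>E\<close> be the central extension
  of \<open>P(n)\<close> by \<open>\<int>/p = \<langle>z\<rangle>\<close> with cocycle \<open>F\<close>, and choose lifts \<open>e\<^sub>i\<close> (for \<open>i \<in> J\<close>) and \<open>t\<close> of the standard
  generators. The relations that hold between the generators in \<open>P(n)\<close> hold in \<open>E\<close> up to powers of \<open>z\<close>:
  \<open>e\<^sub>j e\<^sub>i = e\<^sub>i e\<^sub>j z\<^bsup>c(j,i)\<^esup>\<close> and \<open>t e\<^sub>i t\<^sup>-\<^sup>1 = e\<^sub>i\<^sup>q z\<^bsup>d(i)\<^esup>\<close>. Moreover \<open>e\<^sub>i\<^sup>M\<close> is a power of \<open>z\<close>, so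
  \<open>e\<^sub>i\<^bsup>pM\<^esup> = 1\<close>. This is the point of passing to \<open>P(n+1)\<close>: there the exponents of the \<open>e\<^sub>i\<close> are defined modulo
  \<open>pM\<close>, and
    \<open>S(y, x) = (\<Prod>\<^bsub>i \<in> J\<^esub> e\<^sub>i\<^bsup>y(i)\<^esup>) t\<^sup>x\<close>
  (the product in a fixed order) lifts the projection from \<open>P(n+1)\<close> to \<open>P(n)\<close>, up to coordinates on which
  \<open>F\<close> does not depend. Collecting the factors of \<open>S(g) S(h)\<close> gives \<open>S(g) S(h) = S(g h) z\<^bsup>Q(g,h)\<^esup>\<close> with
    \<open>Q((y, x), (y', x')) \<equiv> \<Sum>\<^bsub>i before j\<^esub> c(j,i) y(j) y'(i) + x \<Sum>\<^sub>i d(i) y'(i) + \<epsilon> x x'\<close>,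
  because \<open>q \<equiv> 1\<close> modulo \<open>p\<close>. Here \<open>t\<^bsup>L'\<^esup> = z\<^sup>\<epsilon>\<close>, where \<open>L'\<close> is the order of the outer factor of \<open>P(n+1)\<close>. If
  \<open>L' = pL\<close>, then \<open>\<epsilon> = 0\<close> as for the \<open>e\<^sub>i\<close>; if \<open>L' = L = p = 2\<close>, then \<open>x x'\<close> is exactly the carry in the
  addition \<open>x + x'\<close>. Coordinates modulo \<open>p\<close> are characters of \<open>P(n+1)\<close>, so \<open>Q\<close> is a sum of products of
  characters. Comparing the \<open>z\<close>-components of both sides, the inflation of \<open>F\<close> equals \<open>Q\<close> up to the coboundary of
  the \<open>z\<close>-component of \<open>S\<close>, and hence it represents a sum of cup products.

  The product formula is \<open>section_mult\<close>, the reduction to finitely many coordinates is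
  \<open>continuous2_finitely_determined\<close>, and everything is put together in \<open>inflation_fully_decomposes\<close>. In
  degree one, trivial coefficients make every coboundary zero, so a class is a single character; this makes cup
  products of classes easy to compute.\<close>

section \<open>Continuous maps from profinite spaces to discrete spaces\<close>

lemma continuous_map_into_discrete_combine:
  assumes "continuous_map Z (discrete_topology S) f" "continuous_map Z (discrete_topology T) g"
    and "\<And>a b. \<lbrakk>a \<in> S; b \<in> T\<rbrakk> \<Longrightarrow> c a b \<in> U"
  shows "continuous_map Z (discrete_topology U) (\<lambda>x. c (f x) (g x))"
proof -
  have "continuous_map Z (discrete_topology (S \<times> T)) (\<lambda>x. (f x, g x))"
    using assms(1,2) by (simp add: prod_topology_discrete_topology continuous_map_pairedI)
  moreover have "continuous_map (discrete_topology (S \<times> T)) (discrete_topology U) (\<lambda>(a, b). c a b)"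
    using assms(3) by auto
  ultimately have "continuous_map Z (discrete_topology U) ((\<lambda>(a, b). c a b) \<circ> (\<lambda>x. (f x, g x)))"
    by (rule continuous_map_compose)
  then show ?thesis by (simp add: o_def)
qed

text \<open>The value \<open>\<kappa> J x\<close> collects the coordinates of \<open>x\<close> in \<open>J\<close>, so that two points with the same value lie in
  the same cylinder over \<open>J\<close>. Allowing an arbitrary \<open>\<kappa>\<close> lets the property pass to products of such spaces, without
  a reindexing of the product of products as one product.\<close>

definition cylinder_base :: "'x topology \<Rightarrow> 'i set \<Rightarrow> ('i set \<Rightarrow> 'x \<Rightarrow> 'k) \<Rightarrow> bool" where
  "cylinder_base Z I \<kappa> \<longleftrightarrow>
     (\<forall>J x. finite J \<longrightarrow> J \<subseteq> I \<longrightarrow> x \<in> topspace Z \<longrightarrow> openin Z {x' \<in> topspace Z. \<kappa> J x' = \<kappa> J x}) \<and>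
     (\<forall>U x. openin Z U \<longrightarrow> x \<in> U \<longrightarrow>
        (\<exists>J. finite J \<and> J \<subseteq> I \<and> {x' \<in> topspace Z. \<kappa> J x' = \<kappa> J x} \<subseteq> U)) \<and>
     (\<forall>J J' x x'. J \<subseteq> J' \<longrightarrow> \<kappa> J' x = \<kappa> J' x' \<longrightarrow> \<kappa> J x = \<kappa> J x')"

lemma cylinder_base_openin:
  "\<lbrakk>cylinder_base Z I \<kappa>; finite J; J \<subseteq> I; x \<in> topspace Z\<rbrakk>
    \<Longrightarrow> openin Z {x' \<in> topspace Z. \<kappa> J x' = \<kappa> J x}"
  unfolding cylinder_base_def by meson

lemma cylinder_base_nhd:
  assumes "cylinder_base Z I \<kappa>" "openin Z U" "x \<in> U"
  obtains J where "finite J" "J \<subseteq> I" "{x' \<in> topspace Z. \<kappa> J x' = \<kappa> J x} \<subseteq> U"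
  using assms unfolding cylinder_base_def by meson

lemma cylinder_base_antimono:
  "\<lbrakk>cylinder_base Z I \<kappa>; J \<subseteq> J'; \<kappa> J' x = \<kappa> J' x'\<rbrakk> \<Longrightarrow> \<kappa> J x = \<kappa> J x'"
  unfolding cylinder_base_def by meson

text \<open>A discrete factor is recorded completely for every \<open>J\<close>, including the empty set.\<close>

lemma cylinder_base_discrete: "cylinder_base (discrete_topology S) I (\<lambda>J x. x)"
  by (auto simp: cylinder_base_def)

lemma cylinder_base_product:
  "cylinder_base (product_topology (\<lambda>_. discrete_topology S) I) I (\<lambda>J x. restrict x J)"
  unfolding cylinder_base_def
proof (intro conjI allI impI)
  fix J :: "'a set" and x :: "'a \<Rightarrow> 'b"
  let ?Z = "product_topology (\<lambda>_. discrete_topology S) I"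
  assume J: "finite J" "J \<subseteq> I" and x: "x \<in> topspace ?Z"
  have "openin ?Z (\<Pi>\<^sub>E i\<in>I. if i \<in> J then {x i} else S)"
    using J x by (auto simp: openin_PiE_gen PiE_iff intro: finite_subset[of _ J])
  moreover have "(\<Pi>\<^sub>E i\<in>I. if i \<in> J then {x i} else S) =
      {x' \<in> topspace ?Z. restrict x' J = restrict x J}"
  proof (intro equalityI subsetI)
    fix x' assume x': "x' \<in> (\<Pi>\<^sub>E i\<in>I. if i \<in> J then {x i} else S)"
    then have *: "x' i = x i" if "i \<in> J" for i
      using J that by (auto dest!: PiE_mem[where x = i])
    have "x' i \<in> S" if "i \<in> I" for i
      using PiE_mem[OF x' that] PiE_mem[of x I "\<lambda>_. S" i] x that by (simp split: if_splits)
    then show "x' \<in> {x' \<in> topspace ?Z. restrict x' J = restrict x J}"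
      using x' * by (auto simp: PiE_iff intro!: restrict_ext)
  next
    fix x' assume x': "x' \<in> {x' \<in> topspace ?Z. restrict x' J = restrict x J}"
    then have "x' i = x i" if "i \<in> J" for i
      using that by (metis (mono_tags, lifting) mem_Collect_eq restrict_apply')
    then show "x' \<in> (\<Pi>\<^sub>E i\<in>I. if i \<in> J then {x i} else S)"
      using x' by (auto simp: PiE_iff)
  qed
  ultimately show "openin ?Z {x' \<in> topspace ?Z. restrict x' J = restrict x J}" by simp
next
  fix U and x :: "'a \<Rightarrow> 'b"
  let ?Z = "product_topology (\<lambda>_. discrete_topology S) I"
  assume "openin ?Z U" "x \<in> U"
  then obtain V where V: "finite {i \<in> I. V i \<noteq> S}" "\<And>i. i \<in> I \<Longrightarrow> V i \<subseteq> S"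
      "x \<in> Pi\<^sub>E I V" "Pi\<^sub>E I V \<subseteq> U"
    unfolding openin_product_topology_alt by auto
  have "x' \<in> Pi\<^sub>E I V" if "x' \<in> topspace ?Z"
      "restrict x' {i \<in> I. V i \<noteq> S} = restrict x {i \<in> I. V i \<noteq> S}" for x'
  proof -
    have "x' i \<in> V i" if "i \<in> I" for i
    proof (cases "V i = S")
      case True
      then show ?thesis using \<open>x' \<in> topspace ?Z\<close> that by (auto simp: PiE_iff)
    next
      case False
      then have "x' i = x i"
        using fun_cong[OF \<open>restrict x' _ = _\<close>, of i] that by simp
      then show ?thesis using V(3) that by (auto simp: PiE_iff)
    qed
    then show ?thesis using that(1) by (auto simp: PiE_iff)
  qed
  then show "\<exists>J. finite J \<and> J \<subseteq> I \<and> {x' \<in> topspace ?Z. restrict x' J = restrict x J} \<subseteq> U"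
    using V by (intro exI[of _ "{i \<in> I. V i \<noteq> S}"]) blast
next
  fix J J' :: "'a set" and x x' :: "'a \<Rightarrow> 'b"
  assume "J \<subseteq> J'" "restrict x J' = restrict x' J'"
  then show "restrict x J = restrict x' J"
    by (metis restrict_restrict inf.absorb_iff2)
qed

lemma cylinder_base_prod:
  assumes "cylinder_base Z I \<kappa>" "cylinder_base Y I \<kappa>'"
  shows "cylinder_base (prod_topology Z Y) I (\<lambda>J (x, y). (\<kappa> J x, \<kappa>' J y))"
  unfolding cylinder_base_def
proof (intro conjI allI impI)
  fix J z
  assume J: "finite J" "J \<subseteq> I" and z: "z \<in> topspace (prod_topology Z Y)"
  obtain x y where xy: "z = (x, y)" by fastforce
  have "openin (prod_topology Z Y)
      ({x' \<in> topspace Z. \<kappa> J x' = \<kappa> J x} \<times> {y' \<in> topspace Y. \<kappa>' J y' = \<kappa>' J y})"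
    using cylinder_base_openin[OF assms(1) J] cylinder_base_openin[OF assms(2) J] z
    unfolding openin_prod_Times_iff xy by simp
  moreover have "{x' \<in> topspace Z. \<kappa> J x' = \<kappa> J x} \<times> {y' \<in> topspace Y. \<kappa>' J y' = \<kappa>' J y} =
      {z' \<in> topspace (prod_topology Z Y). (case z' of (x, y) \<Rightarrow> (\<kappa> J x, \<kappa>' J y)) =
         (case z of (x, y) \<Rightarrow> (\<kappa> J x, \<kappa>' J y))}"
    unfolding xy by auto
  ultimately show "openin (prod_topology Z Y) {z' \<in> topspace (prod_topology Z Y).
      (case z' of (x, y) \<Rightarrow> (\<kappa> J x, \<kappa>' J y)) = (case z of (x, y) \<Rightarrow> (\<kappa> J x, \<kappa>' J y))}"
    by simp
next
  fix U z
  assume U: "openin (prod_topology Z Y) U" "z \<in> U"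
  obtain x y where xy: "z = (x, y)" by fastforce
  obtain V W where VW: "openin Z V" "openin Y W" "x \<in> V" "y \<in> W" "V \<times> W \<subseteq> U"
    using U(1)[unfolded openin_prod_topology_alt, rule_format, of x y] U(2) xy by auto
  obtain J where J: "finite J" "J \<subseteq> I" "{x' \<in> topspace Z. \<kappa> J x' = \<kappa> J x} \<subseteq> V"
    by (rule cylinder_base_nhd[OF assms(1) VW(1,3)])
  obtain K where K: "finite K" "K \<subseteq> I" "{y' \<in> topspace Y. \<kappa>' K y' = \<kappa>' K y} \<subseteq> W"
    by (rule cylinder_base_nhd[OF assms(2) VW(2,4)])
  have 1: "\<kappa> (J \<union> K) x' = \<kappa> (J \<union> K) x \<Longrightarrow> \<kappa> J x' = \<kappa> J x" for x'
    using cylinder_base_antimono[OF assms(1) Un_upper1] .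
  have 2: "\<kappa>' (J \<union> K) y' = \<kappa>' (J \<union> K) y \<Longrightarrow> \<kappa>' K y' = \<kappa>' K y" for y'
    using cylinder_base_antimono[OF assms(2) Un_upper2] .
  show "\<exists>J. finite J \<and> J \<subseteq> I \<and> {z' \<in> topspace (prod_topology Z Y).
      (case z' of (x, y) \<Rightarrow> (\<kappa> J x, \<kappa>' J y)) = (case z of (x, y) \<Rightarrow> (\<kappa> J x, \<kappa>' J y))} \<subseteq> U"
  proof (intro exI[of _ "J \<union> K"] conjI subsetI)
    fix z'
    assume "z' \<in> {z' \<in> topspace (prod_topology Z Y). (case z' of (x, y) \<Rightarrow> (\<kappa> (J \<union> K) x, \<kappa>' (J \<union> K) y)) =
        (case z of (x, y) \<Rightarrow> (\<kappa> (J \<union> K) x, \<kappa>' (J \<union> K) y))}"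
    then have "fst z' \<in> topspace Z" "\<kappa> J (fst z') = \<kappa> J x" "snd z' \<in> topspace Y" "\<kappa>' K (snd z') = \<kappa>' K y"
      using 1[of "fst z'"] 2[of "snd z'"] unfolding xy by (auto simp: split_beta)
    then have "(fst z', snd z') \<in> V \<times> W" using J(3) K(3) by blast
    then show "z' \<in> U" using VW(5) by auto
  qed (use J K in auto)
next
  fix J J' z z'
  assume "J \<subseteq> J'" "(case z of (x, y) \<Rightarrow> (\<kappa> J' x, \<kappa>' J' y)) = (case z' of (x, y) \<Rightarrow> (\<kappa> J' x, \<kappa>' J' y))"
  then show "(case z of (x, y) \<Rightarrow> (\<kappa> J x, \<kappa>' J y)) = (case z' of (x, y) \<Rightarrow> (\<kappa> J x, \<kappa>' J y))"
    using cylinder_base_antimono[OF assms(1) \<open>J \<subseteq> J'\<close>, of "fst z" "fst z'"]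
      cylinder_base_antimono[OF assms(2) \<open>J \<subseteq> J'\<close>, of "snd z" "snd z'"]
    by (simp add: split_beta)
qed

text \<open>Around each point \<open>f\<close> is constant on some cylinder. Finitely many of these cylinders cover the space, and the
  union of their coordinate sets serves for all points at once.\<close>

lemma continuous_map_factors_cylinder:
  assumes base: "cylinder_base Z I \<kappa>" and Z: "compact_space Z"
    and f: "continuous_map Z (discrete_topology S) f"
  obtains J where "finite J" "J \<subseteq> I"
    "\<And>x x'. \<lbrakk>x \<in> topspace Z; x' \<in> topspace Z; \<kappa> J x = \<kappa> J x'\<rbrakk> \<Longrightarrow> f x = f x'"
proof -
  have fin: "\<exists>J. finite J \<and> J \<subseteq> I \<and> {x' \<in> topspace Z. \<kappa> J x' = \<kappa> J x} \<subseteq> {x' \<in> topspace Z. f x' = f x}"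
    if x: "x \<in> topspace Z" for x
  proof -
    have "f x \<in> S" using f x by (auto simp: continuous_map_def)
    then have "openin Z {x' \<in> topspace Z. f x' \<in> {f x}}"
      using f unfolding continuous_map by (metis openin_discrete_topology insert_subset empty_subsetI)
    then obtain J where "finite J" "J \<subseteq> I"
        "{x' \<in> topspace Z. \<kappa> J x' = \<kappa> J x} \<subseteq> {x' \<in> topspace Z. f x' \<in> {f x}}"
      by (rule cylinder_base_nhd[OF base, of _ x]) (simp_all add: x)
    then show ?thesis by (intro exI[of _ J]) auto
  qed
  define J where "J x = (SOME J. finite J \<and> J \<subseteq> I \<and>
      {x' \<in> topspace Z. \<kappa> J x' = \<kappa> J x} \<subseteq> {x' \<in> topspace Z. f x' = f x})" for x
  have J: "finite (J x)" "J x \<subseteq> I" "{x' \<in> topspace Z. \<kappa> (J x) x' = \<kappa> (J x) x} \<subseteq> {x' \<in> topspace Z. f x' = f x}"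
    if "x \<in> topspace Z" for x
    using someI_ex[OF fin[OF that]] unfolding J_def by blast+
  define C where "C x = {x' \<in> topspace Z. \<kappa> (J x) x' = \<kappa> (J x) x}" for x
  have "\<forall>U \<in> C ` topspace Z. openin Z U"
    using cylinder_base_openin[OF base] J unfolding C_def by blast
  moreover have "topspace Z \<subseteq> \<Union> (C ` topspace Z)" by (auto simp: C_def)
  ultimately obtain F where F: "finite F" "F \<subseteq> C ` topspace Z" "topspace Z \<subseteq> \<Union>F"
    using Z unfolding compact_space_alt by meson
  then obtain A where A: "finite A" "A \<subseteq> topspace Z" "topspace Z \<subseteq> \<Union> (C ` A)"
    by (metis finite_subset_image)
  show ?thesis
  proof
    show "finite (\<Union> (J ` A))" "\<Union> (J ` A) \<subseteq> I" using A J by blast+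
    fix x x' assume x: "x \<in> topspace Z" "x' \<in> topspace Z" "\<kappa> (\<Union> (J ` A)) x = \<kappa> (\<Union> (J ` A)) x'"
    then obtain a where a: "a \<in> A" "x \<in> C a" using A by blast
    have "J a \<subseteq> \<Union> (J ` A)" using a by blast
    then have "\<kappa> (J a) x = \<kappa> (J a) x'"
      by (rule cylinder_base_antimono[OF base _ x(3)])
    then have "x' \<in> C a" using a x by (simp add: C_def)
    moreover have "C a \<subseteq> {x' \<in> topspace Z. f x' = f a}"
      using a A J(3)[of a] unfolding C_def by auto
    ultimately have "f x = f a" "f x' = f a" using a by blast+
    then show "f x = f x'" by simp
  qed
qed

lemma continuous_map_if_factors_cylinder:
  assumes base: "cylinder_base Z I \<kappa>" and J: "finite J" "J \<subseteq> I"
    and f: "\<And>x. x \<in> topspace Z \<Longrightarrow> f x \<in> S"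
      "\<And>x x'. \<lbrakk>x \<in> topspace Z; x' \<in> topspace Z; \<kappa> J x = \<kappa> J x'\<rbrakk> \<Longrightarrow> f x = f x'"
  shows "continuous_map Z (discrete_topology S) f"
  unfolding continuous_map
proof (intro conjI allI impI)
  show "f ` topspace Z \<subseteq> topspace (discrete_topology S)" using f(1) by auto
  fix U
  show "openin Z {x \<in> topspace Z. f x \<in> U}"
  proof (subst openin_subopen, intro ballI)
    fix x assume x: "x \<in> {x \<in> topspace Z. f x \<in> U}"
    let ?C = "{x' \<in> topspace Z. \<kappa> J x' = \<kappa> J x}"
    have "openin Z ?C" using cylinder_base_openin[OF base J] x by simp
    moreover have "?C \<subseteq> {x \<in> topspace Z. f x \<in> U}"
    proof
      fix x' assume "x' \<in> ?C"
      then show "x' \<in> {x \<in> topspace Z. f x \<in> U}" using f(2)[of x' x] x by auto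
    qed
    ultimately show "\<exists>T. openin Z T \<and> x \<in> T \<and> T \<subseteq> {x \<in> topspace Z. f x \<in> U}"
      using x by (intro exI[of _ ?C]) auto
  qed
qed

section \<open>Cochains of degree one and two\<close>

definition cochain1 :: "('g, 'm) topological_group_scheme \<Rightarrow> ('g \<Rightarrow> int) \<Rightarrow> (nat \<Rightarrow> 'g) \<Rightarrow> int" where
  "cochain1 G u = (\<lambda>x \<in> tuples 1 G. u (x 0))"

definition cochain2 :: "('g, 'm) topological_group_scheme \<Rightarrow> ('g \<Rightarrow> 'g \<Rightarrow> int) \<Rightarrow> (nat \<Rightarrow> 'g) \<Rightarrow> int"
  where "cochain2 G F = (\<lambda>x \<in> tuples 2 G. F (x 0) (x 1))"

abbreviation tup1 :: "'g \<Rightarrow> nat \<Rightarrow> 'g" where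
  "tup1 g \<equiv> (\<lambda>i \<in> {..<1}. g)"

abbreviation tup2 :: "'g \<Rightarrow> 'g \<Rightarrow> nat \<Rightarrow> 'g" where
  "tup2 g h \<equiv> (\<lambda>i \<in> {..<2}. if i = 0 then g else h)"

abbreviation tup3 :: "'g \<Rightarrow> 'g \<Rightarrow> 'g \<Rightarrow> nat \<Rightarrow> 'g" where
  "tup3 g h k \<equiv> (\<lambda>i \<in> {..<3}. if i = 0 then g else if i = 1 then h else k)"

lemma tuples1_iff: "x \<in> tuples 1 G \<longleftrightarrow> (\<exists>g \<in> carrier G. x = tup1 g)"
  by (auto simp: tuples_def PiE_iff extensional_def fun_eq_iff intro!: bexI[of _ "x 0"])

lemma tuples2_iff: "x \<in> tuples 2 G \<longleftrightarrow> (\<exists>g \<in> carrier G. \<exists>h \<in> carrier G. x = tup2 g h)"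
proof
  assume x: "x \<in> tuples 2 G"
  have "x = tup2 (x 0) (x 1)"
    using x by (auto simp: tuples_def PiE_iff extensional_def fun_eq_iff less_2_cases_iff)
  moreover have "x 0 \<in> carrier G" "x 1 \<in> carrier G"
    using x by (simp_all add: tuples_def PiE_iff)
  ultimately show "\<exists>g \<in> carrier G. \<exists>h \<in> carrier G. x = tup2 g h" by blast
qed (auto simp: tuples_def PiE_iff)

lemma tuples3_iff:
  "x \<in> tuples 3 G \<longleftrightarrow> (\<exists>g \<in> carrier G. \<exists>h \<in> carrier G. \<exists>k \<in> carrier G. x = tup3 g h k)"
proof
  assume x: "x \<in> tuples 3 G"
  have "i = 0 \<or> i = 1 \<or> i = 2" if "i < 3" for i :: nat using that by linarith
  then have "x = tup3 (x 0) (x 1) (x 2)"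
    using x by (force simp: tuples_def PiE_iff extensional_def fun_eq_iff)
  moreover have "x 0 \<in> carrier G" "x 1 \<in> carrier G" "x 2 \<in> carrier G"
    using x by (simp_all add: tuples_def PiE_iff)
  ultimately show "\<exists>g \<in> carrier G. \<exists>h \<in> carrier G. \<exists>k \<in> carrier G. x = tup3 g h k" by blast
qed (auto simp: tuples_def PiE_iff)

lemma cochain1_tup1 [simp]: "g \<in> carrier G \<Longrightarrow> cochain1 G u (tup1 g) = u g"
  by (auto simp: cochain1_def tuples_def)

lemma cochain2_tup2 [simp]:
  "\<lbrakk>g \<in> carrier G; h \<in> carrier G\<rbrakk> \<Longrightarrow> cochain2 G F (tup2 g h) = F g h"
  by (auto simp: cochain2_def tuples_def)

lemma cochain1_cong: "(\<And>g. g \<in> carrier G \<Longrightarrow> u g = v g) \<Longrightarrow> cochain1 G u = cochain1 G v"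
  by (auto simp: cochain1_def tuples_def intro!: restrict_ext)

lemma cochain2_cong:
  "(\<And>g h. \<lbrakk>g \<in> carrier G; h \<in> carrier G\<rbrakk> \<Longrightarrow> F g h = F' g h) \<Longrightarrow> cochain2 G F = cochain2 G F'"
  unfolding cochain2_def by (rule restrict_ext) (simp add: tuples_def PiE_iff)

lemma mult_cochain2:
  "cochain2 G F \<otimes>\<^bsub>cochain_group p 2 G\<^esub> cochain2 G F' = cochain2 G (\<lambda>g h. (F g h + F' g h) mod int p)"
  by (auto simp: cochain_group_def cochain2_def)

lemma one_cochain2: "\<one>\<^bsub>cochain_group p 2 G\<^esub> = cochain2 G (\<lambda>g h. 0)"
  by (auto simp: cochain_group_def cochain2_def)

text \<open>The coboundary of a continuous 1-cochain is again continuous because multiplication is continuous; associativity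
  makes it a cocycle.\<close>

locale mod_p_cochains = monoid G for G :: "('g, 'm) topological_group_scheme" (structure) +
  fixes p :: nat
  assumes p_pos: "0 < p"
    and topspace_topol: "topspace (topol G) = carrier G"
    and continuous_mult: "continuous_map (prod_topology (topol G) (topol G)) (topol G) (\<lambda>z. fst z \<otimes> snd z)"
begin

abbreviation continuous1 :: "('g \<Rightarrow> int) \<Rightarrow> bool" where
  "continuous1 u \<equiv> continuous_map (topol G) (discrete_topology {0..<int p}) u"

abbreviation continuous2 :: "('g \<Rightarrow> 'g \<Rightarrow> int) \<Rightarrow> bool" where
  "continuous2 F \<equiv>
     continuous_map (prod_topology (topol G) (topol G)) (discrete_topology {0..<int p}) (\<lambda>z. F (fst z) (snd z))"

lemma continuous1_range: "\<lbrakk>continuous1 u; g \<in> carrier G\<rbrakk> \<Longrightarrow> 0 \<le> u g \<and> u g < int p"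
  using topspace_topol by (auto simp: continuous_map_def)

lemma continuous2_range:
  "\<lbrakk>continuous2 F; g \<in> carrier G; h \<in> carrier G\<rbrakk> \<Longrightarrow> 0 \<le> F g h \<and> F g h < int p"
  using topspace_topol by (force simp: continuous_map_def)

lemma continuous2_compose:
  assumes "continuous_map (prod_topology (topol G) (topol G)) (topol G) (\<lambda>z. c (fst z) (snd z))" "continuous1 u"
  shows "continuous2 (\<lambda>g h. u (c g h))"
  using continuous_map_compose[OF assms] by (simp add: o_def)

lemma continuous2_combine:
  assumes "continuous2 F" "continuous2 F'"
  shows "continuous2 (\<lambda>g h. c (F g h) (F' g h) mod int p)"
  using continuous_map_into_discrete_combine[OF assms, of "\<lambda>a b. c a b mod int p"] p_pos
  by simp

lemma continuous2_coboundary: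
  assumes "continuous1 u"
  shows "continuous2 (\<lambda>g h. (u h - u (g \<otimes> h) + u g) mod int p)"
proof -
  have fst: "continuous2 (\<lambda>g h. u g)" and snd: "continuous2 (\<lambda>g h. u h)"
    using continuous2_compose[OF _ assms, of "\<lambda>g h. g"] continuous2_compose[OF _ assms, of "\<lambda>g h. h"]
    by (simp_all add: continuous_map_fst continuous_map_snd)
  have mult: "continuous2 (\<lambda>g h. u (g \<otimes> h))"
    using continuous2_compose[OF continuous_mult assms] .
  have "continuous2 (\<lambda>g h. ((u h - u (g \<otimes> h)) mod int p + u g) mod int p)"
    using continuous2_combine[OF continuous2_combine[OF snd mult, of "(-)"] fst, of "(+)"] .
  then show ?thesis by (simp add: mod_simps)
qed

lemma cochain1_in_carrier_iff:
  "f \<in> carrier (cochain_group p 1 G) \<longleftrightarrow> (\<exists>u. continuous1 u \<and> f = cochain1 G u)"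
proof
  assume f: "f \<in> carrier (cochain_group p 1 G)"
  have "continuous_map (topol G) (product_topology (\<lambda>_. topol G) {..<1::nat}) tup1"
    by (auto simp: continuous_map_componentwise)
  then have "continuous1 (f \<circ> tup1)"
    using f by (intro continuous_map_compose) (auto simp: cochain_group_def)
  moreover have "f = cochain1 G (f \<circ> tup1)"
  proof
    fix x
    show "f x = cochain1 G (f \<circ> tup1) x"
    proof (cases "x \<in> tuples 1 G")
      case True
      then obtain g where "g \<in> carrier G" "x = tup1 g" unfolding tuples1_iff by blast
      then show ?thesis using cochain1_tup1[of g G "f \<circ> tup1"] by simp
    next
      case False
      then show ?thesis using f by (auto simp: cochain1_def cochain_group_def extensional_def)
    qed
  qed
  ultimately show "\<exists>u. continuous1 u \<and> f = cochain1 G u" by blast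
next
  assume "\<exists>u. continuous1 u \<and> f = cochain1 G u"
  then obtain u where u: "continuous1 u" "f = cochain1 G u" by blast
  have "continuous_map (product_topology (\<lambda>_. topol G) {..<1::nat}) (discrete_topology {0..<int p})
      (u \<circ> (\<lambda>x. x 0))"
    using u by (intro continuous_map_compose[of _ "topol G"] continuous_map_product_projection) auto
  then have "continuous_map (product_topology (\<lambda>_. topol G) {..<1::nat}) (discrete_topology {0..<int p}) f"
    by (rule continuous_map_eq) (auto simp: u cochain1_def tuples_def topspace_topol)
  then show "f \<in> carrier (cochain_group p 1 G)"
    by (auto simp: cochain_group_def u cochain1_def)
qed

lemma cochain2_in_carrier_iff:
  "f \<in> carrier (cochain_group p 2 G) \<longleftrightarrow> (\<exists>F. continuous2 F \<and> f = cochain2 G F)"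
proof
  assume f: "f \<in> carrier (cochain_group p 2 G)"
  have "continuous_map (prod_topology (topol G) (topol G)) (product_topology (\<lambda>_. topol G) {..<2::nat})
      (\<lambda>z. tup2 (fst z) (snd z))"
    by (auto simp: continuous_map_componentwise continuous_map_fst continuous_map_snd)
  then have "continuous_map (prod_topology (topol G) (topol G)) (discrete_topology {0..<int p})
      (f \<circ> (\<lambda>z. tup2 (fst z) (snd z)))"
    using f by (intro continuous_map_compose) (auto simp: cochain_group_def)
  then have "continuous2 (\<lambda>g h. f (tup2 g h))" by (simp add: o_def)
  moreover have "f = cochain2 G (\<lambda>g h. f (tup2 g h))"
  proof
    fix x
    show "f x = cochain2 G (\<lambda>g h. f (tup2 g h)) x"
    proof (cases "x \<in> tuples 2 G")
      case True
      then obtain g h where "g \<in> carrier G" "h \<in> carrier G" "x = tup2 g h" unfolding tuples2_iff by blast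
      then show ?thesis using cochain2_tup2[of g G h "\<lambda>g h. f (tup2 g h)"] by simp
    next
      case False
      then show ?thesis using f by (auto simp: cochain2_def cochain_group_def extensional_def)
    qed
  qed
  ultimately show "\<exists>F. continuous2 F \<and> f = cochain2 G F"
    by (intro exI[of _ "\<lambda>g h. f (tup2 g h)"] conjI)
next
  assume "\<exists>F. continuous2 F \<and> f = cochain2 G F"
  then obtain F where F: "continuous2 F" "f = cochain2 G F" by blast
  have "continuous_map (product_topology (\<lambda>_. topol G) {..<2::nat}) (discrete_topology {0..<int p})
      ((\<lambda>z. F (fst z) (snd z)) \<circ> (\<lambda>x. (x 0, x 1)))"
    using F by (intro continuous_map_compose[of _ "prod_topology (topol G) (topol G)"]
        continuous_map_pairedI continuous_map_product_projection) auto
  then have "continuous_map (product_topology (\<lambda>_. topol G) {..<2::nat}) (discrete_topology {0..<int p}) f"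
    by (rule continuous_map_eq) (auto simp: F cochain2_def tuples_def topspace_topol)
  then show "f \<in> carrier (cochain_group p 2 G)"
    by (auto simp: cochain_group_def F cochain2_def)
qed

lemma coboundary_cochain1:
  "coboundary p 1 G (cochain1 G u) = cochain2 G (\<lambda>g h. (u h - u (g \<otimes> h) + u g) mod int p)"
proof
  fix x
  show "coboundary p 1 G (cochain1 G u) x = cochain2 G (\<lambda>g h. (u h - u (g \<otimes> h) + u g) mod int p) x"
  proof (cases "x \<in> tuples 2 G")
    case True
    then obtain g h where gh: "g \<in> carrier G" "h \<in> carrier G" "x = tup2 g h" unfolding tuples2_iff by blast
    have args: "(\<lambda>i \<in> {..<1}. x (Suc i)) = tup1 h" "(\<lambda>i \<in> {..<1}. x i) = tup1 g"
      "(\<lambda>i \<in> {..<1}. if i < 0 then x i else if i = 0 then x 0 \<otimes> x (Suc 0) else x (Suc i)) = tup1 (g \<otimes> h)"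
      by (auto simp: fun_eq_iff gh(3))
    have sum: "(\<Sum>j<1. c j) = c 0" for c :: "nat \<Rightarrow> int" by simp
    have x: "x \<in> tuples (Suc 1) G" using True by (simp add: numeral_2_eq_2)
    have "coboundary p 1 G (cochain1 G u) x = (u h - u (g \<otimes> h) + u g) mod int p"
      unfolding coboundary_def restrict_apply'[OF x] sum args using gh(1,2) by (simp del: One_nat_def)
    then show ?thesis using gh by (simp del: restrict_apply)
  next
    case False
    then show ?thesis by (simp add: coboundary_def cochain2_def numeral_2_eq_2)
  qed
qed

lemma coboundary_cochain2:
  assumes "g \<in> carrier G" "h \<in> carrier G" "k \<in> carrier G"
  shows "coboundary p 2 G (cochain2 G F) (tup3 g h k) =
    (F h k - F (g \<otimes> h) k + F g (h \<otimes> k) - F g h) mod int p"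
proof -
  define x where "x = tup3 g h k"
  have args: "(\<lambda>i \<in> {..<2}. x (Suc i)) = tup2 h k" "(\<lambda>i \<in> {..<2}. x i) = tup2 g h"
    "(\<lambda>i \<in> {..<2}. if i < 0 then x i else if i = 0 then x 0 \<otimes> x (Suc 0) else x (Suc i)) = tup2 (g \<otimes> h) k"
    "(\<lambda>i \<in> {..<2}. if i < 1 then x i else if i = 1 then x 1 \<otimes> x (Suc 1) else x (Suc i)) = tup2 g (h \<otimes> k)"
    by (auto simp: fun_eq_iff x_def)
  have sum: "(\<Sum>j<2. c j) = c 0 + c 1" for c :: "nat \<Rightarrow> int"
    by (simp add: numeral_2_eq_2)
  have x: "x \<in> tuples (Suc 2) G"
    using assms tuples3_iff[of x G] unfolding x_def by (auto simp: numeral_3_eq_3 numeral_2_eq_2)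
  have "coboundary p 2 G (cochain2 G F) x = (F h k - F (g \<otimes> h) k + F g (h \<otimes> k) - F g h) mod int p"
    unfolding coboundary_def restrict_apply'[OF x] sum args using assms by (simp add: algebra_simps)
  then show ?thesis unfolding x_def .
qed

text \<open>The cocycle condition is stated as a congruence, so that it applies to integer valued functions that need not
  be reduced modulo \<open>p\<close>.\<close>

definition is_cocycle2 :: "('g \<Rightarrow> 'g \<Rightarrow> int) \<Rightarrow> bool" where
  "is_cocycle2 F \<longleftrightarrow> (\<forall>g \<in> carrier G. \<forall>h \<in> carrier G. \<forall>k \<in> carrier G.
     int p dvd F h k - F (g \<otimes> h) k + F g (h \<otimes> k) - F g h)"

lemma cochain2_in_cocycles_iff:
  assumes "continuous2 F"
  shows "cochain2 G F \<in> cocycles p 2 G \<longleftrightarrow> is_cocycle2 F"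
proof -
  have "coboundary p 2 G (cochain2 G F) = \<one>\<^bsub>cochain_group p 3 G\<^esub> \<longleftrightarrow>
      (\<forall>x \<in> tuples 3 G. coboundary p 2 G (cochain2 G F) x = 0)"
    unfolding cochain_group_def coboundary_def by (auto simp: fun_eq_iff numeral_3_eq_3 numeral_2_eq_2)
  also have "\<dots> \<longleftrightarrow> is_cocycle2 F"
  proof -
    have "(\<forall>x \<in> tuples 3 G. c x = 0) \<longleftrightarrow>
        (\<forall>g \<in> carrier G. \<forall>h \<in> carrier G. \<forall>k \<in> carrier G. c (tup3 g h k) = 0)" for c :: "_ \<Rightarrow> int"
      unfolding Ball_def tuples3_iff by blast
    then show ?thesis
      by (simp only: is_cocycle2_def dvd_eq_mod_eq_0 coboundary_cochain2 cong: ball_cong)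
  qed
  finally show ?thesis
    using assms cochain2_in_carrier_iff by (auto simp: cocycles_def numeral_3_eq_3)
qed

lemma cocycles2_iff: "f \<in> cocycles p 2 G \<longleftrightarrow> (\<exists>F. continuous2 F \<and> is_cocycle2 F \<and> f = cochain2 G F)"
  using cochain2_in_cocycles_iff cochain2_in_carrier_iff[of f] unfolding cocycles_def by blast

end

section \<open>The group of degree two cohomology classes, and cup products of characters\<close>

context mod_p_cochains begin

abbreviation cocycle_group :: "((nat \<Rightarrow> 'g) \<Rightarrow> int) monoid" where
  "cocycle_group \<equiv> (cochain_group p 2 G)\<lparr>carrier := cocycles p 2 G\<rparr>"

abbreviation class2 :: "('g \<Rightarrow> 'g \<Rightarrow> int) \<Rightarrow> ((nat \<Rightarrow> 'g) \<Rightarrow> int) set" where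
  "class2 F \<equiv> cohomology_class p 2 G (cochain2 G F)"

lemma is_cocycle2_add:
  assumes "is_cocycle2 F" "is_cocycle2 F'"
  shows "is_cocycle2 (\<lambda>g h. (F g h + F' g h) mod int p)"
  unfolding is_cocycle2_def
proof (intro ballI)
  fix g h k assume "g \<in> carrier G" "h \<in> carrier G" "k \<in> carrier G"
  then have "int p dvd (F h k - F (g \<otimes> h) k + F g (h \<otimes> k) - F g h) +
      (F' h k - F' (g \<otimes> h) k + F' g (h \<otimes> k) - F' g h)"
    using assms unfolding is_cocycle2_def by (intro dvd_add) blast+
  moreover have c: "[(F h k + F' h k) mod int p - (F (g \<otimes> h) k + F' (g \<otimes> h) k) mod int p +
        (F g (h \<otimes> k) + F' g (h \<otimes> k)) mod int p - (F g h + F' g h) mod int p =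
      (F h k + F' h k) - (F (g \<otimes> h) k + F' (g \<otimes> h) k) + (F g (h \<otimes> k) + F' g (h \<otimes> k)) -
        (F g h + F' g h)] (mod int p)"
    by (intro cong_add cong_diff) simp_all
  ultimately show "int p dvd (F h k + F' h k) mod int p - (F (g \<otimes> h) k + F' (g \<otimes> h) k) mod int p +
      (F g (h \<otimes> k) + F' g (h \<otimes> k)) mod int p - (F g h + F' g h) mod int p"
    unfolding cong_dvd_iff[OF c] by (simp add: algebra_simps)
qed

lemma is_cocycle2_minus:
  assumes "is_cocycle2 F"
  shows "is_cocycle2 (\<lambda>g h. (- F g h) mod int p)"
  unfolding is_cocycle2_def
proof (intro ballI)
  fix g h k assume "g \<in> carrier G" "h \<in> carrier G" "k \<in> carrier G"
  then have "int p dvd - (F h k - F (g \<otimes> h) k + F g (h \<otimes> k) - F g h)"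
    using assms unfolding is_cocycle2_def dvd_minus_iff by blast
  moreover have c: "[(- F h k) mod int p - (- F (g \<otimes> h) k) mod int p +
        (- F g (h \<otimes> k)) mod int p - (- F g h) mod int p =
      - F h k - (- F (g \<otimes> h) k) + (- F g (h \<otimes> k)) - (- F g h)] (mod int p)"
    by (intro cong_add cong_diff) simp_all
  ultimately show "int p dvd (- F h k) mod int p - (- F (g \<otimes> h) k) mod int p +
      (- F g (h \<otimes> k)) mod int p - (- F g h) mod int p"
    unfolding cong_dvd_iff[OF c] by (simp add: algebra_simps)
qed

lemma is_cocycle2_coboundary: "is_cocycle2 (\<lambda>g h. (u h - u (g \<otimes> h) + u g) mod int p)"
  unfolding is_cocycle2_def
proof (intro ballI)
  fix g h k assume ghk: "g \<in> carrier G" "h \<in> carrier G" "k \<in> carrier G"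
  have c: "[(u k - u (h \<otimes> k) + u h) mod int p - (u k - u (g \<otimes> h \<otimes> k) + u (g \<otimes> h)) mod int p +
        (u (h \<otimes> k) - u (g \<otimes> (h \<otimes> k)) + u g) mod int p - (u h - u (g \<otimes> h) + u g) mod int p =
      (u k - u (h \<otimes> k) + u h) - (u k - u (g \<otimes> h \<otimes> k) + u (g \<otimes> h)) +
        (u (h \<otimes> k) - u (g \<otimes> (h \<otimes> k)) + u g) - (u h - u (g \<otimes> h) + u g)] (mod int p)"
    by (intro cong_add cong_diff) simp_all
  show "int p dvd (u k - u (h \<otimes> k) + u h) mod int p - (u k - u (g \<otimes> h \<otimes> k) + u (g \<otimes> h)) mod int p +
        (u (h \<otimes> k) - u (g \<otimes> (h \<otimes> k)) + u g) mod int p - (u h - u (g \<otimes> h) + u g) mod int p"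
    unfolding cong_dvd_iff[OF c] using ghk by (simp add: m_assoc)
qed

lemma continuous2_minus: "continuous2 F \<Longrightarrow> continuous2 (\<lambda>g h. (- F g h) mod int p)"
  using continuous2_combine[of F F "\<lambda>a b. - a"] by simp

lemma continuous2_add:
  "\<lbrakk>continuous2 F; continuous2 F'\<rbrakk> \<Longrightarrow> continuous2 (\<lambda>g h. (F g h + F' g h) mod int p)"
  using continuous2_combine[of F F' "(+)"] by simp

lemma continuous2_zero: "continuous2 (\<lambda>g h. 0)"
  using p_pos by simp

lemma cochain2_mod_cancel:
  assumes "continuous2 F"
  shows "cochain2 G (\<lambda>g h. F g h mod int p) = cochain2 G F"
  using continuous2_range[OF assms] by (intro cochain2_cong) (simp add: mod_pos_pos_trivial)

lemma carrier_cocycle_groupE: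
  assumes "f \<in> carrier cocycle_group"
  obtains F where "continuous2 F" "is_cocycle2 F" "f = cochain2 G F"
  using assms cocycles2_iff by auto

lemma cochain2_in_cocycle_group:
  "\<lbrakk>continuous2 F; is_cocycle2 F\<rbrakk> \<Longrightarrow> cochain2 G F \<in> carrier cocycle_group"
  using cocycles2_iff by auto

lemma mult_cocycle_group:
  "cochain2 G F \<otimes>\<^bsub>cocycle_group\<^esub> cochain2 G F' = cochain2 G (\<lambda>g h. (F g h + F' g h) mod int p)"
  using mult_cochain2 by simp

lemma one_cocycle_group: "\<one>\<^bsub>cocycle_group\<^esub> = cochain2 G (\<lambda>g h. 0)"
  using one_cochain2 by simp

lemma cochain2_minus_inverse:
  "cochain2 G (\<lambda>g h. (- F g h) mod int p) \<otimes>\<^bsub>cocycle_group\<^esub> cochain2 G F = \<one>\<^bsub>cocycle_group\<^esub>"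
  unfolding mult_cocycle_group one_cocycle_group by (simp add: mod_simps)

lemma comm_group_cocycle_group: "comm_group cocycle_group"
proof (rule comm_groupI)
  fix f f' assume f: "f \<in> carrier cocycle_group" and f': "f' \<in> carrier cocycle_group"
  obtain F where F: "continuous2 F" "is_cocycle2 F" "f = cochain2 G F"
    by (rule carrier_cocycle_groupE[OF f])
  obtain F' where F': "continuous2 F'" "is_cocycle2 F'" "f' = cochain2 G F'"
    by (rule carrier_cocycle_groupE[OF f'])
  show "f \<otimes>\<^bsub>cocycle_group\<^esub> f' \<in> carrier cocycle_group"
    unfolding F(3) F'(3) mult_cocycle_group
    using F F' by (intro cochain2_in_cocycle_group continuous2_add is_cocycle2_add)
  show "f \<otimes>\<^bsub>cocycle_group\<^esub> f' = f' \<otimes>\<^bsub>cocycle_group\<^esub> f"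
    unfolding F(3) F'(3) mult_cocycle_group by (simp add: add.commute)
  show "\<one>\<^bsub>cocycle_group\<^esub> \<otimes>\<^bsub>cocycle_group\<^esub> f = f"
    unfolding F(3) one_cocycle_group mult_cocycle_group using F(1) by (simp add: cochain2_mod_cancel)
  show "\<exists>g \<in> carrier cocycle_group. g \<otimes>\<^bsub>cocycle_group\<^esub> f = \<one>\<^bsub>cocycle_group\<^esub>"
    unfolding F(3)
    by (intro bexI[of _ "cochain2 G (\<lambda>g h. (- F g h) mod int p)"] cochain2_minus_inverse
        cochain2_in_cocycle_group continuous2_minus is_cocycle2_minus F)
  fix f'' assume f'': "f'' \<in> carrier cocycle_group"
  obtain F'' where F'': "f'' = cochain2 G F''"
    by (rule carrier_cocycle_groupE[OF f''])
  show "f \<otimes>\<^bsub>cocycle_group\<^esub> f' \<otimes>\<^bsub>cocycle_group\<^esub> f'' = f \<otimes>\<^bsub>cocycle_group\<^esub> (f' \<otimes>\<^bsub>cocycle_group\<^esub> f'')"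
    unfolding F(3) F'(3) F'' mult_cocycle_group by (simp add: mod_simps add.assoc)
next
  show "\<one>\<^bsub>cocycle_group\<^esub> \<in> carrier cocycle_group"
    unfolding one_cocycle_group
    by (intro cochain2_in_cocycle_group continuous2_zero) (simp add: is_cocycle2_def)
qed

lemma coboundaries2_iff:
  "f \<in> coboundaries p 2 G \<longleftrightarrow>
     (\<exists>u. continuous1 u \<and> f = cochain2 G (\<lambda>g h. (u h - u (g \<otimes> h) + u g) mod int p))"
proof -
  have image: "coboundaries p 2 G = coboundary p 1 G ` carrier (cochain_group p 1 G)"
    by (simp add: coboundaries_def numeral_2_eq_2)
  have ex: "(\<exists>c. (\<exists>u. P u \<and> c = k u) \<and> Q c) \<longleftrightarrow> (\<exists>u. P u \<and> Q (k u))" for P Q and k :: "_ \<Rightarrow> (nat \<Rightarrow> 'g) \<Rightarrow> int"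
    by blast
  show ?thesis
    unfolding image image_iff Bex_def cochain1_in_carrier_iff coboundary_cochain1[symmetric] by (rule ex)
qed

lemma continuous1_add: "\<lbrakk>continuous1 u; continuous1 v\<rbrakk> \<Longrightarrow> continuous1 (\<lambda>g. (u g + v g) mod int p)"
  using continuous_map_into_discrete_combine[of _ _ u _ v "\<lambda>a b. (a + b) mod int p" "{0..<int p}"] p_pos
  by simp

lemma continuous1_minus: "continuous1 u \<Longrightarrow> continuous1 (\<lambda>g. (- u g) mod int p)"
  using continuous_map_into_discrete_combine[of _ _ u _ u "\<lambda>a b. (- a) mod int p" "{0..<int p}"] p_pos
  by simp

lemma subgroup_coboundaries2: "subgroup (coboundaries p 2 G) cocycle_group"
proof -
  interpret C: comm_group cocycle_group by (rule comm_group_cocycle_group)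
  have sub: "coboundaries p 2 G \<subseteq> carrier cocycle_group"
    unfolding subset_iff coboundaries2_iff
    by (auto simp only: intro!: cochain2_in_cocycle_group continuous2_coboundary is_cocycle2_coboundary)
  show ?thesis
  proof (rule C.subgroupI[OF sub])
    have "continuous1 (\<lambda>g. 0)" using p_pos by simp
    then show "coboundaries p 2 G \<noteq> {}" using coboundaries2_iff by blast
  next
    fix a assume a: "a \<in> coboundaries p 2 G"
    then obtain u where u: "continuous1 u" "a = cochain2 G (\<lambda>g h. (u h - u (g \<otimes> h) + u g) mod int p)"
      unfolding coboundaries2_iff by blast
    let ?b = "cochain2 G (\<lambda>g h. ((- u h) mod int p - (- u (g \<otimes> h)) mod int p + (- u g) mod int p) mod int p)"
    have b: "?b \<in> coboundaries p 2 G"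
      unfolding coboundaries2_iff using continuous1_minus[OF u(1)] by blast
    have "?b \<otimes>\<^bsub>cocycle_group\<^esub> a = \<one>\<^bsub>cocycle_group\<^esub>"
      unfolding u(2) mult_cocycle_group one_cocycle_group by (simp add: mod_simps)
    then have "inv\<^bsub>cocycle_group\<^esub> a = ?b"
      using C.inv_equality a b sub by blast
    then show "inv\<^bsub>cocycle_group\<^esub> a \<in> coboundaries p 2 G" using b by simp
  next
    fix a b assume "a \<in> coboundaries p 2 G" "b \<in> coboundaries p 2 G"
    then obtain u v where u: "continuous1 u" "a = cochain2 G (\<lambda>g h. (u h - u (g \<otimes> h) + u g) mod int p)"
        and v: "continuous1 v" "b = cochain2 G (\<lambda>g h. (v h - v (g \<otimes> h) + v g) mod int p)"
      unfolding coboundaries2_iff by blast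
    have "a \<otimes>\<^bsub>cocycle_group\<^esub> b = cochain2 G (\<lambda>g h. ((u h + v h) mod int p - (u (g \<otimes> h) + v (g \<otimes> h)) mod int p
        + (u g + v g) mod int p) mod int p)"
      unfolding u v mult_cocycle_group
    proof (intro cochain2_cong)
      fix g h
      have "[(u h - u (g \<otimes> h) + u g) mod int p + (v h - v (g \<otimes> h) + v g) mod int p =
          (u h - u (g \<otimes> h) + u g) + (v h - v (g \<otimes> h) + v g)] (mod int p)"
        by (intro cong_add) simp_all
      moreover have "[(u h + v h) mod int p - (u (g \<otimes> h) + v (g \<otimes> h)) mod int p + (u g + v g) mod int p =
          (u h + v h) - (u (g \<otimes> h) + v (g \<otimes> h)) + (u g + v g)] (mod int p)"
        by (intro cong_add cong_diff) simp_all
      ultimately show "((u h - u (g \<otimes> h) + u g) mod int p + (v h - v (g \<otimes> h) + v g) mod int p) mod int p =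
          ((u h + v h) mod int p - (u (g \<otimes> h) + v (g \<otimes> h)) mod int p + (u g + v g) mod int p) mod int p"
        unfolding cong_def by (simp add: algebra_simps)
    qed
    then show "a \<otimes>\<^bsub>cocycle_group\<^esub> b \<in> coboundaries p 2 G"
      unfolding coboundaries2_iff using continuous1_add[OF u(1) v(1)] by blast
  qed
qed

lemma cohomology2_eq: "cohomology p 2 G = cocycle_group Mod coboundaries p 2 G"
  by (simp add: cohomology_def)

lemma cohomology_class2_eq: "cohomology_class p 2 G f = coboundaries p 2 G #>\<^bsub>cocycle_group\<^esub> f"
  by (simp add: cohomology_class_def r_coset_def)

lemma comm_group_cohomology2: "comm_group (cohomology p 2 G)"
  unfolding cohomology2_eq
  using comm_group.abelian_FactGroup[OF comm_group_cocycle_group subgroup_coboundaries2] .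

lemma carrier_cohomology2_iff:
  "\<gamma> \<in> carrier (cohomology p 2 G) \<longleftrightarrow> (\<exists>F. continuous2 F \<and> is_cocycle2 F \<and> \<gamma> = class2 F)"
proof -
  have "f \<in> carrier cocycle_group \<longleftrightarrow> (\<exists>F. continuous2 F \<and> is_cocycle2 F \<and> f = cochain2 G F)" for f
    using cocycles2_iff[of f] by simp
  then show ?thesis
    unfolding cohomology2_eq carrier_FactGroup cohomology_class2_eq image_iff Bex_def by (auto simp only:)
qed

lemma mult_cohomology2:
  assumes "continuous2 F" "is_cocycle2 F" "continuous2 F'" "is_cocycle2 F'"
  shows "class2 F \<otimes>\<^bsub>cohomology p 2 G\<^esub> class2 F' = class2 (\<lambda>g h. (F g h + F' g h) mod int p)"
proof -
  interpret C: comm_group cocycle_group by (rule comm_group_cocycle_group)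
  interpret normal "coboundaries p 2 G" cocycle_group
    using subgroup_coboundaries2 by (simp add: C.normal_iff_subgroup)
  show ?thesis
    unfolding cohomology2_eq mult_FactGroup cohomology_class2_eq
    using rcos_sum[OF cochain2_in_cocycle_group[OF assms(1,2)] cochain2_in_cocycle_group[OF assms(3,4)]]
    unfolding mult_cocycle_group .
qed

lemma one_cohomology2: "\<one>\<^bsub>cohomology p 2 G\<^esub> = class2 (\<lambda>g h. 0)"
proof -
  interpret C: comm_group cocycle_group by (rule comm_group_cocycle_group)
  interpret subgroup "coboundaries p 2 G" cocycle_group by (rule subgroup_coboundaries2)
  show ?thesis
    unfolding cohomology2_eq one_FactGroup cohomology_class2_eq
    using C.coset_mult_one[OF subset] unfolding one_cocycle_group by simp
qed

text \<open>The form in which cohomologous cocycles appear below: congruences of unreduced integer expressions.\<close>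

lemma class2_eqI:
  assumes F: "continuous2 F'" "is_cocycle2 F'" and u: "continuous1 u"
    and eq: "\<And>g h. \<lbrakk>g \<in> carrier G; h \<in> carrier G\<rbrakk> \<Longrightarrow>
      F g h mod int p = (F' g h + u h - u (g \<otimes> h) + u g) mod int p"
    and range: "continuous2 F"
  shows "class2 F = class2 F'"
proof -
  interpret C: comm_group cocycle_group by (rule comm_group_cocycle_group)
  let ?b = "cochain2 G (\<lambda>g h. (u h - u (g \<otimes> h) + u g) mod int p)"
  have "cochain2 G F = cochain2 G (\<lambda>g h. F g h mod int p)"
    using cochain2_mod_cancel[OF range] by simp
  also have "\<dots> = ?b \<otimes>\<^bsub>cocycle_group\<^esub> cochain2 G F'"
    unfolding mult_cocycle_group by (intro cochain2_cong) (simp add: eq mod_add_left_eq mod_add_right_eq algebra_simps)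
  finally have "cochain2 G F \<in> coboundaries p 2 G #>\<^bsub>cocycle_group\<^esub> cochain2 G F'"
    using u coboundaries2_iff[of ?b] unfolding r_coset_def by blast
  then show ?thesis
    unfolding cohomology_class2_eq
    by (rule C.repr_independence[OF _ cochain2_in_cocycle_group[OF F] subgroup_coboundaries2, symmetric])
qed

definition character :: "('g \<Rightarrow> int) \<Rightarrow> bool" where
  "character u \<longleftrightarrow> continuous1 u \<and> (\<forall>g \<in> carrier G. \<forall>h \<in> carrier G. u (g \<otimes> h) = (u g + u h) mod int p)"

text \<open>The coboundary of a 0-cochain \<open>a\<close> is \<open>a - a\<close>, as the coefficients are trivial. Therefore a class of degree one
  consists of one function only, and the unions in \<open>cup\<close> are trivial.\<close>

lemma coboundaries1: "coboundaries p 1 G = {cochain1 G (\<lambda>g. 0)}"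
proof
  have tuples0: "tuples 0 G = {\<lambda>i. undefined}"
    by (simp add: tuples_def)
  have "coboundary p 0 G f = cochain1 G (\<lambda>g. 0)" for f
  proof
    fix x
    have "(\<lambda>i \<in> {..<0::nat}. c i) = (\<lambda>i. undefined :: 'g)" for c :: "nat \<Rightarrow> 'g" by auto
    then show "coboundary p 0 G f x = cochain1 G (\<lambda>g. 0) x"
      by (simp add: coboundary_def cochain1_def)
  qed
  moreover have "\<one>\<^bsub>cochain_group p 0 G\<^esub> \<in> carrier (cochain_group p 0 G)"
  proof -
    have "continuous_map (product_topology (\<lambda>_. topol G) {..<0::nat}) (discrete_topology {0..<int p}) (\<lambda>x. 0)"
      using p_pos by simp
    then have "continuous_map (product_topology (\<lambda>_. topol G) {..<0::nat}) (discrete_topology {0..<int p})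
        (\<lambda>x \<in> tuples 0 G. 0)"
      by (rule continuous_map_eq) (simp add: tuples0)
    then show ?thesis by (simp add: cochain_group_def)
  qed
  ultimately show "coboundaries p 1 G \<subseteq> {cochain1 G (\<lambda>g. 0)}" "{cochain1 G (\<lambda>g. 0)} \<subseteq> coboundaries p 1 G"
    by (auto simp: coboundaries_def)
qed

lemma cohomology_class1:
  assumes "continuous1 u"
  shows "cohomology_class p 1 G (cochain1 G u) = {cochain1 G u}"
proof -
  have "cochain1 G (\<lambda>g. 0) \<otimes>\<^bsub>cochain_group p 1 G\<^esub> cochain1 G u = cochain1 G (\<lambda>g. (0 + u g) mod int p)"
    by (auto simp: cochain_group_def cochain1_def)
  also have "\<dots> = cochain1 G u"
    using continuous1_range[OF assms] by (intro cochain1_cong) simp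
  finally show ?thesis
    unfolding cohomology_class_def coboundaries1 r_coset_def by simp
qed

lemma character_in_cohomology1:
  assumes "character u"
  shows "{cochain1 G u} \<in> carrier (cohomology p 1 G)"
proof -
  have u: "continuous1 u" "\<And>g h. \<lbrakk>g \<in> carrier G; h \<in> carrier G\<rbrakk> \<Longrightarrow> u (g \<otimes> h) = (u g + u h) mod int p"
    using assms unfolding character_def by blast+
  have "coboundary p 1 G (cochain1 G u) = cochain2 G (\<lambda>g h. 0)"
    unfolding coboundary_cochain1
  proof (rule cochain2_cong)
    fix g h assume "g \<in> carrier G" "h \<in> carrier G"
    then show "(u h - u (g \<otimes> h) + u g) mod int p = 0"
      by (simp add: u(2) mod_diff_right_eq mod_add_left_eq algebra_simps)
  qed
  then have "cochain1 G u \<in> cocycles p 1 G"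
    using u(1) cochain1_in_carrier_iff[of "cochain1 G u"] one_cochain2[of p G]
    unfolding cocycles_def Suc_1[symmetric] One_nat_def[symmetric] by auto
  then have "cohomology_class p 1 G (cochain1 G u) \<in> carrier (cohomology p 1 G)"
    unfolding cohomology_def carrier_FactGroup cohomology_class_def r_coset_def by auto
  then show ?thesis using cohomology_class1[OF u(1)] by simp
qed

lemma cup_characters:
  "cup p 1 1 G {cochain1 G u} {cochain1 G v} = class2 (\<lambda>g h. (u g * v h) mod int p)"
proof -
  have eq: "(\<lambda>x \<in> tuples (1 + 1) G. (cochain1 G u (\<lambda>k \<in> {..<1}. x k) * cochain1 G v (\<lambda>k \<in> {..<1}. x (1 + k))) mod int p)
      = cochain2 G (\<lambda>g h. (u g * v h) mod int p)"
    unfolding cochain2_def one_add_one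
  proof (rule restrict_ext)
    fix x assume "x \<in> tuples 2 G"
    then obtain g h where gh: "g \<in> carrier G" "h \<in> carrier G" "x = tup2 g h" unfolding tuples2_iff by blast
    have "(\<lambda>k \<in> {..<1}. x k) = tup1 g" "(\<lambda>k \<in> {..<1}. x (1 + k)) = tup1 h" "x 0 = g" "x 1 = h"
      by (auto simp: fun_eq_iff gh(3))
    then show "(cochain1 G u (\<lambda>k \<in> {..<1}. x k) * cochain1 G v (\<lambda>k \<in> {..<1}. x (1 + k))) mod int p =
        (u (x 0) * v (x 1)) mod int p"
      using gh(1,2) by (simp only: cochain1_tup1)
  qed
  have singleton: "(\<Union>f \<in> {a}. \<Union>g \<in> {b}. H f g) = H a b" for a b and H :: "_ \<Rightarrow> _ \<Rightarrow> _ set"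
    by simp
  show ?thesis unfolding cup_def singleton eq unfolding one_add_one ..
qed

lemma continuous2_product:
  assumes "continuous1 u" "continuous1 v"
  shows "continuous2 (\<lambda>g h. (u g * v h) mod int p)"
proof -
  have "continuous2 (\<lambda>g h. u g)" "continuous2 (\<lambda>g h. v h)"
    using continuous2_compose[OF _ assms(1), of "\<lambda>g h. g"] continuous2_compose[OF _ assms(2), of "\<lambda>g h. h"]
    by (simp_all add: continuous_map_fst continuous_map_snd)
  from continuous2_combine[OF this, of "(*)"] show ?thesis .
qed

lemma is_cocycle2_product:
  assumes "character u" "character v"
  shows "is_cocycle2 (\<lambda>g h. (u g * v h) mod int p)"
  unfolding is_cocycle2_def
proof (intro ballI)
  fix g h k assume ghk: "g \<in> carrier G" "h \<in> carrier G" "k \<in> carrier G"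
  have u: "[u (g \<otimes> h) = u g + u h] (mod int p)" and v: "[v (h \<otimes> k) = v h + v k] (mod int p)"
    using assms ghk by (auto simp: character_def)
  have "[(u h * v k) mod int p - (u (g \<otimes> h) * v k) mod int p + (u g * v (h \<otimes> k)) mod int p - (u g * v h) mod int p =
      u h * v k - u (g \<otimes> h) * v k + u g * v (h \<otimes> k) - u g * v h] (mod int p)"
    by (intro cong_add cong_diff) simp_all
  also have "[u h * v k - u (g \<otimes> h) * v k + u g * v (h \<otimes> k) - u g * v h =
      u h * v k - (u g + u h) * v k + u g * (v h + v k) - u g * v h] (mod int p)"
    by (intro cong_add cong_diff cong_mult cong_refl u v)
  also have "u h * v k - (u g + u h) * v k + u g * (v h + v k) - u g * v h = 0"
    by (simp add: algebra_simps)
  finally show "int p dvd (u h * v k) mod int p - (u (g \<otimes> h) * v k) mod int p + (u g * v (h \<otimes> k)) mod int p -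
      (u g * v h) mod int p"
    by (simp only: cong_0_iff)
qed

lemma fully_decomposes_one: "fully_decomposes p G \<one>\<^bsub>cohomology p 2 G\<^esub>"
proof -
  interpret H: comm_group "cohomology p 2 G" by (rule comm_group_cohomology2)
  show ?thesis unfolding fully_decomposes_def by (intro exI[of _ "0::nat"]) simp
qed

lemma carrier_cohomology1E:
  assumes "\<alpha> \<in> carrier (cohomology p 1 G)"
  obtains u where "character u" "\<alpha> = {cochain1 G u}"
proof -
  obtain f where f: "f \<in> cocycles p 1 G" "\<alpha> = cohomology_class p 1 G f"
    using assms unfolding cohomology_def carrier_FactGroup cohomology_class_def r_coset_def by auto
  obtain u where u: "continuous1 u" "f = cochain1 G u"
    using f(1) cochain1_in_carrier_iff[of f] unfolding cocycles_def by blast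
  have "cochain2 G (\<lambda>g h. (u h - u (g \<otimes> h) + u g) mod int p) = cochain2 G (\<lambda>g h. 0)"
    using f(1) u(2) coboundary_cochain1[of u] one_cochain2[of p G]
    unfolding cocycles_def Suc_1[symmetric] One_nat_def[symmetric] by simp
  then have eq: "(u h - u (g \<otimes> h) + u g) mod int p = 0" if "g \<in> carrier G" "h \<in> carrier G" for g h
    using cochain2_tup2[OF that, of "\<lambda>g h. (u h - u (g \<otimes> h) + u g) mod int p"]
      cochain2_tup2[OF that, of "\<lambda>g h. 0"] by simp
  have "u (g \<otimes> h) = (u g + u h) mod int p" if gh: "g \<in> carrier G" "h \<in> carrier G" for g h
  proof -
    have "u (g \<otimes> h) mod int p = (u g + u h) mod int p"
      using eq[OF gh] by (simp add: mod_eq_dvd_iff dvd_eq_mod_eq_0[symmetric] algebra_simps dvd_diff_commute)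
    then show ?thesis using continuous1_range[OF u(1) m_closed[OF gh]] by simp
  qed
  then have "character u" using u(1) unfolding character_def by blast
  then show ?thesis using that f(2) u cohomology_class1 by simp
qed

lemma cup_closed:
  assumes "\<alpha> \<in> carrier (cohomology p 1 G)" "\<beta> \<in> carrier (cohomology p 1 G)"
  shows "cup p 1 1 G \<alpha> \<beta> \<in> carrier (cohomology p 2 G)"
proof -
  obtain u where u: "character u" "\<alpha> = {cochain1 G u}" by (rule carrier_cohomology1E[OF assms(1)])
  obtain v where v: "character v" "\<beta> = {cochain1 G v}" by (rule carrier_cohomology1E[OF assms(2)])
  show ?thesis
    unfolding u(2) v(2) cup_characters carrier_cohomology2_iff
    using u(1) v(1) continuous2_product is_cocycle2_product
    by (intro exI[of _ "\<lambda>g h. (u g * v h) mod int p"]) (simp add: character_def)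
qed

text \<open>Prolong the families that decompose \<open>\<gamma>\<close> by one more pair of characters.\<close>

lemma fully_decomposes_mult_cup:
  assumes \<gamma>: "fully_decomposes p G \<gamma>" and u: "character u" and v: "character v"
  shows "fully_decomposes p G (class2 (\<lambda>g h. (u g * v h) mod int p) \<otimes>\<^bsub>cohomology p 2 G\<^esub> \<gamma>)"
proof -
  interpret H: comm_group "cohomology p 2 G" by (rule comm_group_cohomology2)
  obtain r and \<alpha> \<beta> :: "nat \<Rightarrow> _" where
    \<alpha>\<beta>: "\<And>j. j < r \<Longrightarrow> \<alpha> j \<in> carrier (cohomology p 1 G) \<and> \<beta> j \<in> carrier (cohomology p 1 G)"
    and eq: "\<gamma> = finprod (cohomology p 2 G) (\<lambda>j. cup p 1 1 G (\<alpha> j) (\<beta> j)) {..<r}"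
    using \<gamma> unfolding fully_decomposes_def by blast
  define \<alpha>' where "\<alpha>' = \<alpha>(r := {cochain1 G u})"
  define \<beta>' where "\<beta>' = \<beta>(r := {cochain1 G v})"
  have \<alpha>\<beta>': "\<alpha>' j \<in> carrier (cohomology p 1 G) \<and> \<beta>' j \<in> carrier (cohomology p 1 G)" if "j < Suc r" for j
    using that \<alpha>\<beta>[of j] character_in_cohomology1[OF u] character_in_cohomology1[OF v]
    by (cases "j = r") (simp_all add: \<alpha>'_def \<beta>'_def)
  have closed: "cup p 1 1 G (\<alpha>' j) (\<beta>' j) \<in> carrier (cohomology p 2 G)" if "j < Suc r" for j
    using \<alpha>\<beta>'[OF that] by (intro cup_closed) blast+
  have "\<gamma> = finprod (cohomology p 2 G) (\<lambda>j. cup p 1 1 G (\<alpha>' j) (\<beta>' j)) {..<r}"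
    unfolding eq
  proof (rule H.finprod_cong')
    show "(\<lambda>j. cup p 1 1 G (\<alpha>' j) (\<beta>' j)) \<in> {..<r} \<rightarrow> carrier (cohomology p 2 G)"
      by (intro funcsetI closed) simp
  qed (simp_all add: \<alpha>'_def \<beta>'_def)
  moreover have "finprod (cohomology p 2 G) (\<lambda>j. cup p 1 1 G (\<alpha>' j) (\<beta>' j)) (insert r {..<r}) =
      cup p 1 1 G (\<alpha>' r) (\<beta>' r) \<otimes>\<^bsub>cohomology p 2 G\<^esub>
        finprod (cohomology p 2 G) (\<lambda>j. cup p 1 1 G (\<alpha>' j) (\<beta>' j)) {..<r}"
    by (intro H.finprod_insert funcsetI closed) simp_all
  moreover have "cup p 1 1 G (\<alpha>' r) (\<beta>' r) = class2 (\<lambda>g h. (u g * v h) mod int p)"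
    by (simp only: \<alpha>'_def \<beta>'_def fun_upd_same cup_characters)
  ultimately have "class2 (\<lambda>g h. (u g * v h) mod int p) \<otimes>\<^bsub>cohomology p 2 G\<^esub> \<gamma> =
      finprod (cohomology p 2 G) (\<lambda>j. cup p 1 1 G (\<alpha>' j) (\<beta>' j)) {..<Suc r}"
    unfolding lessThan_Suc by (simp only:)
  then show ?thesis
    unfolding fully_decomposes_def using \<alpha>\<beta>' by blast
qed

definition character_products :: "(('g \<Rightarrow> int) \<times> ('g \<Rightarrow> int)) list \<Rightarrow> 'g \<Rightarrow> 'g \<Rightarrow> int" where
  "character_products ps g h = (\<Sum>(u, v) \<leftarrow> ps. u g * v h) mod int p"

lemma character_products:
  assumes "\<forall>(u, v) \<in> set ps. character u \<and> character v"
  shows "continuous2 (character_products ps) \<and> is_cocycle2 (character_products ps) \<and>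
    fully_decomposes p G (class2 (character_products ps))"
  using assms
proof (induction ps)
  case Nil
  have "character_products [] = (\<lambda>g h. 0)" by (simp add: character_products_def fun_eq_iff)
  then show ?case
    using continuous2_zero fully_decomposes_one by (simp add: one_cohomology2 is_cocycle2_def)
next
  case (Cons w ps)
  obtain u v where w: "w = (u, v)" by fastforce
  let ?F = "\<lambda>g h. (u g * v h) mod int p" and ?F' = "character_products ps"
  have uv: "character u" "character v" using Cons.prems w by auto
  have F: "continuous2 ?F" "is_cocycle2 ?F"
    using uv continuous2_product is_cocycle2_product by (simp_all add: character_def)
  have F': "continuous2 ?F'" "is_cocycle2 ?F'" "fully_decomposes p G (class2 ?F')"
    using Cons.IH Cons.prems by auto
  have "character_products (w # ps) = (\<lambda>g h. (?F g h + ?F' g h) mod int p)"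
    by (simp add: character_products_def fun_eq_iff w mod_add_eq)
  then show ?case
    using continuous2_add[OF F(1) F'(1)] is_cocycle2_add[OF F(2) F'(2)]
      fully_decomposes_mult_cup[OF F'(3) uv] mult_cohomology2[OF F F'(1,2)] by simp
qed

end

section \<open>Ordered products in a group with a central element of order \<open>p\<close>\<close>

context group begin

lemma inv_mult_cancel_left [simp]: "\<lbrakk>u \<in> carrier G; w \<in> carrier G\<rbrakk> \<Longrightarrow> inv u \<otimes> (u \<otimes> w) = w"
  by (simp flip: m_assoc)

lemma conj_mult:
  assumes "u \<in> carrier G" "v \<in> carrier G" "w \<in> carrier G"
  shows "u \<otimes> (v \<otimes> w) \<otimes> inv u = (u \<otimes> v \<otimes> inv u) \<otimes> (u \<otimes> w \<otimes> inv u)"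
  using assms by (simp add: m_assoc)

lemma conj_int_pow:
  fixes k :: int
  assumes "u \<in> carrier G" "v \<in> carrier G"
  shows "u \<otimes> v [^] k \<otimes> inv u = (u \<otimes> v \<otimes> inv u) [^] k"
proof -
  have "(\<lambda>v. u \<otimes> v \<otimes> inv u) \<in> hom G G"
    using assms(1) by (intro homI conj_mult) auto
  from hom_int_pow[OF this assms(2)] show ?thesis by (simp add: is_group)
qed

end

definition word :: "('g, 'm) monoid_scheme \<Rightarrow> ('i \<Rightarrow> 'g) \<Rightarrow> 'i list \<Rightarrow> ('i \<Rightarrow> int) \<Rightarrow> 'g" where
  "word E e js y = foldr (\<lambda>i w. e i [^]\<^bsub>E\<^esub> y i \<otimes>\<^bsub>E\<^esub> w) js \<one>\<^bsub>E\<^esub>"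

text \<open>The exponent of \<open>z\<close> that arises when the ordered words with exponents \<open>y\<close> and \<open>y'\<close> are multiplied and their
  letters are sorted: each letter \<open>i\<close> of the second word has to pass all letters \<open>j\<close> after \<open>i\<close> of the first.\<close>

primrec commutation_form :: "('i \<Rightarrow> 'i \<Rightarrow> int) \<Rightarrow> 'i list \<Rightarrow> ('i \<Rightarrow> int) \<Rightarrow> ('i \<Rightarrow> int) \<Rightarrow> int" where
  "commutation_form c [] y y' = 0"
| "commutation_form c (i # js) y y' = commutation_form c js y y' + (\<Sum>j\<leftarrow>js. c j i * y j) * y' i"

lemma word_Nil [simp]: "word E e [] y = \<one>\<^bsub>E\<^esub>"
  and word_Cons [simp]: "word E e (i # js) y = e i [^]\<^bsub>E\<^esub> y i \<otimes>\<^bsub>E\<^esub> word E e js y"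
  by (simp_all add: word_def)

lemma word_cong:
  "(\<And>i. i \<in> set js \<Longrightarrow> e i [^]\<^bsub>E\<^esub> y i = e i [^]\<^bsub>E\<^esub> y' i) \<Longrightarrow> word E e js y = word E e js y'"
  by (induction js) auto

locale group_with_central_element = group E for E :: "('g, 'm) monoid_scheme" (structure) +
  fixes z :: 'g and p :: nat
  assumes z_closed [simp]: "z \<in> carrier E"
    and z_central: "u \<in> carrier E \<Longrightarrow> z \<otimes> u = u \<otimes> z"
    and z_pow: "z [^] p = \<one>"
begin

lemma z_int_pow_central:
  fixes k :: int
  assumes "u \<in> carrier E"
  shows "z [^] k \<otimes> u = u \<otimes> z [^] k"
proof -
  have "u \<otimes> z \<otimes> inv u = z" using assms z_central[OF assms] by (simp add: m_assoc flip: z_central)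
  then have "u \<otimes> z [^] k \<otimes> inv u = z [^] k" using conj_int_pow[OF assms, of z k] by simp
  then have "u \<otimes> z [^] k \<otimes> inv u \<otimes> u = z [^] k \<otimes> u" by simp
  then show ?thesis using assms by (simp add: m_assoc)
qed

lemma z_int_pow_cong:
  assumes "[k = l] (mod int p)"
  shows "z [^] k = z [^] l"
proof -
  obtain m where "k = l + int p * m" using assms by (metis cong_iff_lin cong_sym)
  moreover have "z [^] (int p * m) = \<one>"
    using int_pow_pow[of z "int p" m] by (simp add: z_pow int_pow_int)
  ultimately show ?thesis by (simp add: int_pow_mult)
qed

lemma z_move:
  fixes k :: int
  assumes "a \<in> carrier E" "b \<in> carrier E"
  shows "a \<otimes> z [^] k \<otimes> b = a \<otimes> b \<otimes> z [^] k"
  using assms z_int_pow_central[of b k] by (simp add: m_assoc)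

lemma z_collect:
  fixes k l :: int
  assumes "a \<in> carrier E" "b \<in> carrier E"
  shows "(a \<otimes> z [^] k) \<otimes> (b \<otimes> z [^] l) = a \<otimes> b \<otimes> z [^] (k + l)"
proof -
  have "(a \<otimes> z [^] k) \<otimes> (b \<otimes> z [^] l) = (a \<otimes> z [^] k \<otimes> b) \<otimes> z [^] l"
    using assms by (simp add: m_assoc)
  also have "\<dots> = a \<otimes> b \<otimes> z [^] (k + l)"
    unfolding z_move[OF assms] using assms by (simp add: m_assoc int_pow_mult)
  finally show ?thesis .
qed

abbreviation commute_up_to :: "'g \<Rightarrow> 'g \<Rightarrow> int \<Rightarrow> bool" where
  "commute_up_to u v c \<equiv> u \<otimes> v = v \<otimes> u \<otimes> z [^] c"

lemma commute_up_to_iff_conj: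
  assumes "u \<in> carrier E" "v \<in> carrier E"
  shows "commute_up_to u v c \<longleftrightarrow> u \<otimes> v \<otimes> inv u = v \<otimes> z [^] c"
proof -
  have "u \<otimes> v \<otimes> inv u = v \<otimes> z [^] c \<longleftrightarrow> u \<otimes> v = v \<otimes> z [^] c \<otimes> u"
    using assms by (metis int_pow_closed inv_closed inv_solve_right m_closed z_closed)
  then show ?thesis using assms z_int_pow_central[of u c] by (simp add: m_assoc)
qed

lemma commute_up_to_pow_right:
  fixes b :: int
  assumes "u \<in> carrier E" "v \<in> carrier E" "commute_up_to u v c"
  shows "commute_up_to u (v [^] b) (c * b)"
proof -
  have "u \<otimes> v [^] b \<otimes> inv u = (v \<otimes> z [^] c) [^] b"
    using assms commute_up_to_iff_conj conj_int_pow by simp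
  also have "\<dots> = v [^] b \<otimes> z [^] (c * b)"
    using assms z_int_pow_central[of v c] by (simp add: int_pow_mult_distrib int_pow_pow)
  finally show ?thesis using assms commute_up_to_iff_conj by simp
qed

lemma commute_up_to_swap:
  assumes "u \<in> carrier E" "v \<in> carrier E" "commute_up_to u v c"
  shows "commute_up_to v u (- c)"
  using assms by (simp add: m_assoc flip: int_pow_mult)

text \<open>Commutators that are central are bilinear. Conjugation by \<open>u\<close> is an automorphism, which gives powers of \<open>v\<close>,
  also negative ones; exchanging the roles of \<open>u\<close> and \<open>v\<close> then gives powers of \<open>u\<close>.\<close>

lemma commute_up_to_pow:
  fixes a b :: int
  assumes "u \<in> carrier E" "v \<in> carrier E" "commute_up_to u v c"
  shows "commute_up_to (u [^] a) (v [^] b) (c * a * b)"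
proof -
  have "commute_up_to (v [^] b) u (- (c * b))"
    using assms by (intro commute_up_to_swap commute_up_to_pow_right) auto
  then have "commute_up_to (v [^] b) (u [^] a) (- (c * b) * a)"
    using assms by (intro commute_up_to_pow_right) auto
  then have "commute_up_to (u [^] a) (v [^] b) (- (- (c * b) * a))"
    using assms by (intro commute_up_to_swap) auto
  then show ?thesis by (simp add: mult_ac)
qed

lemma commute_up_to_mult_left:
  assumes "u \<in> carrier E" "u' \<in> carrier E" "v \<in> carrier E" "commute_up_to u v c" "commute_up_to u' v c'"
  shows "commute_up_to (u \<otimes> u') v (c + c')"
proof -
  have "u \<otimes> u' \<otimes> v = u \<otimes> (u' \<otimes> v)" using assms(1-3) by (simp add: m_assoc)
  also have "\<dots> = (u \<otimes> v) \<otimes> (u' \<otimes> z [^] c')"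
    unfolding assms(5) using assms(1-3) by (simp add: m_assoc)
  also have "\<dots> = v \<otimes> (u \<otimes> u') \<otimes> z [^] (c + c')"
    unfolding assms(4) using assms(1-3) z_collect[of "v \<otimes> u" u' c c'] by (simp add: m_assoc)
  finally show ?thesis .
qed

lemma word_closed [simp]: "(\<And>i. i \<in> set js \<Longrightarrow> e i \<in> carrier E) \<Longrightarrow> word E e js y \<in> carrier E"
  by (induction js) auto

lemma word_commute_up_to:
  assumes "\<And>j. j \<in> set js \<Longrightarrow> e j \<in> carrier E" "v \<in> carrier E"
    and "\<And>j. j \<in> set js \<Longrightarrow> commute_up_to (e j) v (c j)"
  shows "commute_up_to (word E e js y) v (\<Sum>j\<leftarrow>js. c j * y j)"
  using assms
proof (induction js)
  case (Cons i js)
  have "commute_up_to (e i [^] y i) (v [^] (1::int)) (c i * y i * 1)"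
    using Cons.prems by (intro commute_up_to_pow) auto
  then have "commute_up_to (e i [^] y i) v (c i * y i)" using Cons.prems by simp
  moreover have "commute_up_to (word E e js y) v (\<Sum>j\<leftarrow>js. c j * y j)"
    using Cons by simp
  ultimately show ?case
    using commute_up_to_mult_left[of "e i [^] y i" "word E e js y" v] Cons.prems by simp
qed simp

lemma word_mult:
  assumes "\<And>j. j \<in> set js \<Longrightarrow> e j \<in> carrier E"
    and "\<And>i j. \<lbrakk>i \<in> set js; j \<in> set js\<rbrakk> \<Longrightarrow> commute_up_to (e j) (e i) (c j i)"
  shows "word E e js y \<otimes> word E e js y' = word E e js (\<lambda>i. y i + y' i) \<otimes> z [^] commutation_form c js y y'"
  using assms
proof (induction js)
  case (Cons i js)
  let ?s = "\<Sum>j\<leftarrow>js. c j i * y j"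
  define a a' where "a = e i [^] y i" and "a' = e i [^] y' i"
  define w w' where "w = word E e js y" and "w' = word E e js y'"
  have closed: "a \<in> carrier E" "a' \<in> carrier E" "w \<in> carrier E" "w' \<in> carrier E"
    using Cons.prems(1) by (auto simp: a_def a'_def w_def w'_def)
  have e: "e j \<in> carrier E" if "j \<in> set (i # js)" for j
    using Cons.prems(1) that .
  have "commute_up_to w (e i) ?s"
    unfolding w_def by (rule word_commute_up_to; (rule e | rule Cons.prems(2)); simp)
  then have swap: "commute_up_to w a' (?s * y' i)"
    unfolding a'_def by (rule commute_up_to_pow_right[OF closed(3) e[OF list.set_intros(1)]])
  have "a \<otimes> (w \<otimes> a') \<otimes> w' = (a \<otimes> (a' \<otimes> w)) \<otimes> z [^] (?s * y' i) \<otimes> w'"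
    unfolding swap using closed by (simp add: m_assoc)
  also have "\<dots> = (a \<otimes> (a' \<otimes> w)) \<otimes> w' \<otimes> z [^] (?s * y' i)"
    using closed by (intro z_move) auto
  finally have "(a \<otimes> w) \<otimes> (a' \<otimes> w') = (a \<otimes> a') \<otimes> (w \<otimes> w') \<otimes> z [^] (?s * y' i)"
    using closed by (simp add: m_assoc)
  also have "w \<otimes> w' = word E e js (\<lambda>i. y i + y' i) \<otimes> z [^] commutation_form c js y y'"
    unfolding w_def w'_def by (rule Cons.IH; rule Cons.prems; simp)
  also have "a \<otimes> a' = e i [^] (y i + y' i)"
    using Cons.prems(1) by (simp add: a_def a'_def int_pow_mult)
  finally have "(a \<otimes> w) \<otimes> (a' \<otimes> w') =
      e i [^] (y i + y' i) \<otimes> word E e js (\<lambda>i. y i + y' i) \<otimes>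
        (z [^] commutation_form c js y y' \<otimes> z [^] (?s * y' i))"
    using e by (simp add: m_assoc)
  then show ?case
    by (simp add: a_def a'_def w_def w'_def int_pow_mult)
qed simp

text \<open>Each conjugation by \<open>t\<close> raises to the power \<open>q\<close> and contributes a factor \<open>z\<close> to the power \<open>d\<close> times the current
  exponent of \<open>v\<close>. As \<open>q \<equiv> 1\<close> modulo \<open>p\<close> and \<open>z\<^sup>p = 1\<close>, the latter exponent may be replaced by \<open>a\<close>
  every time, so the contributions are linear in \<open>m\<close>.\<close>

lemma conj_pow_generator:
  fixes q d a :: int and m :: nat
  assumes "t \<in> carrier E" "v \<in> carrier E" "t \<otimes> v \<otimes> inv t = v [^] q \<otimes> z [^] d" "[q = 1] (mod int p)"
  shows "t [^] m \<otimes> v [^] a \<otimes> inv (t [^] m) = v [^] (q ^ m * a) \<otimes> z [^] (int m * (d * a))"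
proof (induction m)
  case 0
  then show ?case using assms(2) by simp
next
  case (Suc m)
  let ?r = "q ^ m * a"
  have "t \<otimes> v [^] ?r \<otimes> inv t = (v [^] q \<otimes> z [^] d) [^] ?r"
    using conj_int_pow[OF assms(1,2)] assms(3) by simp
  also have "\<dots> = v [^] (q * ?r) \<otimes> z [^] (d * ?r)"
    using assms(2) z_int_pow_central[of "v [^] q" d] by (simp add: int_pow_mult_distrib int_pow_pow)
  also have "z [^] (d * ?r) = z [^] (d * a)"
  proof (rule z_int_pow_cong)
    have "[q ^ m = 1] (mod int p)" using cong_pow[OF assms(4), of m] by simp
    then have "[d * (q ^ m * a) = d * (1 * a)] (mod int p)" by (intro cong_mult cong_refl)
    then show "[d * ?r = d * a] (mod int p)" by simp
  qed
  finally have step: "t \<otimes> v [^] ?r \<otimes> inv t = v [^] (q * ?r) \<otimes> z [^] (d * a)" .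
  have zconj: "t \<otimes> z [^] (int m * (d * a)) \<otimes> inv t = z [^] (int m * (d * a))"
    using assms(1) z_int_pow_central[of t "int m * (d * a)", symmetric] by (simp add: m_assoc)
  have "t [^] Suc m = t \<otimes> t [^] m" using assms(1) nat_pow_Suc2 by blast
  then have "t [^] Suc m \<otimes> v [^] a \<otimes> inv (t [^] Suc m) =
      t \<otimes> (t [^] m \<otimes> v [^] a \<otimes> inv (t [^] m)) \<otimes> inv t"
    using assms(1,2) by (simp add: inv_mult_group m_assoc del: nat_pow_Suc)
  also have "\<dots> = (t \<otimes> v [^] ?r \<otimes> inv t) \<otimes> (t \<otimes> z [^] (int m * (d * a)) \<otimes> inv t)"
    unfolding Suc.IH using assms(1,2) by (intro conj_mult) auto
  also have "\<dots> = v [^] (q ^ Suc m * a) \<otimes> z [^] (int (Suc m) * (d * a))"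
    unfolding step zconj using assms(2) by (simp add: m_assoc algebra_simps flip: int_pow_mult)
  finally show ?case .
qed

lemma conj_pow_word:
  fixes q :: int and m :: nat
  assumes t: "t \<in> carrier E" and e: "\<And>i. i \<in> set js \<Longrightarrow> e i \<in> carrier E"
    and conj: "\<And>i. i \<in> set js \<Longrightarrow> t \<otimes> e i \<otimes> inv t = e i [^] q \<otimes> z [^] d i" and q: "[q = 1] (mod int p)"
  shows "t [^] m \<otimes> word E e js y \<otimes> inv (t [^] m) =
    word E e js (\<lambda>i. q ^ m * y i) \<otimes> z [^] (int m * (\<Sum>i\<leftarrow>js. d i * y i))"
  using e conj
proof (induction js)
  case Nil
  then show ?case using t by simp
next
  case (Cons i js)
  define w where "w = word E e js (\<lambda>i. q ^ m * y i)"
  have w: "w \<in> carrier E" using Cons.prems(1) by (simp add: w_def)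
  have "t [^] m \<otimes> word E e (i # js) y \<otimes> inv (t [^] m) =
      (t [^] m \<otimes> e i [^] y i \<otimes> inv (t [^] m)) \<otimes> (t [^] m \<otimes> word E e js y \<otimes> inv (t [^] m))"
    unfolding word_Cons using t Cons.prems(1) by (intro conj_mult) auto
  also have "t [^] m \<otimes> e i [^] y i \<otimes> inv (t [^] m) = e i [^] (q ^ m * y i) \<otimes> z [^] (int m * (d i * y i))"
    using t Cons.prems q by (intro conj_pow_generator) auto
  also have "t [^] m \<otimes> word E e js y \<otimes> inv (t [^] m) = w \<otimes> z [^] (int m * (\<Sum>i\<leftarrow>js. d i * y i))"
    unfolding w_def using Cons by simp
  also have "e i [^] (q ^ m * y i) \<otimes> z [^] (int m * (d i * y i)) \<otimes> (w \<otimes> z [^] (int m * (\<Sum>i\<leftarrow>js. d i * y i))) =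
      e i [^] (q ^ m * y i) \<otimes> w \<otimes> z [^] (int m * (d i * y i) + int m * (\<Sum>i\<leftarrow>js. d i * y i))"
    using Cons.prems(1) w by (intro z_collect) auto
  also have "\<dots> = word E e (i # js) (\<lambda>i. q ^ m * y i) \<otimes> z [^] (int m * (\<Sum>i\<leftarrow>i # js. d i * y i))"
    by (simp add: w_def distrib_left)
  finally show ?case .
qed

text \<open>Move \<open>t\<^sup>m\<close> to the right past the second word, then sort the letters of the two words.\<close>

lemma section_mult:
  fixes q :: int and m m' :: nat
  assumes t: "t \<in> carrier E" and e: "\<And>i. i \<in> set js \<Longrightarrow> e i \<in> carrier E"
    and comm: "\<And>i j. \<lbrakk>i \<in> set js; j \<in> set js\<rbrakk> \<Longrightarrow> commute_up_to (e j) (e i) (c j i)"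
    and conj: "\<And>i. i \<in> set js \<Longrightarrow> t \<otimes> e i \<otimes> inv t = e i [^] q \<otimes> z [^] d i" and q: "[q = 1] (mod int p)"
  shows "(word E e js y \<otimes> t [^] m) \<otimes> (word E e js y' \<otimes> t [^] m') =
    word E e js (\<lambda>i. y i + q ^ m * y' i) \<otimes> t [^] (m + m') \<otimes>
      z [^] (commutation_form c js y (\<lambda>i. q ^ m * y' i) + int m * (\<Sum>i\<leftarrow>js. d i * y' i))"
proof -
  let ?w = "word E e js"
  let ?f = "commutation_form c js y (\<lambda>i. q ^ m * y' i)" and ?s = "int m * (\<Sum>i\<leftarrow>js. d i * y' i)"
  have w: "?w v \<in> carrier E" for v using e by simp
  let ?W = "?w (\<lambda>i. q ^ m * y' i)"
  have conj': "t [^] m \<otimes> ?w y' \<otimes> inv (t [^] m) = ?W \<otimes> z [^] ?s"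
    by (rule conj_pow_word) (use assms in auto)
  have "t [^] m \<otimes> ?w y' = (t [^] m \<otimes> ?w y' \<otimes> inv (t [^] m)) \<otimes> t [^] m"
    using t w[of y'] by (simp add: m_assoc)
  also have "\<dots> = ?W \<otimes> t [^] m \<otimes> z [^] ?s"
    unfolding conj' using t w by (intro z_move) auto
  finally have swap: "t [^] m \<otimes> ?w y' = ?W \<otimes> t [^] m \<otimes> z [^] ?s" .
  have "(?w y \<otimes> t [^] m) \<otimes> (?w y' \<otimes> t [^] m') = ?w y \<otimes> (t [^] m \<otimes> ?w y') \<otimes> t [^] m'"
    using t w[of y] w[of y'] by (simp add: m_assoc)
  also have "\<dots> = (?w y \<otimes> (?W \<otimes> t [^] m)) \<otimes> z [^] ?s \<otimes> t [^] m'"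
    unfolding swap using t w by (simp add: m_assoc)
  also have "\<dots> = (?w y \<otimes> (?W \<otimes> t [^] m)) \<otimes> t [^] m' \<otimes> z [^] ?s"
    using t w by (intro z_move) auto
  also have "\<dots> = (?w y \<otimes> ?W) \<otimes> t [^] (m + m') \<otimes> z [^] ?s"
    using t w by (simp add: m_assoc flip: nat_pow_mult)
  also have "?w y \<otimes> ?W = ?w (\<lambda>i. y i + q ^ m * y' i) \<otimes> z [^] ?f"
    using e comm by (rule word_mult)
  also have "?w (\<lambda>i. y i + q ^ m * y' i) \<otimes> z [^] ?f \<otimes> t [^] (m + m') =
      ?w (\<lambda>i. y i + q ^ m * y' i) \<otimes> t [^] (m + m') \<otimes> z [^] ?f"
    using t w by (intro z_move) auto
  finally show ?thesis
    using t w by (simp add: m_assoc int_pow_mult)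
qed

end

section \<open>Sums of products of characters, and inflation\<close>

context mod_p_cochains begin

lemma character_zero: "character (\<lambda>g. 0)"
  using p_pos by (simp add: character_def)

lemma character_add_scaled:
  assumes "character u" "character v"
  shows "character (\<lambda>g. (c * u g + v g) mod int p)"
  unfolding character_def
proof (intro conjI ballI)
  show "continuous1 (\<lambda>g. (c * u g + v g) mod int p)"
    by (rule continuous_map_into_discrete_combine[of _ "{0..<int p}" u "{0..<int p}" v "\<lambda>a b. (c * a + b) mod int p"])
      (use assms p_pos in \<open>auto simp: character_def\<close>)
  fix g h assume gh: "g \<in> carrier G" "h \<in> carrier G"
  have "[c * u (g \<otimes> h) + v (g \<otimes> h) = c * (u g + u h) + (v g + v h)] (mod int p)"
    using assms gh unfolding character_def by (intro cong_add cong_mult cong_refl) simp_all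
  moreover have "[(c * u g + v g) mod int p + (c * u h + v h) mod int p = (c * u g + v g) + (c * u h + v h)] (mod int p)"
    by (intro cong_add) simp_all
  ultimately show "(c * u (g \<otimes> h) + v (g \<otimes> h)) mod int p =
      ((c * u g + v g) mod int p + (c * u h + v h) mod int p) mod int p"
    unfolding cong_def by (simp add: algebra_simps)
qed

lemma character_sum_list:
  assumes "\<And>j. j \<in> set js \<Longrightarrow> character (\<chi> j)"
  shows "character (\<lambda>g. (\<Sum>j\<leftarrow>js. c j * \<chi> j g) mod int p)"
  using assms
proof (induction js)
  case (Cons i js)
  then have "character (\<lambda>g. (c i * \<chi> i g + (\<Sum>j\<leftarrow>js. c j * \<chi> j g) mod int p) mod int p)"
    by (intro character_add_scaled) auto
  then show ?case by (simp add: mod_add_right_eq)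
qed (simp add: character_zero)

text \<open>Congruence in place of equality allows a representation by characters, with values in \<open>{0..<p}\<close>, of functions
  that are naturally integer valued.\<close>

definition sum_of_products :: "('g \<Rightarrow> 'g \<Rightarrow> int) \<Rightarrow> bool" where
  "sum_of_products Q \<longleftrightarrow> (\<exists>ps. (\<forall>(u, v) \<in> set ps. character u \<and> character v) \<and>
     (\<forall>g \<in> carrier G. \<forall>h \<in> carrier G. [Q g h = character_products ps g h] (mod int p)))"

lemma sum_of_products_zero: "sum_of_products (\<lambda>g h. 0)"
  unfolding sum_of_products_def by (rule exI[of _ "[]"]) (simp add: character_products_def)

lemma sum_of_products_product:
  assumes "character u" "character v"
  shows "sum_of_products (\<lambda>g h. u g * v h)"
  unfolding sum_of_products_def by (rule exI[of _ "[(u, v)]"]) (simp add: assms character_products_def cong_def)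

lemma sum_of_products_add:
  assumes "sum_of_products Q" "sum_of_products Q'"
  shows "sum_of_products (\<lambda>g h. Q g h + Q' g h)"
proof -
  obtain ps where ps: "\<forall>(u, v) \<in> set ps. character u \<and> character v"
    "\<And>g h. \<lbrakk>g \<in> carrier G; h \<in> carrier G\<rbrakk> \<Longrightarrow> [Q g h = character_products ps g h] (mod int p)"
    using assms(1) unfolding sum_of_products_def by auto
  obtain ps' where ps': "\<forall>(u, v) \<in> set ps'. character u \<and> character v"
    "\<And>g h. \<lbrakk>g \<in> carrier G; h \<in> carrier G\<rbrakk> \<Longrightarrow> [Q' g h = character_products ps' g h] (mod int p)"
    using assms(2) unfolding sum_of_products_def by auto
  have "[Q g h + Q' g h = character_products (ps @ ps') g h] (mod int p)"
    if "g \<in> carrier G" "h \<in> carrier G" for g h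
    using cong_add[OF ps(2)[OF that] ps'(2)[OF that]]
    by (simp add: character_products_def cong_def mod_add_eq)
  then show ?thesis
    unfolding sum_of_products_def using ps(1) ps'(1) by (intro exI[of _ "ps @ ps'"]) auto
qed

lemma sum_of_products_cong:
  assumes "sum_of_products Q" "\<And>g h. \<lbrakk>g \<in> carrier G; h \<in> carrier G\<rbrakk> \<Longrightarrow> [Q' g h = Q g h] (mod int p)"
  shows "sum_of_products Q'"
proof -
  obtain ps where ps: "\<forall>(u, v) \<in> set ps. character u \<and> character v"
    "\<And>g h. \<lbrakk>g \<in> carrier G; h \<in> carrier G\<rbrakk> \<Longrightarrow> [Q g h = character_products ps g h] (mod int p)"
    using assms(1) unfolding sum_of_products_def by auto
  have "[Q' g h = character_products ps g h] (mod int p)" if "g \<in> carrier G" "h \<in> carrier G" for g h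
    by (rule cong_trans[OF assms(2)[OF that] ps(2)[OF that]])
  then show ?thesis unfolding sum_of_products_def using ps(1) by (intro exI[of _ ps]) simp
qed

lemma sum_of_products_commutation_form:
  assumes "\<And>j. j \<in> set js \<Longrightarrow> character (\<chi> j)"
  shows "sum_of_products (\<lambda>g h. commutation_form c js (\<lambda>i. \<chi> i g) (\<lambda>i. \<chi> i h))"
  using assms
proof (induction js)
  case Nil
  then show ?case by (simp add: sum_of_products_zero)
next
  case (Cons i js)
  have "sum_of_products (\<lambda>g h. commutation_form c js (\<lambda>i. \<chi> i g) (\<lambda>i. \<chi> i h) +
      ((\<Sum>j\<leftarrow>js. c j i * \<chi> j g) mod int p) * \<chi> i h)"
    using Cons by (intro sum_of_products_add sum_of_products_product character_sum_list) auto
  then show ?case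
  proof (rule sum_of_products_cong)
    fix g h
    show "[commutation_form c (i # js) (\<lambda>i. \<chi> i g) (\<lambda>i. \<chi> i h) =
      commutation_form c js (\<lambda>i. \<chi> i g) (\<lambda>i. \<chi> i h) + (\<Sum>j\<leftarrow>js. c j i * \<chi> j g) mod int p * \<chi> i h] (mod int p)"
      unfolding commutation_form.simps by (intro cong_add cong_mult cong_refl) simp
  qed
qed

lemma fully_decomposes_if_cohomologous_to_sum_of_products:
  assumes F: "continuous2 F" and Q: "sum_of_products Q" and u: "continuous1 u"
    and eq: "\<And>g h. \<lbrakk>g \<in> carrier G; h \<in> carrier G\<rbrakk> \<Longrightarrow> [F g h = Q g h + u h - u (g \<otimes> h) + u g] (mod int p)"
  shows "fully_decomposes p G (class2 F)"
proof -
  obtain ps where ps: "\<forall>(u, v) \<in> set ps. character u \<and> character v"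
    "\<And>g h. \<lbrakk>g \<in> carrier G; h \<in> carrier G\<rbrakk> \<Longrightarrow> [Q g h = character_products ps g h] (mod int p)"
    using Q unfolding sum_of_products_def by auto
  note P = character_products[OF ps(1)]
  have "class2 F = class2 (character_products ps)"
  proof (rule class2_eqI[OF _ _ u _ F])
    fix g h assume gh: "g \<in> carrier G" "h \<in> carrier G"
    have "[F g h = character_products ps g h + u h - u (g \<otimes> h) + u g] (mod int p)"
      by (rule cong_trans[OF eq[OF gh]]) (intro cong_add cong_diff cong_refl ps(2) gh)
    then show "F g h mod int p = (character_products ps g h + u h - u (g \<otimes> h) + u g) mod int p"
      unfolding cong_def .
  qed (use P in simp_all)
  then show ?thesis using P by simp
qed

end

lemma sum_list_cong_mod:
  assumes "\<And>j. j \<in> set js \<Longrightarrow> [f j = g j] (mod m)"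
  shows "[(\<Sum>j\<leftarrow>js. f j) = (\<Sum>j\<leftarrow>js. g j)] (mod (m :: int))"
  using assms by (induction js) (auto intro!: cong_add)

lemma commutation_form_cong:
  assumes "\<And>i. i \<in> set js \<Longrightarrow> [y i = w i] (mod m)" "\<And>i. i \<in> set js \<Longrightarrow> [y' i = w' i] (mod m)"
  shows "[commutation_form c js y y' = commutation_form c js w w'] (mod m)"
  using assms
proof (induction js)
  case (Cons i js)
  then show ?case
    unfolding commutation_form.simps by (intro cong_add cong_mult sum_list_cong_mod cong_refl) auto
qed simp

locale mod_p_cochains_hom = G: mod_p_cochains G p + H: mod_p_cochains H p
  for G :: "('g, 'm) topological_group_scheme" and H :: "('h, 'n) topological_group_scheme" and p +
  fixes \<pi> :: "'g \<Rightarrow> 'h"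
  assumes continuous: "continuous_map (topol G) (topol H) \<pi>"
    and hom: "\<pi> \<in> hom G H"
begin

lemma \<pi>_closed: "g \<in> carrier G \<Longrightarrow> \<pi> g \<in> carrier H"
  and \<pi>_mult: "\<lbrakk>g \<in> carrier G; h \<in> carrier G\<rbrakk> \<Longrightarrow> \<pi> (g \<otimes>\<^bsub>G\<^esub> h) = \<pi> g \<otimes>\<^bsub>H\<^esub> \<pi> h"
  using hom by (auto simp: hom_def)

lemma continuous2_pullback:
  assumes "H.continuous2 F"
  shows "G.continuous2 (\<lambda>g h. F (\<pi> g) (\<pi> h))"
proof -
  have "continuous_map (prod_topology (topol G) (topol G)) (prod_topology (topol H) (topol H))
      (\<lambda>t. (\<pi> (fst t), \<pi> (snd t)))"
    using continuous_map_compose[OF continuous_map_fst continuous] continuous_map_compose[OF continuous_map_snd continuous]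
    by (intro continuous_map_pairedI) (simp_all only: o_def)
  from continuous_map_compose[OF this assms] show ?thesis by (simp add: o_def)
qed

lemma is_cocycle2_pullback:
  assumes "H.is_cocycle2 F"
  shows "G.is_cocycle2 (\<lambda>g h. F (\<pi> g) (\<pi> h))"
  using assms unfolding G.is_cocycle2_def H.is_cocycle2_def by (simp add: \<pi>_mult \<pi>_closed)

text \<open>\<open>inflation\<close> is a union over all representatives, so one has to see that cohomologous representatives pull back
  to cohomologous cocycles.\<close>

lemma inflation_class2:
  assumes F: "H.continuous2 F" "H.is_cocycle2 F"
  shows "inflation p 2 G \<pi> (H.class2 F) = G.class2 (\<lambda>g h. F (\<pi> g) (\<pi> h))"
proof -
  have pullback: "(\<lambda>x \<in> tuples 2 G. cochain2 H F' (\<lambda>k \<in> {..<2}. \<pi> (x k))) =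
      cochain2 G (\<lambda>g h. F' (\<pi> g) (\<pi> h))" for F'
    unfolding cochain2_def[of G]
  proof (rule restrict_ext)
    fix x assume "x \<in> tuples 2 G"
    then obtain g h where gh: "g \<in> carrier G" "h \<in> carrier G" "x = tup2 g h" unfolding tuples2_iff by blast
    have "(\<lambda>k \<in> {..<2}. \<pi> (x k)) = tup2 (\<pi> g) (\<pi> h)" "x 0 = g" "x 1 = h"
      by (auto simp: fun_eq_iff gh(3))
    then show "cochain2 H F' (\<lambda>k \<in> {..<2}. \<pi> (x k)) = F' (\<pi> (x 0)) (\<pi> (x 1))"
      using gh(1,2) by (simp only: cochain2_tup2 \<pi>_closed)
  qed
  have representative: "cohomology_class p 2 G (\<lambda>x \<in> tuples 2 G. f (\<lambda>k \<in> {..<2}. \<pi> (x k))) =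
      G.class2 (\<lambda>g h. F (\<pi> g) (\<pi> h))" if f: "f \<in> H.class2 F" for f
  proof -
    obtain b where b: "b \<in> coboundaries p 2 H" "f = b \<otimes>\<^bsub>cochain_group p 2 H\<^esub> cochain2 H F"
      using f unfolding cohomology_class_def r_coset_def by blast
    obtain u where u: "H.continuous1 u" "b = cochain2 H (\<lambda>g h. (u h - u (g \<otimes>\<^bsub>H\<^esub> h) + u g) mod int p)"
      using b(1) unfolding H.coboundaries2_iff by blast
    let ?F' = "\<lambda>g h. ((u h - u (g \<otimes>\<^bsub>H\<^esub> h) + u g) mod int p + F g h) mod int p"
    have f_eq: "f = cochain2 H ?F'" unfolding b(2) u(2) mult_cochain2 ..
    have F': "H.continuous2 ?F'"
      using H.continuous2_add[OF H.continuous2_coboundary[OF u(1)] F(1)] .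
    have u': "G.continuous1 (\<lambda>g. u (\<pi> g))"
      using continuous_map_compose[OF continuous u(1)] by (simp only: o_def)
    have "G.class2 (\<lambda>g h. ?F' (\<pi> g) (\<pi> h)) = G.class2 (\<lambda>g h. F (\<pi> g) (\<pi> h))"
    proof (rule G.class2_eqI[OF continuous2_pullback[OF F(1)] is_cocycle2_pullback[OF F(2)] u' _ continuous2_pullback[OF F']])
      fix g h assume "g \<in> carrier G" "h \<in> carrier G"
      then show "?F' (\<pi> g) (\<pi> h) mod int p =
          (F (\<pi> g) (\<pi> h) + u (\<pi> h) - u (\<pi> (g \<otimes>\<^bsub>G\<^esub> h)) + u (\<pi> g)) mod int p"
        by (simp add: \<pi>_mult mod_add_left_eq mod_add_right_eq algebra_simps)
    qed
    then show ?thesis unfolding f_eq pullback .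
  qed
  have "cochain2 H F \<in> H.class2 F"
    unfolding H.cohomology_class2_eq
    by (rule group.rcos_self[OF comm_group.axioms(2)[OF H.comm_group_cocycle_group]
          H.cochain2_in_cocycle_group[OF F] H.subgroup_coboundaries2])
  then show ?thesis
    unfolding inflation_def using representative by blast
qed

end

section \<open>The central extension given by a cocycle\<close>

text \<open>The normalisation makes \<open>(1, 0)\<close> the neutral element. It costs nothing, since subtracting the constant
  \<open>F(1, 1)\<close> from a cocycle changes it by the coboundary of a constant.\<close>

locale cocycle_extension = group G for G :: "('g, 'm) monoid_scheme" (structure) +
  fixes p :: nat and F :: "'g \<Rightarrow> 'g \<Rightarrow> int"
  assumes p_pos: "0 < p"
    and cocycle: "\<lbrakk>g \<in> carrier G; h \<in> carrier G; k \<in> carrier G\<rbrakk> \<Longrightarrow>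
      [F h k + F g (h \<otimes> k) = F (g \<otimes> h) k + F g h] (mod int p)"
    and normalised: "F \<one> \<one> = 0"
begin

definition extension :: "('g \<times> int) monoid" where
  "extension = \<lparr>carrier = carrier G \<times> {0..<int p},
     monoid.mult = (\<lambda>(g, a) (h, b). (g \<otimes> h, (a + b + F g h) mod int p)),
     one = (\<one>, 0)\<rparr>"

lemma carrier_extension: "carrier extension = carrier G \<times> {0..<int p}"
  and mult_extension: "u \<otimes>\<^bsub>extension\<^esub> v = (fst u \<otimes> fst v, (snd u + snd v + F (fst u) (fst v)) mod int p)"
  and one_extension: "\<one>\<^bsub>extension\<^esub> = (\<one>, 0)"
  by (simp_all add: extension_def split_beta)

lemma cocycle_one_left: "g \<in> carrier G \<Longrightarrow> [F \<one> g = 0] (mod int p)"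
  using cocycle[of \<one> \<one> g] normalised by (simp add: cong_iff_dvd_diff)

lemma cocycle_one_right: "g \<in> carrier G \<Longrightarrow> [F g \<one> = 0] (mod int p)"
  using cocycle[of g \<one> \<one>] normalised by (simp add: cong_iff_dvd_diff)

lemma group_extension: "group extension"
proof (rule groupI)
  fix u v assume u: "u \<in> carrier extension" and v: "v \<in> carrier extension"
  then show "u \<otimes>\<^bsub>extension\<^esub> v \<in> carrier extension"
    using p_pos by (auto simp: carrier_extension mult_extension)
  fix w assume w: "w \<in> carrier extension"
  have "[F (fst v) (fst w) + F (fst u) (fst v \<otimes> fst w) =
      F (fst u \<otimes> fst v) (fst w) + F (fst u) (fst v)] (mod int p)"
    using u v w by (intro cocycle) (auto simp: carrier_extension)
  then have "[snd u + snd v + F (fst u) (fst v) + snd w + F (fst u \<otimes> fst v) (fst w) =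
      snd u + (snd v + snd w + F (fst v) (fst w)) + F (fst u) (fst v \<otimes> fst w)] (mod int p)"
    unfolding cong_iff_dvd_diff by (simp add: algebra_simps dvd_diff_commute)
  moreover have "[(snd u + snd v + F (fst u) (fst v)) mod int p + snd w + F (fst u \<otimes> fst v) (fst w) =
      snd u + snd v + F (fst u) (fst v) + snd w + F (fst u \<otimes> fst v) (fst w)] (mod int p)"
    by (intro cong_add) simp_all
  moreover have "[snd u + (snd v + snd w + F (fst v) (fst w)) mod int p + F (fst u) (fst v \<otimes> fst w) =
      snd u + (snd v + snd w + F (fst v) (fst w)) + F (fst u) (fst v \<otimes> fst w)] (mod int p)"
    by (intro cong_add) simp_all
  ultimately have "[(snd u + snd v + F (fst u) (fst v)) mod int p + snd w + F (fst u \<otimes> fst v) (fst w) =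
      snd u + (snd v + snd w + F (fst v) (fst w)) mod int p + F (fst u) (fst v \<otimes> fst w)] (mod int p)"
    unfolding cong_def by (simp only:)
  then show "u \<otimes>\<^bsub>extension\<^esub> v \<otimes>\<^bsub>extension\<^esub> w = u \<otimes>\<^bsub>extension\<^esub> (v \<otimes>\<^bsub>extension\<^esub> w)"
    using u v w unfolding cong_def by (auto simp: mult_extension carrier_extension m_assoc)
next
  fix u assume u: "u \<in> carrier extension"
  have "(snd u + F \<one> (fst u)) mod int p = snd u"
    using u cong_add[OF cong_refl[of "snd u"] cocycle_one_left[of "fst u"]]
    unfolding cong_def by (auto simp: carrier_extension)
  then show "\<one>\<^bsub>extension\<^esub> \<otimes>\<^bsub>extension\<^esub> u = u"
    using u by (auto simp: mult_extension one_extension carrier_extension)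
  let ?v = "(inv (fst u), (- snd u - F (inv (fst u)) (fst u)) mod int p)"
  have "?v \<otimes>\<^bsub>extension\<^esub> u = \<one>\<^bsub>extension\<^esub>"
    using u by (auto simp: mult_extension one_extension carrier_extension mod_add_left_eq add.assoc)
  then show "\<exists>v \<in> carrier extension. v \<otimes>\<^bsub>extension\<^esub> u = \<one>\<^bsub>extension\<^esub>"
    using u p_pos by (intro bexI[of _ ?v]) (auto simp: carrier_extension)
qed (use p_pos in \<open>auto simp: carrier_extension one_extension\<close>)

sublocale E: group extension by (rule group_extension)

definition z :: "'g \<times> int" where "z = (\<one>, 1 mod int p)"

lemma z_closed: "z \<in> carrier extension"
  using p_pos by (simp add: z_def carrier_extension)

lemma mult_z_pow_nat:
  fixes n :: nat
  assumes "u \<in> carrier extension"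
  shows "u \<otimes>\<^bsub>extension\<^esub> z [^]\<^bsub>extension\<^esub> n = (fst u, (snd u + int n) mod int p)"
proof (induction n)
  case 0
  then show ?case using assms by (auto simp: carrier_extension)
next
  case (Suc n)
  have "u \<otimes>\<^bsub>extension\<^esub> z [^]\<^bsub>extension\<^esub> Suc n = (u \<otimes>\<^bsub>extension\<^esub> z [^]\<^bsub>extension\<^esub> n) \<otimes>\<^bsub>extension\<^esub> z"
    using assms z_closed by (simp add: E.m_assoc)
  also have "\<dots> = (fst u, ((snd u + int n) mod int p + 1 mod int p + F (fst u) \<one>) mod int p)"
    unfolding Suc.IH using assms by (auto simp: mult_extension z_def carrier_extension)
  also have "[(snd u + int n) mod int p + 1 mod int p + F (fst u) \<one> = snd u + int n + 1 + 0] (mod int p)"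
    using assms by (intro cong_add cocycle_one_right) (auto simp: carrier_extension)
  then have "((snd u + int n) mod int p + 1 mod int p + F (fst u) \<one>) mod int p = (snd u + int (Suc n)) mod int p"
    by (simp add: cong_def algebra_simps)
  finally show ?case .
qed

lemma group_with_central_element_extension: "group_with_central_element extension z p"
proof
  show "z \<in> carrier extension" by (rule z_closed)
  have "\<one>\<^bsub>extension\<^esub> \<otimes>\<^bsub>extension\<^esub> z [^]\<^bsub>extension\<^esub> p = \<one>\<^bsub>extension\<^esub>"
    unfolding mult_z_pow_nat[OF E.one_closed] by (simp add: one_extension)
  then show "z [^]\<^bsub>extension\<^esub> p = \<one>\<^bsub>extension\<^esub>" using z_closed by simp
  fix u assume u: "u \<in> carrier extension"
  have "[1 mod int p + snd u + F \<one> (fst u) = 1 + snd u + 0] (mod int p)"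
    using u by (intro cong_add cocycle_one_left) (auto simp: carrier_extension)
  then have "z \<otimes>\<^bsub>extension\<^esub> u = (fst u, (snd u + 1) mod int p)"
    using u by (auto simp: mult_extension z_def carrier_extension cong_def add.commute)
  then show "z \<otimes>\<^bsub>extension\<^esub> u = u \<otimes>\<^bsub>extension\<^esub> z"
    using mult_z_pow_nat[OF u, of 1] z_closed by simp
qed

sublocale E: group_with_central_element extension z p
  by (rule group_with_central_element_extension)

lemma mult_z_pow:
  fixes k :: int
  assumes "u \<in> carrier extension"
  shows "u \<otimes>\<^bsub>extension\<^esub> z [^]\<^bsub>extension\<^esub> k = (fst u, (snd u + k) mod int p)"
proof -
  have "z [^]\<^bsub>extension\<^esub> k = z [^]\<^bsub>extension\<^esub> int (nat (k mod int p))"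
    using p_pos by (intro E.z_int_pow_cong) simp
  then show ?thesis
    using mult_z_pow_nat[OF assms, of "nat (k mod int p)"] p_pos by (simp add: int_pow_int mod_simps)
qed

text \<open>Every relation of the base group lifts to the extension up to a power of \<open>z\<close>; this yields the constants in the
  product formula.\<close>

lemma same_fst_imp_mult_z_pow:
  assumes "u \<in> carrier extension" "v \<in> carrier extension" "fst u = fst v"
  obtains k :: int where "u = v \<otimes>\<^bsub>extension\<^esub> z [^]\<^bsub>extension\<^esub> k"
proof
  show "u = v \<otimes>\<^bsub>extension\<^esub> z [^]\<^bsub>extension\<^esub> (snd u - snd v)"
    using assms unfolding mult_z_pow[OF assms(2)] by (auto simp: carrier_extension)
qed

lemma fst_hom: "fst \<in> hom extension G"
  by (auto simp: hom_def carrier_extension mult_extension)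

lemma fst_int_pow: "u \<in> carrier extension \<Longrightarrow> fst (u [^]\<^bsub>extension\<^esub> (k :: int)) = fst u [^] k"
  using hom_int_pow[OF fst_hom] group_extension is_group by blast

lemma fst_word:
  "(\<And>i. i \<in> set js \<Longrightarrow> e i \<in> carrier extension) \<Longrightarrow> fst (word extension e js y) = word G (\<lambda>i. fst (e i)) js y"
  by (induction js) (simp_all add: mult_extension one_extension fst_int_pow)

end

section \<open>Semidirect products of a power of a cyclic group with a cyclic group\<close>

lemma cong_pow_nat_mod:
  fixes q :: int
  assumes "[q ^ L = 1] (mod m)" "0 \<le> x"
  shows "[q ^ nat (x mod int L) = q ^ nat x] (mod m)"
proof -
  have "nat x = nat (x mod int L) + L * nat (x div int L)"
    using assms(2) by (simp add: nat_mod_distrib nat_div_distrib)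
  then have "q ^ nat x = q ^ nat (x mod int L) * (q ^ L) ^ nat (x div int L)"
    by (simp add: power_add power_mult)
  moreover have "[q ^ nat (x mod int L) * (q ^ L) ^ nat (x div int L) = q ^ nat (x mod int L) * 1 ^ nat (x div int L)] (mod m)"
    by (intro cong_mult cong_pow assms cong_refl)
  ultimately show ?thesis by (simp add: cong_sym)
qed

text \<open>The group \<open>(\<Prod>\<^sub>I \<int>/M) \<rtimes> \<int>/L\<close>, with the generator of \<open>\<int>/L\<close> acting as multiplication by \<open>q\<close>. Its operation
  is prescribed on the carrier only, because outside of it a concrete group record may contain anything.\<close>

locale twisted_power =
  fixes G :: "(('i \<Rightarrow> int) \<times> int, 'm) topological_group_scheme" (structure)
    and I :: "'i set" and M L :: nat and q :: int
  assumes M: "1 < M" and L: "1 < L" and q: "[q ^ L = 1] (mod int M)"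
    and carrier_eq: "carrier G = (I \<rightarrow>\<^sub>E {0..<int M}) \<times> {0..<int L}"
    and mult_eq: "\<lbrakk>u \<in> carrier G; v \<in> carrier G\<rbrakk> \<Longrightarrow>
      u \<otimes> v = (\<lambda>i\<in>I. (fst u i + q ^ nat (snd u) * fst v i) mod int M, (snd u + snd v) mod int L)"
    and one_eq: "\<one> = (\<lambda>i\<in>I. 0, 0)"
    and topol_eq: "topol G =
      prod_topology (product_topology (\<lambda>_. discrete_topology {0..<int M}) I) (discrete_topology {0..<int L})"
begin

lemma in_carrierI:
  "\<lbrakk>\<And>i. i \<in> I \<Longrightarrow> 0 \<le> y i \<and> y i < int M; 0 \<le> x; x < int L\<rbrakk> \<Longrightarrow> (restrict y I, x) \<in> carrier G"
  by (auto simp: carrier_eq)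

lemma carrierD:
  assumes "u \<in> carrier G"
  shows "i \<in> I \<Longrightarrow> 0 \<le> fst u i" "i \<in> I \<Longrightarrow> fst u i < int M" "0 \<le> snd u" "snd u < int L"
  using assms by (auto simp: carrier_eq PiE_iff)

lemma mult_components:
  assumes "u \<in> carrier G" "v \<in> carrier G"
  shows "i \<in> I \<Longrightarrow> fst (u \<otimes> v) i = (fst u i + q ^ nat (snd u) * fst v i) mod int M"
    and "snd (u \<otimes> v) = (snd u + snd v) mod int L"
  using assms by (simp_all add: mult_eq)

lemma m_closed': "\<lbrakk>u \<in> carrier G; v \<in> carrier G\<rbrakk> \<Longrightarrow> u \<otimes> v \<in> carrier G"
  using M L by (simp add: mult_eq) (rule in_carrierI, auto)

lemma carrier_eqI:
  assumes "u \<in> carrier G" "v \<in> carrier G" "\<And>i. i \<in> I \<Longrightarrow> fst u i = fst v i" "snd u = snd v"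
  shows "u = v"
proof -
  have "fst u = fst v"
    using assms(1-3) by (intro PiE_ext[of "fst u" I "\<lambda>_. {0..<int M}"]) (auto simp: carrier_eq)
  then show ?thesis using assms(4) by (rule prod_eqI)
qed

lemma group_twisted_power: "group G"
proof (rule groupI)
  show one: "\<one> \<in> carrier G" using M L by (auto simp: one_eq carrier_eq)
  fix u assume u: "u \<in> carrier G"
  show "\<one> \<otimes> u = u"
    using u one m_closed' carrierD[OF u] M
    by (intro carrier_eqI) (auto simp: mult_components one_eq)
  let ?x = "(- snd u) mod int L"
  let ?v = "(\<lambda>i\<in>I. (- (q ^ nat ?x * fst u i)) mod int M, ?x)"
  have v: "?v \<in> carrier G" using M L by (intro in_carrierI) auto
  have "?v \<otimes> u = \<one>"
    using u v one m_closed'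
    by (intro carrier_eqI) (simp_all add: mult_components one_eq mod_add_left_eq)
  then show "\<exists>v \<in> carrier G. v \<otimes> u = \<one>" using v by blast
  fix v assume v: "v \<in> carrier G"
  show "u \<otimes> v \<in> carrier G" using u v by (rule m_closed')
  fix w assume w: "w \<in> carrier G"
  show "u \<otimes> v \<otimes> w = u \<otimes> (v \<otimes> w)"
  proof (rule carrier_eqI)
    fix i assume i: "i \<in> I"
    have "[q ^ nat ((snd u + snd v) mod int L) = q ^ nat (snd u + snd v)] (mod int M)"
      using carrierD(3)[OF u] carrierD(3)[OF v] by (intro cong_pow_nat_mod[OF q]) simp
    also have "q ^ nat (snd u + snd v) = q ^ nat (snd u) * q ^ nat (snd v)"
      using carrierD(3)[OF u] carrierD(3)[OF v] by (simp add: nat_add_distrib power_add)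
    finally have "[(fst u i + q ^ nat (snd u) * fst v i) mod int M + q ^ nat ((snd u + snd v) mod int L) * fst w i =
        (fst u i + q ^ nat (snd u) * fst v i) + q ^ nat (snd u) * q ^ nat (snd v) * fst w i] (mod int M)"
      by (intro cong_add cong_mult cong_refl) simp
    moreover have "[fst u i + q ^ nat (snd u) * ((fst v i + q ^ nat (snd v) * fst w i) mod int M) =
        fst u i + q ^ nat (snd u) * (fst v i + q ^ nat (snd v) * fst w i)] (mod int M)"
      by (intro cong_add cong_mult cong_refl) simp
    ultimately show "fst (u \<otimes> v \<otimes> w) i = fst (u \<otimes> (v \<otimes> w)) i"
      using u v w i m_closed' by (simp add: mult_components cong_def algebra_simps)
  qed (use u v w m_closed' in \<open>simp_all add: mult_components mod_simps add.assoc\<close>)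
qed

sublocale group G by (rule group_twisted_power)

lemma continuous_coordinate:
  assumes "i \<in> I"
  shows "continuous_map (topol G) (discrete_topology {0..<int M}) (\<lambda>u. fst u i)"
proof -
  have "continuous_map (product_topology (\<lambda>_. discrete_topology {0..<int M}) I)
      (discrete_topology {0..<int M}) (\<lambda>y. y i)"
    using continuous_map_product_projection[OF assms, of "\<lambda>_. discrete_topology {0..<int M}"] .
  from continuous_map_compose[OF continuous_map_fst this] show ?thesis
    unfolding topol_eq by (simp only: o_def)
qed

lemma continuous_snd: "continuous_map (topol G) (discrete_topology {0..<int L}) snd"
  unfolding topol_eq by (rule continuous_map_snd)

lemma topspace_topol_eq: "topspace (topol G) = carrier G"
  by (simp add: topol_eq carrier_eq)

lemma continuous_map_into_topol:
  assumes "\<And>i. i \<in> I \<Longrightarrow> continuous_map T (discrete_topology {0..<int M}) (\<lambda>t. fst (f t) i)"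
    and "continuous_map T (discrete_topology {0..<int L}) (\<lambda>t. snd (f t))"
    and "\<And>t. t \<in> topspace T \<Longrightarrow> fst (f t) \<in> extensional I"
  shows "continuous_map T (topol G) f"
  unfolding topol_eq continuous_map_pairwise
  using assms by (auto simp: continuous_map_componentwise o_def)

lemma continuous_mult_eq:
  "continuous_map (prod_topology (topol G) (topol G)) (topol G) (\<lambda>t. fst t \<otimes> snd t)"
proof (rule continuous_map_into_topol)
  let ?T = "prod_topology (topol G) (topol G)"
  have fst: "continuous_map ?T (discrete_topology S) (\<lambda>t. f (fst t))"
    if "continuous_map (topol G) (discrete_topology S) f" for f and S :: "int set"
    using continuous_map_compose[OF continuous_map_fst that] by (simp only: o_def)
  have snd: "continuous_map ?T (discrete_topology S) (\<lambda>t. f (snd t))"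
    if "continuous_map (topol G) (discrete_topology S) f" for f and S :: "int set"
    using continuous_map_compose[OF continuous_map_snd that] by (simp only: o_def)
  have carrier: "fst t \<in> carrier G" "snd t \<in> carrier G" if "t \<in> topspace ?T" for t
    using that by (simp_all only: topspace_prod_topology topspace_topol_eq mem_Times_iff)
  show "continuous_map ?T (discrete_topology {0..<int M}) (\<lambda>t. fst (fst t \<otimes> snd t) i)" if i: "i \<in> I" for i
  proof (rule continuous_map_eq)
    have "continuous_map ?T (discrete_topology UNIV) (\<lambda>t. q ^ nat (snd (fst t)) * fst (snd t) i)"
      by (rule continuous_map_into_discrete_combine[OF fst[OF continuous_snd] snd[OF continuous_coordinate[OF i]],
          of "\<lambda>a b. q ^ nat a * b"]) simp
    from continuous_map_into_discrete_combine[OF fst[OF continuous_coordinate[OF i]] this,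
        of "\<lambda>a b. (a + b) mod int M" "{0..<int M}"]
    show "continuous_map ?T (discrete_topology {0..<int M})
        (\<lambda>t. (fst (fst t) i + q ^ nat (snd (fst t)) * fst (snd t) i) mod int M)"
      using M by simp
    fix t assume "t \<in> topspace ?T"
    from carrier[OF this] i
    show "(fst (fst t) i + q ^ nat (snd (fst t)) * fst (snd t) i) mod int M = fst (fst t \<otimes> snd t) i"
      by (simp only: mult_components)
  qed
  show "continuous_map ?T (discrete_topology {0..<int L}) (\<lambda>t. snd (fst t \<otimes> snd t))"
  proof (rule continuous_map_eq)
    show "continuous_map ?T (discrete_topology {0..<int L}) (\<lambda>t. (snd (fst t) + snd (snd t)) mod int L)"
      by (rule continuous_map_into_discrete_combine[OF fst[OF continuous_snd] snd[OF continuous_snd],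
          of "\<lambda>a b. (a + b) mod int L"]) (use L in simp)
    fix t assume "t \<in> topspace ?T"
    from carrier[OF this] show "(snd (fst t) + snd (snd t)) mod int L = snd (fst t \<otimes> snd t)"
      by (simp only: mult_components)
  qed
  show "fst (fst t \<otimes> snd t) \<in> extensional I" if "t \<in> topspace ?T" for t
    unfolding mult_eq[OF carrier[OF that]] by simp
qed

lemma mod_p_cochains_twisted_power: "0 < p \<Longrightarrow> mod_p_cochains G p"
  by (intro mod_p_cochains.intro mod_p_cochains_axioms.intro)
    (simp_all add: group.axioms(1)[OF group_twisted_power] topspace_topol_eq continuous_mult_eq)

lemma cylinder_base_topol:
  "cylinder_base (topol G) I (\<lambda>J (y, x). (restrict y J, x))"
  unfolding topol_eq by (intro cylinder_base_prod cylinder_base_product cylinder_base_discrete)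

lemma compact_space_topol: "compact_space (topol G)"
  unfolding topol_eq
  by (simp add: compact_space_prod_topology compact_space_product_topology compact_space_discrete_topology)

lemma continuous_if_finitely_determined:
  assumes "finite J" "J \<subseteq> I" "\<And>u. u \<in> carrier G \<Longrightarrow> f u \<in> S"
    and "\<And>u v. \<lbrakk>u \<in> carrier G; v \<in> carrier G; \<And>i. i \<in> J \<Longrightarrow> fst u i = fst v i; snd u = snd v\<rbrakk> \<Longrightarrow> f u = f v"
  shows "continuous_map (topol G) (discrete_topology S) f"
proof (rule continuous_map_if_factors_cylinder[OF cylinder_base_topol assms(1,2)])
  fix u v
  assume "u \<in> topspace (topol G)" "v \<in> topspace (topol G)"
    and eq: "(case u of (y, x) \<Rightarrow> (restrict y J, x)) = (case v of (y, x) \<Rightarrow> (restrict y J, x))"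
  then have uv: "u \<in> carrier G" "v \<in> carrier G" "restrict (fst u) J = restrict (fst v) J" "snd u = snd v"
    by (simp_all add: topspace_topol_eq split_beta)
  have "fst u i = fst v i" if "i \<in> J" for i
    using fun_cong[OF uv(3), of i] that by simp
  then show "f u = f v" using uv by (intro assms(4))
qed (use assms(3) topspace_topol_eq in simp)

text \<open>The only place where the compactness of the group is used. For infinite \<open>I\<close> it reduces the problem to finitely
  many generators.\<close>

lemma continuous2_finitely_determined:
  assumes "continuous_map (prod_topology (topol G) (topol G)) (discrete_topology S) (\<lambda>t. F (fst t) (snd t))"
  obtains J where "finite J" "J \<subseteq> I"
    "\<And>u v u' v'. \<lbrakk>u \<in> carrier G; v \<in> carrier G; u' \<in> carrier G; v' \<in> carrier G;
       \<And>i. i \<in> J \<Longrightarrow> fst u i = fst u' i; snd u = snd u';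
       \<And>i. i \<in> J \<Longrightarrow> fst v i = fst v' i; snd v = snd v'\<rbrakk> \<Longrightarrow> F u v = F u' v'"
proof -
  let ?\<kappa> = "\<lambda>J (y :: 'i \<Rightarrow> int, x :: int). (restrict y J, x)"
  have "compact_space (prod_topology (topol G) (topol G))"
    using compact_space_topol by (simp add: compact_space_prod_topology)
  then obtain J where J: "finite J" "J \<subseteq> I"
    "\<And>t t'. \<lbrakk>t \<in> topspace (prod_topology (topol G) (topol G)); t' \<in> topspace (prod_topology (topol G) (topol G));
       (case t of (u, v) \<Rightarrow> (?\<kappa> J u, ?\<kappa> J v)) = (case t' of (u, v) \<Rightarrow> (?\<kappa> J u, ?\<kappa> J v))\<rbrakk>
       \<Longrightarrow> F (fst t) (snd t) = F (fst t') (snd t')"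
    using continuous_map_factors_cylinder[OF cylinder_base_prod[OF cylinder_base_topol cylinder_base_topol] _ assms]
    by blast
  show ?thesis
  proof
    show "finite J" "J \<subseteq> I" by fact+
    fix u v u' v'
    assume carrier: "u \<in> carrier G" "v \<in> carrier G" "u' \<in> carrier G" "v' \<in> carrier G"
      and eq: "\<And>i. i \<in> J \<Longrightarrow> fst u i = fst u' i" "snd u = snd u'"
        "\<And>i. i \<in> J \<Longrightarrow> fst v i = fst v' i" "snd v = snd v'"
    have "restrict (fst u) J = restrict (fst u') J" "restrict (fst v) J = restrict (fst v') J"
      using eq by (auto intro: restrict_ext)
    then show "F u v = F u' v'"
      using J(3)[of "(u, v)" "(u', v')"] carrier eq topspace_topol_eq by (simp add: split_beta)
  qed
qed

definition basis :: "'i \<Rightarrow> ('i \<Rightarrow> int) \<times> int" where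
  "basis i = (\<lambda>j\<in>I. if j = i then 1 else 0, 0)"

definition generator :: "('i \<Rightarrow> int) \<times> int" where
  "generator = (\<lambda>i\<in>I. 0, 1)"

lemma basis_closed: "basis i \<in> carrier G"
  unfolding basis_def using M L by (intro in_carrierI) auto

lemma generator_closed: "generator \<in> carrier G"
  unfolding generator_def using M L by (intro in_carrierI) auto

lemma base_element_closed: "0 \<le> x \<Longrightarrow> x < int L \<Longrightarrow> (\<lambda>j\<in>I. c j mod int M, x) \<in> carrier G"
  using M by (intro in_carrierI) auto

lemma mult_base_elements:
  assumes "0 \<le> x" "x < int L"
  shows "(\<lambda>j\<in>I. c j mod int M, 0) \<otimes> (\<lambda>j\<in>I. d j mod int M, x) = (\<lambda>j\<in>I. (c j + d j) mod int M, x)"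
  using assms L base_element_closed[of 0 c] base_element_closed[of x d]
  by (simp add: mult_eq mod_add_eq cong: restrict_cong)

text \<open>Scalar multiplication is a homomorphism from the integers and agrees with taking powers at \<open>1\<close>; negative
  exponents, which occur for \<open>q = -1\<close>, need no separate treatment.\<close>

lemma base_element_int_pow: "(\<lambda>j\<in>I. c j mod int M, 0) [^] (a :: int) = (\<lambda>j\<in>I. (a * c j) mod int M, 0)"
proof -
  let ?h = "\<lambda>a :: int. (\<lambda>j\<in>I. (a * c j) mod int M, 0 :: int)"
  have "?h \<in> hom integer_group G"
  proof (rule homI)
    show "?h a \<in> carrier G" for a using base_element_closed[of 0] L by simp
    show "?h (a \<otimes>\<^bsub>integer_group\<^esub> b) = ?h a \<otimes> ?h b" for a b
      using mult_base_elements[of 0 "\<lambda>j. a * c j" "\<lambda>j. b * c j"] L by (simp add: distrib_right)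
  qed
  from hom_int_pow[OF this, of 1 a] show ?thesis by (simp add: group_twisted_power)
qed

lemma generator_nat_pow: "generator [^] (n :: nat) = (\<lambda>i\<in>I. 0, int n mod int L)"
proof (induction n)
  case 0
  then show ?case by (simp add: one_eq restrict_def)
next
  case (Suc n)
  have closed: "(\<lambda>i\<in>I. 0, int n mod int L) \<in> carrier G" using M L by (intro in_carrierI) auto
  have "generator [^] Suc n = (\<lambda>i\<in>I. 0, int n mod int L) \<otimes> generator"
    by (simp only: nat_pow_Suc Suc.IH)
  also have "\<dots> = (\<lambda>i\<in>I. 0, int (Suc n) mod int L)"
    unfolding mult_eq[OF closed generator_closed]
    by (auto simp: generator_def mod_add_left_eq mod_add_right_eq add.commute intro!: restrict_ext)
  finally show ?case .
qed

lemma basis_int_pow: "basis i [^] (a :: int) = (\<lambda>j\<in>I. (if j = i then a else 0) mod int M, 0)"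
proof -
  have "basis i = (\<lambda>j\<in>I. (if j = i then 1 else 0) mod int M, 0)"
    using M by (auto simp: basis_def cong: restrict_cong)
  then show ?thesis
    by (simp add: base_element_int_pow if_distrib[of "\<lambda>x. a * x"] cong: if_cong)
qed

lemma word_basis:
  assumes "distinct js"
  shows "word G basis js y = (\<lambda>j\<in>I. (if j \<in> set js then y j else 0) mod int M, 0)"
  using assms
proof (induction js)
  case Nil
  then show ?case by (simp add: one_eq restrict_def)
next
  case (Cons i js)
  have IH: "word G basis js y = (\<lambda>j\<in>I. (if j \<in> set js then y j else 0) mod int M, 0)"
    by (rule Cons.IH) (use Cons.prems in simp)
  have "word G basis (i # js) y =
      (\<lambda>j\<in>I. ((if j = i then y i else 0) + (if j \<in> set js then y j else 0)) mod int M, 0)"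
    unfolding word_Cons IH basis_int_pow by (rule mult_base_elements) (use L in simp_all)
  then show ?case using Cons.prems by (auto intro!: restrict_ext)
qed

lemma word_basis_mult_generator_pow:
  assumes "distinct js" "0 \<le> x"
  shows "word G basis js y \<otimes> generator [^] nat x = (\<lambda>j\<in>I. (if j \<in> set js then y j else 0) mod int M, x mod int L)"
  using mult_base_elements[of "x mod int L" "\<lambda>j. if j \<in> set js then y j else 0" "\<lambda>_. 0"] L assms
  by (simp add: word_basis generator_nat_pow)

lemma basis_commute: "basis i \<otimes> basis j = basis j \<otimes> basis i"
  by (simp add: mult_eq basis_closed) (simp add: basis_def add.commute cong: restrict_cong)

lemma generator_basis: "generator \<otimes> basis i = basis i [^] q \<otimes> generator"
proof -
  have "generator = (\<lambda>j\<in>I. 0 mod int M, 1)" by (simp add: generator_def)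
  then have "basis i [^] q \<otimes> generator = (\<lambda>j\<in>I. (if j = i then q else 0) mod int M, 1)"
    using mult_base_elements[of 1 "\<lambda>j. if j = i then q else 0" "\<lambda>_. 0"] L by (simp add: basis_int_pow)
  also have "\<dots> = generator \<otimes> basis i"
    using L by (auto simp: mult_eq basis_closed generator_closed) (auto simp: basis_def generator_def intro!: restrict_ext)
  finally show ?thesis ..
qed

end

section \<open>Inflation from level \<open>n\<close> to level \<open>n + 1\<close>\<close>

text \<open>\<open>H\<close> is the lower and \<open>G\<close> the upper level. The alternative in \<open>carry\<close> distinguishes the rigid from the
  superpythagorean tower: either the outer factor grows by \<open>p\<close>, and then a lift of its generator has order
  dividing \<open>L'\<close> in any central extension of \<open>H\<close> by \<open>\<int>/p\<close>, or it stays equal to \<open>\<int>/2\<close>, and then the cocycle of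
  the group extension \<open>\<int>/4\<close> of \<open>\<int>/2\<close> by \<open>\<int>/2\<close> is the product \<open>x x'\<close> itself.\<close>

locale twisted_power_tower = H: twisted_power H I M L q + G: twisted_power G I "p * M" L' q
  for H :: "(('i \<Rightarrow> int) \<times> int, 'm) topological_group_scheme"
    and G :: "(('i \<Rightarrow> int) \<times> int, 'n) topological_group_scheme"
    and I M L L' q p +
  assumes p_pos: "0 < p" and q_cong: "[q = 1] (mod int p)"
    and carry: "L' = p * L \<or> p = 2 \<and> L = 2 \<and> L' = 2"
begin

definition \<pi> :: "('i \<Rightarrow> int) \<times> int \<Rightarrow> ('i \<Rightarrow> int) \<times> int" where
  "\<pi> u = (\<lambda>i\<in>I. fst u i mod int M, snd u mod int L)"

lemma p_dvd: "int p dvd int L'" and L_dvd: "int L dvd int L'"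
  using carry by auto

lemma \<pi>_closed: "\<pi> u \<in> carrier H"
  unfolding \<pi>_def using H.M H.L by (intro H.in_carrierI) auto

lemma \<pi>_hom: "\<pi> \<in> hom G H"
proof (rule homI)
  fix u v assume u: "u \<in> carrier G" and v: "v \<in> carrier G"
  show "\<pi> (u \<otimes>\<^bsub>G\<^esub> v) = \<pi> u \<otimes>\<^bsub>H\<^esub> \<pi> v"
  proof (rule H.carrier_eqI)
    fix i assume i: "i \<in> I"
    have "[q ^ nat (snd u mod int L) = q ^ nat (snd u)] (mod int M)"
      using G.carrierD(3)[OF u] by (intro cong_pow_nat_mod H.q)
    then have "[fst u i mod int M + q ^ nat (snd u mod int L) * (fst v i mod int M) =
        fst u i + q ^ nat (snd u) * fst v i] (mod int M)"
      by (intro cong_add cong_mult) simp_all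
    then show "fst (\<pi> (u \<otimes>\<^bsub>G\<^esub> v)) i = fst (\<pi> u \<otimes>\<^bsub>H\<^esub> \<pi> v) i"
      unfolding H.mult_components(1)[OF \<pi>_closed \<pi>_closed i]
      using i by (simp add: \<pi>_def G.mult_components(1)[OF u v i] cong_def mod_mod_cancel)
  next
    show "snd (\<pi> (u \<otimes>\<^bsub>G\<^esub> v)) = snd (\<pi> u \<otimes>\<^bsub>H\<^esub> \<pi> v)"
      unfolding H.mult_components(2)[OF \<pi>_closed \<pi>_closed]
      using L_dvd by (simp add: \<pi>_def G.mult_components(2)[OF u v] mod_mod_cancel mod_add_eq)
  qed (use \<pi>_closed H.m_closed in auto)
qed (rule \<pi>_closed)

lemma \<pi>_continuous: "continuous_map (topol G) (topol H) \<pi>"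
proof (rule H.continuous_map_into_topol)
  have compose: "continuous_map (topol G) (discrete_topology S') (\<lambda>u. c (f u))"
    if "continuous_map (topol G) (discrete_topology S) f" "c \<in> S \<rightarrow> S'" for S S' :: "int set" and c f
    using continuous_map_compose[OF that(1), of "discrete_topology S'" c] that(2) by (simp add: o_def)
  show "continuous_map (topol G) (discrete_topology {0..<int M}) (\<lambda>u. fst (\<pi> u) i)" if "i \<in> I" for i
    using compose[OF G.continuous_coordinate[OF that], of "\<lambda>a. a mod int M"] that H.M by (simp add: \<pi>_def)
  show "continuous_map (topol G) (discrete_topology {0..<int L}) (\<lambda>u. snd (\<pi> u))"
    using compose[OF G.continuous_snd, of "\<lambda>a. a mod int L"] H.L by (simp add: \<pi>_def)
qed (simp add: \<pi>_def)

sublocale C: mod_p_cochains_hom G H p \<pi>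
  by (intro mod_p_cochains_hom.intro mod_p_cochains_hom_axioms.intro G.mod_p_cochains_twisted_power
      H.mod_p_cochains_twisted_power p_pos \<pi>_continuous \<pi>_hom)

lemma character_coordinate:
  assumes i: "i \<in> I"
  shows "C.G.character (\<lambda>u. fst u i mod int p)"
  unfolding C.G.character_def
proof (intro conjI ballI)
  show "C.G.continuous1 (\<lambda>u. fst u i mod int p)"
    by (rule G.continuous_if_finitely_determined[of "{i}"]) (use i p_pos in auto)
  fix u v assume u: "u \<in> carrier G" and v: "v \<in> carrier G"
  have "[q ^ nat (snd u) = 1] (mod int p)"
    using cong_pow[OF q_cong, of "nat (snd u)"] by simp
  then have "[fst u i + q ^ nat (snd u) * fst v i = fst u i mod int p + 1 * (fst v i mod int p)] (mod int p)"
    by (intro cong_add cong_mult) simp_all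
  then show "fst (u \<otimes>\<^bsub>G\<^esub> v) i mod int p = (fst u i mod int p + fst v i mod int p) mod int p"
    unfolding G.mult_components(1)[OF u v i] by (simp add: cong_def mod_mod_cancel)
qed

lemma character_outer: "C.G.character (\<lambda>u. snd u mod int p)"
  unfolding C.G.character_def
proof (intro conjI ballI)
  show "C.G.continuous1 (\<lambda>u. snd u mod int p)"
    by (rule G.continuous_if_finitely_determined[of "{}"]) (use p_pos in auto)
  fix u v assume u: "u \<in> carrier G" and v: "v \<in> carrier G"
  show "snd (u \<otimes>\<^bsub>G\<^esub> v) mod int p = (snd u mod int p + snd v mod int p) mod int p"
    unfolding G.mult_components(2)[OF u v] using p_dvd by (simp add: mod_mod_cancel mod_add_eq)
qed

text \<open>The central extension \<open>?E\<close> of \<open>H\<close> is trivialised over \<open>G\<close>, up to products of characters, by the lift \<open>S\<close>.\<close>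

theorem inflation_fully_decomposes:
  assumes "\<gamma> \<in> carrier (cohomology p 2 H)"
  shows "fully_decomposes p G (inflation p 2 G \<pi> \<gamma>)"
proof -
  obtain F where F: "C.H.continuous2 F" "C.H.is_cocycle2 F" and \<gamma>: "\<gamma> = C.H.class2 F"
    using assms C.H.carrier_cohomology2_iff by blast
  obtain J where J: "finite J" "J \<subseteq> I" and F_J: "\<And>u v u' v'.
      \<lbrakk>u \<in> carrier H; v \<in> carrier H; u' \<in> carrier H; v' \<in> carrier H;
       \<And>i. i \<in> J \<Longrightarrow> fst u i = fst u' i; snd u = snd u';
       \<And>i. i \<in> J \<Longrightarrow> fst v i = fst v' i; snd v = snd v'\<rbrakk> \<Longrightarrow> F u v = F u' v'"
    by (rule H.continuous2_finitely_determined[OF F(1)]) blast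
  obtain js where js: "distinct js" "set js = J" using finite_distinct_list[OF J(1)] by blast
  \<comment> \<open>The normalising constant. It is compensated by the constant in \<open>w\<close> below.\<close>
  define c0 where "c0 = F \<one>\<^bsub>H\<^esub> \<one>\<^bsub>H\<^esub>"
  interpret X: cocycle_extension H p "\<lambda>u v. F u v - c0"
  proof
    fix g h k assume "g \<in> carrier H" "h \<in> carrier H" "k \<in> carrier H"
    then have "int p dvd F h k - F (g \<otimes>\<^bsub>H\<^esub> h) k + F g (h \<otimes>\<^bsub>H\<^esub> k) - F g h"
      using F(2) unfolding C.H.is_cocycle2_def by blast
    then show "[F h k - c0 + (F g (h \<otimes>\<^bsub>H\<^esub> k) - c0) = F (g \<otimes>\<^bsub>H\<^esub> h) k - c0 + (F g h - c0)] (mod int p)"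
      unfolding cong_iff_dvd_diff by (simp add: algebra_simps)
  qed (simp_all add: p_pos c0_def)
  let ?E = X.extension
  define e where "e i = (H.basis i, 0 :: int)" for i
  define t where "t = (H.generator, 0 :: int)"
  have e: "e i \<in> carrier ?E" and t: "t \<in> carrier ?E" for i
    using p_pos by (simp_all add: e_def t_def X.carrier_extension H.basis_closed H.generator_closed)
  have fst_mult: "fst (u \<otimes>\<^bsub>?E\<^esub> v) = fst u \<otimes>\<^bsub>H\<^esub> fst v" for u v
    by (simp add: X.mult_extension)

  \<comment> \<open>The \<open>e i\<close> lift commuting elements of \<open>H\<close>, so their commutators are powers of \<open>z\<close>.\<close>
  define c where "c j i = (SOME k :: int. e j \<otimes>\<^bsub>?E\<^esub> e i = e i \<otimes>\<^bsub>?E\<^esub> e j \<otimes>\<^bsub>?E\<^esub> X.z [^]\<^bsub>?E\<^esub> k)" for j i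
  have c: "e j \<otimes>\<^bsub>?E\<^esub> e i = e i \<otimes>\<^bsub>?E\<^esub> e j \<otimes>\<^bsub>?E\<^esub> X.z [^]\<^bsub>?E\<^esub> c j i" for i j
    unfolding c_def
  proof (rule someI_ex)
    obtain k :: int where "e j \<otimes>\<^bsub>?E\<^esub> e i = e i \<otimes>\<^bsub>?E\<^esub> e j \<otimes>\<^bsub>?E\<^esub> X.z [^]\<^bsub>?E\<^esub> k"
      by (rule X.same_fst_imp_mult_z_pow[of "e j \<otimes>\<^bsub>?E\<^esub> e i" "e i \<otimes>\<^bsub>?E\<^esub> e j"])
        (use e in \<open>simp_all add: fst_mult e_def H.basis_commute\<close>)
    then show "\<exists>k :: int. e j \<otimes>\<^bsub>?E\<^esub> e i = e i \<otimes>\<^bsub>?E\<^esub> e j \<otimes>\<^bsub>?E\<^esub> X.z [^]\<^bsub>?E\<^esub> k" by (rule exI)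
  qed

  \<comment> \<open>Conjugation by \<open>t\<close> lifts the action of the outer generator: it raises \<open>e i\<close> to the power \<open>q\<close>, up to a power of \<open>z\<close>.\<close>
  define d where "d i = (SOME k :: int. t \<otimes>\<^bsub>?E\<^esub> e i \<otimes>\<^bsub>?E\<^esub> inv\<^bsub>?E\<^esub> t = e i [^]\<^bsub>?E\<^esub> q \<otimes>\<^bsub>?E\<^esub> X.z [^]\<^bsub>?E\<^esub> k)" for i
  have d: "t \<otimes>\<^bsub>?E\<^esub> e i \<otimes>\<^bsub>?E\<^esub> inv\<^bsub>?E\<^esub> t = e i [^]\<^bsub>?E\<^esub> q \<otimes>\<^bsub>?E\<^esub> X.z [^]\<^bsub>?E\<^esub> d i" for i
    unfolding d_def
  proof (rule someI_ex)
    obtain k :: int where k: "t \<otimes>\<^bsub>?E\<^esub> e i = e i [^]\<^bsub>?E\<^esub> q \<otimes>\<^bsub>?E\<^esub> t \<otimes>\<^bsub>?E\<^esub> X.z [^]\<^bsub>?E\<^esub> k"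
    proof (rule X.same_fst_imp_mult_z_pow[of "t \<otimes>\<^bsub>?E\<^esub> e i" "e i [^]\<^bsub>?E\<^esub> q \<otimes>\<^bsub>?E\<^esub> t"])
      show "fst (t \<otimes>\<^bsub>?E\<^esub> e i) = fst (e i [^]\<^bsub>?E\<^esub> q \<otimes>\<^bsub>?E\<^esub> t)"
        unfolding fst_mult X.fst_int_pow[OF e] by (simp add: e_def t_def H.generator_basis)
    qed (use e t in auto)
    have "t \<otimes>\<^bsub>?E\<^esub> e i \<otimes>\<^bsub>?E\<^esub> inv\<^bsub>?E\<^esub> t = e i [^]\<^bsub>?E\<^esub> q \<otimes>\<^bsub>?E\<^esub> X.z [^]\<^bsub>?E\<^esub> k"
      unfolding k using e t X.E.z_move[of "e i [^]\<^bsub>?E\<^esub> q" t k, symmetric] by (simp add: X.E.m_assoc)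
    then show "\<exists>k :: int. t \<otimes>\<^bsub>?E\<^esub> e i \<otimes>\<^bsub>?E\<^esub> inv\<^bsub>?E\<^esub> t = e i [^]\<^bsub>?E\<^esub> q \<otimes>\<^bsub>?E\<^esub> X.z [^]\<^bsub>?E\<^esub> k" by (rule exI)
  qed

  have central: "\<exists>k :: int. u = X.z [^]\<^bsub>?E\<^esub> k" if u: "u \<in> carrier ?E" "fst u = \<one>\<^bsub>H\<^esub>" for u
  proof -
    obtain k :: int where "u = \<one>\<^bsub>?E\<^esub> \<otimes>\<^bsub>?E\<^esub> X.z [^]\<^bsub>?E\<^esub> k"
      by (rule X.same_fst_imp_mult_z_pow[OF u(1) X.E.one_closed]) (simp_all add: u(2) X.one_extension)
    then show ?thesis by auto
  qed
  have fst_t_pow: "fst (t [^]\<^bsub>?E\<^esub> n) = (\<lambda>i\<in>I. 0, int n mod int L)" for n :: nat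
    using X.fst_int_pow[OF t, of "int n"] H.generator_nat_pow[of n] by (simp add: int_pow_int t_def)

  \<comment> \<open>The \<open>M\<close>-th powers of the \<open>e i\<close> lie in the group generated by \<open>z\<close>, which has exponent \<open>p\<close>.\<close>
  have e_pow: "e i [^]\<^bsub>?E\<^esub> int (p * M) = \<one>\<^bsub>?E\<^esub>" for i
  proof -
    have "fst (e i [^]\<^bsub>?E\<^esub> int M) = \<one>\<^bsub>H\<^esub>"
      unfolding X.fst_int_pow[OF e] by (auto simp: e_def H.basis_int_pow H.one_eq intro!: restrict_ext)
    then obtain k :: int where k: "e i [^]\<^bsub>?E\<^esub> int M = X.z [^]\<^bsub>?E\<^esub> k"
      using central[of "e i [^]\<^bsub>?E\<^esub> int M"] e by auto
    have "e i [^]\<^bsub>?E\<^esub> int (p * M) = (e i [^]\<^bsub>?E\<^esub> int M) [^]\<^bsub>?E\<^esub> int p"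
      using X.E.int_pow_pow[OF e, of i "int M" "int p"] by (simp add: mult.commute)
    also have "\<dots> = X.z [^]\<^bsub>?E\<^esub> (k * int p)"
      unfolding k by (rule X.E.int_pow_pow[OF X.z_closed])
    also have "\<dots> = X.z [^]\<^bsub>?E\<^esub> (0 :: int)" by (rule X.E.z_int_pow_cong) (simp add: cong_def)
    finally show ?thesis by simp
  qed
  have e_pow_mod: "e i [^]\<^bsub>?E\<^esub> (a mod int (p * M)) = e i [^]\<^bsub>?E\<^esub> a" for i and a :: int
  proof -
    have "e i [^]\<^bsub>?E\<^esub> a = e i [^]\<^bsub>?E\<^esub> (int (p * M) * (a div int (p * M)) + a mod int (p * M))" by simp
    also have "\<dots> = (e i [^]\<^bsub>?E\<^esub> int (p * M)) [^]\<^bsub>?E\<^esub> (a div int (p * M)) \<otimes>\<^bsub>?E\<^esub> e i [^]\<^bsub>?E\<^esub> (a mod int (p * M))"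
      using e by (simp only: X.E.int_pow_mult X.E.int_pow_pow)
    also have "\<dots> = e i [^]\<^bsub>?E\<^esub> (a mod int (p * M))"
      unfolding e_pow using e by simp
    finally show ?thesis by (rule sym)
  qed

  \<comment> \<open>The sum \<open>x + x'\<close> has to be reduced modulo \<open>L'\<close>, and \<open>\<epsilon>\<close> measures the cost of a carry.\<close>
  obtain \<epsilon> :: int where \<epsilon>: "t [^]\<^bsub>?E\<^esub> L' = X.z [^]\<^bsub>?E\<^esub> \<epsilon>"
    and \<epsilon>_carry: "\<And>x x'. \<lbrakk>0 \<le> x; x < int L'; 0 \<le> x'; x' < int L'\<rbrakk> \<Longrightarrow>
      [\<epsilon> * ((x + x') div int L') = \<epsilon> * (x * x')] (mod int p)"
    using carry
  proof
    assume L': "L' = p * L"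
    obtain k :: int where k: "t [^]\<^bsub>?E\<^esub> L = X.z [^]\<^bsub>?E\<^esub> k"
      using central[of "t [^]\<^bsub>?E\<^esub> L"] t by (auto simp: fst_t_pow H.one_eq)
    have "t [^]\<^bsub>?E\<^esub> L' = (t [^]\<^bsub>?E\<^esub> L) [^]\<^bsub>?E\<^esub> p"
      using X.E.nat_pow_pow[OF t, of L p] by (simp add: L' mult.commute)
    also have "\<dots> = X.z [^]\<^bsub>?E\<^esub> (k * int p)"
      unfolding k using X.E.int_pow_pow[OF X.z_closed, of k "int p"] by (simp add: int_pow_int)
    also have "\<dots> = X.z [^]\<^bsub>?E\<^esub> (0 :: int)" by (rule X.E.z_int_pow_cong) (simp add: cong_def)
    finally show thesis by (rule that) simp
  next
    assume two: "p = 2 \<and> L = 2 \<and> L' = 2"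
    have "fst (t [^]\<^bsub>?E\<^esub> L') = \<one>\<^bsub>H\<^esub>"
      using L_dvd by (simp add: fst_t_pow H.one_eq)
    then obtain k :: int where k: "t [^]\<^bsub>?E\<^esub> L' = X.z [^]\<^bsub>?E\<^esub> k"
      using central[OF X.E.nat_pow_closed[OF t]] by blast
    show thesis
    proof (rule that[OF k])
      fix x x' :: int assume "0 \<le> x" "x < int L'" "0 \<le> x'" "x' < int L'"
      then have "(x = 0 \<or> x = 1) \<and> (x' = 0 \<or> x' = 1)" using two by auto
      then have "(x + x') div int L' = x * x'" using two by auto
      then show "[k * ((x + x') div int L') = k * (x * x')] (mod int p)" by simp
    qed
  qed
  have t_pow_mod: "t [^]\<^bsub>?E\<^esub> (nat x + nat x') =
      t [^]\<^bsub>?E\<^esub> nat ((x + x') mod int L') \<otimes>\<^bsub>?E\<^esub> X.z [^]\<^bsub>?E\<^esub> (\<epsilon> * ((x + x') div int L'))"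
    if "0 \<le> x" "0 \<le> x'" for x x' :: int
  proof -
    have nonneg: "0 \<le> (x + x') div int L'"
      using that G.L by (simp add: pos_imp_zdiv_nonneg_iff)
    have "nat x + nat x' = nat ((x + x') mod int L') + L' * nat ((x + x') div int L')"
      using that by (simp add: nat_mod_distrib nat_div_distrib nat_add_distrib)
    then have "t [^]\<^bsub>?E\<^esub> (nat x + nat x') =
        t [^]\<^bsub>?E\<^esub> nat ((x + x') mod int L') \<otimes>\<^bsub>?E\<^esub> (t [^]\<^bsub>?E\<^esub> L') [^]\<^bsub>?E\<^esub> nat ((x + x') div int L')"
      using t by (simp only: X.E.nat_pow_mult X.E.nat_pow_pow)
    also have "(t [^]\<^bsub>?E\<^esub> L') [^]\<^bsub>?E\<^esub> nat ((x + x') div int L') = X.z [^]\<^bsub>?E\<^esub> (\<epsilon> * ((x + x') div int L'))"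
      unfolding \<epsilon> using X.E.int_pow_pow[OF X.z_closed, of \<epsilon> "int (nat ((x + x') div int L'))"] nonneg
      by (simp add: int_pow_int[symmetric])
    finally show ?thesis .
  qed

  \<comment> \<open>Nonnegative representatives are used for \<open>x\<close>; for the coordinates of \<open>y\<close> any representative modulo \<open>p M\<close> will do.\<close>
  define S where "S u = word ?E e js (fst u) \<otimes>\<^bsub>?E\<^esub> t [^]\<^bsub>?E\<^esub> nat (snd u)" for u
  define Q where "Q u v = commutation_form c js (fst u) (\<lambda>i. q ^ nat (snd u) * fst v i) +
      int (nat (snd u)) * (\<Sum>i\<leftarrow>js. d i * fst v i) + \<epsilon> * ((snd u + snd v) div int L')" for u v :: "('i \<Rightarrow> int) \<times> int"
  have S_closed: "S u \<in> carrier ?E" for u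
    using e t by (simp add: S_def)
  have fst_S: "fst (S u) = (\<lambda>j\<in>I. (if j \<in> J then fst u j else 0) mod int M, snd u mod int L)"
    if "u \<in> carrier G" for u
  proof -
    have "fst (S u) = word H H.basis js (fst u) \<otimes>\<^bsub>H\<^esub> H.generator [^]\<^bsub>H\<^esub> nat (snd u)"
      unfolding S_def fst_mult fst_t_pow H.generator_nat_pow[symmetric] X.fst_word[OF e] by (simp add: e_def)
    then show ?thesis
      using H.word_basis_mult_generator_pow[OF js(1) G.carrierD(3)[OF that]] js(2) by simp
  qed
  have S_mult: "S u \<otimes>\<^bsub>?E\<^esub> S v = S (u \<otimes>\<^bsub>G\<^esub> v) \<otimes>\<^bsub>?E\<^esub> X.z [^]\<^bsub>?E\<^esub> Q u v"
    if u: "u \<in> carrier G" and v: "v \<in> carrier G" for u v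
  proof -
    let ?m = "nat (snd u)"
    let ?w = "word ?E e js (\<lambda>i. fst u i + q ^ ?m * fst v i)"
    let ?k = "commutation_form c js (fst u) (\<lambda>i. q ^ ?m * fst v i) + int ?m * (\<Sum>i\<leftarrow>js. d i * fst v i)"
    let ?l = "\<epsilon> * ((snd u + snd v) div int L')"
    let ?t = "t [^]\<^bsub>?E\<^esub> nat ((snd u + snd v) mod int L')"
    have w: "?w = word ?E e js (fst (u \<otimes>\<^bsub>G\<^esub> v))"
    proof (rule word_cong)
      fix i assume "i \<in> set js"
      then have "i \<in> I" using js J by blast
      then show "e i [^]\<^bsub>?E\<^esub> (fst u i + q ^ ?m * fst v i) = e i [^]\<^bsub>?E\<^esub> fst (u \<otimes>\<^bsub>G\<^esub> v) i"
        by (simp only: G.mult_components(1)[OF u v] e_pow_mod)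
    qed
    have w_closed: "?w \<in> carrier ?E" and t_closed: "?t \<in> carrier ?E" using e t by simp_all
    have "S u \<otimes>\<^bsub>?E\<^esub> S v = ?w \<otimes>\<^bsub>?E\<^esub> t [^]\<^bsub>?E\<^esub> (?m + nat (snd v)) \<otimes>\<^bsub>?E\<^esub> X.z [^]\<^bsub>?E\<^esub> ?k"
      unfolding S_def by (rule X.E.section_mult[OF t e c d q_cong])
    also have "\<dots> = (?w \<otimes>\<^bsub>?E\<^esub> ?t) \<otimes>\<^bsub>?E\<^esub> (X.z [^]\<^bsub>?E\<^esub> ?l \<otimes>\<^bsub>?E\<^esub> X.z [^]\<^bsub>?E\<^esub> ?k)"
      unfolding t_pow_mod[OF G.carrierD(3)[OF u] G.carrierD(3)[OF v]]
      using w_closed t_closed X.z_closed by (simp add: X.E.m_assoc)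
    also have "X.z [^]\<^bsub>?E\<^esub> ?l \<otimes>\<^bsub>?E\<^esub> X.z [^]\<^bsub>?E\<^esub> ?k = X.z [^]\<^bsub>?E\<^esub> Q u v"
      unfolding Q_def X.E.int_pow_mult[OF X.z_closed, symmetric] by (simp add: add.commute)
    finally show ?thesis
      unfolding w S_def G.mult_components(2)[OF u v] .
  qed

  \<comment> \<open>The 1-cochain whose coboundary is the difference of the inflated cocycle and \<open>Q\<close>.\<close>
  define w where "w u = (c0 - snd (S u)) mod int p" for u
  have inflation_eq: "[F (\<pi> u) (\<pi> v) = Q u v + w v - w (u \<otimes>\<^bsub>G\<^esub> v) + w u] (mod int p)"
    if u: "u \<in> carrier G" and v: "v \<in> carrier G" for u v
  proof -
    have fst_S_closed: "fst (S u) \<in> carrier H" for u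
      using S_closed[of u] by (auto simp: X.carrier_extension)
    \<comment> \<open>\<open>S u\<close> lies over \<open>\<pi> u\<close> with the coordinates outside of \<open>J\<close> replaced by 0.\<close>
    have "F (\<pi> u) (\<pi> v) = F (fst (S u)) (fst (S v))"
    proof (rule F_J)
      show "fst (\<pi> u) i = fst (fst (S u)) i" if "i \<in> J" for i
        using that J(2) by (auto simp: fst_S[OF u] \<pi>_def)
      show "fst (\<pi> v) i = fst (fst (S v)) i" if "i \<in> J" for i
        using that J(2) by (auto simp: fst_S[OF v] \<pi>_def)
    qed ((rule \<pi>_closed fst_S_closed | simp add: fst_S[OF u] fst_S[OF v] \<pi>_def)+)
    moreover have "(snd (S u) + snd (S v) + (F (fst (S u)) (fst (S v)) - c0)) mod int p =
        (snd (S (u \<otimes>\<^bsub>G\<^esub> v)) + Q u v) mod int p"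
      using arg_cong[OF S_mult[OF u v], of snd] unfolding X.mult_z_pow[OF S_closed] by (simp add: X.mult_extension)
    ultimately have "[F (\<pi> u) (\<pi> v) =
        Q u v + (c0 - snd (S v)) - (c0 - snd (S (u \<otimes>\<^bsub>G\<^esub> v))) + (c0 - snd (S u))] (mod int p)"
      unfolding cong_iff_dvd_diff mod_eq_dvd_iff by (simp add: algebra_simps)
    moreover have "[Q u v + w v - w (u \<otimes>\<^bsub>G\<^esub> v) + w u =
        Q u v + (c0 - snd (S v)) - (c0 - snd (S (u \<otimes>\<^bsub>G\<^esub> v))) + (c0 - snd (S u))] (mod int p)"
      unfolding w_def by (intro cong_add cong_diff cong_refl) simp_all
    ultimately show ?thesis by (rule cong_trans[OF _ cong_sym])
  qed

  have "C.G.continuous1 w"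
  proof (rule G.continuous_if_finitely_determined[OF J])
    show "w u \<in> {0..<int p}" for u using p_pos by (simp add: w_def)
    fix u v :: "('i \<Rightarrow> int) \<times> int"
    assume eq: "\<And>i. i \<in> J \<Longrightarrow> fst u i = fst v i" "snd u = snd v"
    have "word ?E e js (fst u) = word ?E e js (fst v)"
      by (rule word_cong) (simp add: eq(1) js(2))
    then have "S u = S v" by (simp only: S_def eq(2))
    then show "w u = w v" by (simp add: w_def)
  qed
  moreover have "C.G.sum_of_products Q"
  proof (rule C.G.sum_of_products_cong)
    \<comment> \<open>Modulo \<open>p\<close> the powers of \<open>q\<close> disappear and every coordinate may be replaced by its residue, a character.\<close>
    have outer: "C.G.character (\<lambda>u. snd u mod int p)" by (rule character_outer)
    have coordinate: "C.G.character (\<lambda>u. fst u i mod int p)" if "i \<in> set js" for i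
      using that js J by (intro character_coordinate) blast
    show "C.G.sum_of_products (\<lambda>u v. commutation_form c js (\<lambda>i. fst u i mod int p) (\<lambda>i. fst v i mod int p) +
        (snd u mod int p) * ((\<Sum>i\<leftarrow>js. d i * (fst v i mod int p)) mod int p) +
        ((\<epsilon> * (snd u mod int p) + 0) mod int p) * (snd v mod int p))"
      by (intro C.G.sum_of_products_add C.G.sum_of_products_commutation_form C.G.sum_of_products_product
          C.G.character_sum_list C.G.character_add_scaled C.G.character_zero outer coordinate)
    fix u v assume u: "u \<in> carrier G" and v: "v \<in> carrier G"
    have "[q ^ nat (snd u) = 1] (mod int p)"
      using cong_pow[OF q_cong, of "nat (snd u)"] by simp
    then have "[q ^ nat (snd u) * fst v i = 1 * (fst v i mod int p)] (mod int p)" for i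
      by (intro cong_mult) simp_all
    then have form: "[commutation_form c js (fst u) (\<lambda>i. q ^ nat (snd u) * fst v i) =
        commutation_form c js (\<lambda>i. fst u i mod int p) (\<lambda>i. fst v i mod int p)] (mod int p)"
      by (intro commutation_form_cong) simp_all
    have linear: "[int (nat (snd u)) * (\<Sum>i\<leftarrow>js. d i * fst v i) =
        (snd u mod int p) * ((\<Sum>i\<leftarrow>js. d i * (fst v i mod int p)) mod int p)] (mod int p)"
    proof (rule cong_mult)
      show "[int (nat (snd u)) = snd u mod int p] (mod int p)" using G.carrierD(3)[OF u] by simp
      have "[(\<Sum>i\<leftarrow>js. d i * fst v i) = (\<Sum>i\<leftarrow>js. d i * (fst v i mod int p))] (mod int p)"
        by (intro sum_list_cong_mod cong_mult cong_refl) simp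
      then show "[(\<Sum>i\<leftarrow>js. d i * fst v i) = (\<Sum>i\<leftarrow>js. d i * (fst v i mod int p)) mod int p] (mod int p)" by simp
    qed
    have "[\<epsilon> * ((snd u + snd v) div int L') = \<epsilon> * (snd u * snd v)] (mod int p)"
      using G.carrierD(3,4)[OF u] G.carrierD(3,4)[OF v] by (intro \<epsilon>_carry)
    moreover have "[((\<epsilon> * (snd u mod int p) + 0) mod int p) * (snd v mod int p) = \<epsilon> * snd u * snd v] (mod int p)"
      by (intro cong_mult) (simp_all add: cong_def mod_mult_right_eq)
    ultimately have carry: "[\<epsilon> * ((snd u + snd v) div int L') =
        ((\<epsilon> * (snd u mod int p) + 0) mod int p) * (snd v mod int p)] (mod int p)"
      by (simp add: cong_def mult.assoc)
    show "[Q u v = commutation_form c js (\<lambda>i. fst u i mod int p) (\<lambda>i. fst v i mod int p) +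
        (snd u mod int p) * ((\<Sum>i\<leftarrow>js. d i * (fst v i mod int p)) mod int p) +
        ((\<epsilon> * (snd u mod int p) + 0) mod int p) * (snd v mod int p)] (mod int p)"
      unfolding Q_def by (intro cong_add form linear carry)
  qed
  ultimately show ?thesis
    unfolding \<gamma> C.inflation_class2[OF F]
    using C.G.fully_decomposes_if_cohomologous_to_sum_of_products[OF C.continuous2_pullback[OF F(1)]] inflation_eq
    by blast
qed

end

section \<open>The groups \<open>P(n)\<close>\<close>

lemma inflation_cong:
  assumes "\<And>g. g \<in> carrier G \<Longrightarrow> \<pi> g = \<pi>' g"
  shows "inflation p m G \<pi> \<gamma> = inflation p m G \<pi>' \<gamma>"
proof -
  have "(\<lambda>x \<in> tuples m G. f (\<lambda>k \<in> {..<m}. \<pi> (x k))) = (\<lambda>x \<in> tuples m G. f (\<lambda>k \<in> {..<m}. \<pi>' (x k)))" for f :: "_ \<Rightarrow> int"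
  proof (rule restrict_ext)
    fix x assume "x \<in> tuples m G"
    then have "(\<lambda>k \<in> {..<m}. \<pi> (x k)) = (\<lambda>k \<in> {..<m}. \<pi>' (x k))"
      by (intro restrict_ext assms) (simp add: tuples_def PiE_iff)
    then show "f (\<lambda>k \<in> {..<m}. \<pi> (x k)) = f (\<lambda>k \<in> {..<m}. \<pi>' (x k))" by simp
  qed
  then show ?thesis unfolding inflation_def by simp
qed

lemma carrier_cyclic: "0 < m \<Longrightarrow> carrier (cyclic m) = {0..<int m}"
  and mult_cyclic: "x \<otimes>\<^bsub>cyclic m\<^esub> y = (x + y) mod int m"
  and one_cyclic: "\<one>\<^bsub>cyclic m\<^esub> = 0"
  and topol_cyclic: "0 < m \<Longrightarrow> topol (cyclic m) = discrete_topology {0..<int m}"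
  by (simp_all add: cyclic_def with_topology_def carrier_integer_mod_group)

lemma carrier_power_cyclic: "0 < m \<Longrightarrow> carrier (power_group I (cyclic m)) = (I \<rightarrow>\<^sub>E {0..<int m})"
  and mult_power_cyclic: "y \<otimes>\<^bsub>power_group I (cyclic m)\<^esub> y' = (\<lambda>i\<in>I. (y i + y' i) mod int m)"
  and one_power_cyclic: "\<one>\<^bsub>power_group I (cyclic m)\<^esub> = (\<lambda>i\<in>I. 0)"
  and topol_power_cyclic: "0 < m \<Longrightarrow> topol (power_group I (cyclic m)) =
    product_topology (\<lambda>_. discrete_topology {0..<int m}) I"
  by (simp_all add: power_group_def with_topology_def carrier_cyclic mult_cyclic one_cyclic topol_cyclic)

lemma group_power_cyclic:
  assumes "0 < m"
  shows "group (power_group I (cyclic m))"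
proof (rule groupI; unfold carrier_power_cyclic[OF assms] mult_power_cyclic one_power_cyclic)
  fix y assume y: "y \<in> I \<rightarrow>\<^sub>E {0..<int m}"
  then have ext: "y = (\<lambda>i\<in>I. y i)" by (metis PiE_restrict)
  have mod: "y i mod int m = y i" if "i \<in> I" for i using y that by (auto simp: PiE_iff)
  show "(\<lambda>i\<in>I. ((\<lambda>i\<in>I. 0) i + y i) mod int m) = y"
  proof -
    have "(\<lambda>i\<in>I. ((\<lambda>i\<in>I. 0) i + y i) mod int m) = (\<lambda>i\<in>I. y i)"
      by (rule restrict_ext) (simp add: mod)
    then show ?thesis by (simp only: ext[symmetric])
  qed
  show "\<exists>y' \<in> I \<rightarrow>\<^sub>E {0..<int m}. (\<lambda>i\<in>I. (y' i + y i) mod int m) = (\<lambda>i\<in>I. 0)"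
    by (rule bexI[of _ "\<lambda>i\<in>I. (- y i) mod int m"])
      (use assms in \<open>auto simp: mod_add_left_eq intro!: restrict_ext\<close>)
qed (use assms in \<open>auto simp: mod_simps add.assoc intro!: restrict_ext\<close>)

lemma int_pow_power_cyclic:
  fixes k :: int
  assumes "0 < m" "y \<in> carrier (power_group I (cyclic m))"
  shows "y [^]\<^bsub>power_group I (cyclic m)\<^esub> k = (\<lambda>i\<in>I. (k * y i) mod int m)"
proof
  let ?N = "power_group I (cyclic m)"
  interpret N: group ?N by (rule group_power_cyclic[OF assms(1)])
  fix i
  show "(y [^]\<^bsub>?N\<^esub> k) i = (\<lambda>i\<in>I. (k * y i) mod int m) i"
  proof (cases "i \<in> I")
    case True
    have "(\<lambda>y. y i) \<in> hom ?N (integer_mod_group m)"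
      using True assms(1)
      by (intro homI) (auto simp: carrier_power_cyclic mult_power_cyclic carrier_integer_mod_group PiE_iff)
    from hom_int_pow[OF this assms(2) N.is_group group_integer_mod_group, of k] show ?thesis
      using True by (simp add: int_pow_integer_mod_group)
  next
    case False
    have "y [^]\<^bsub>?N\<^esub> k \<in> I \<rightarrow>\<^sub>E {0..<int m}"
      using N.int_pow_closed[OF assms(2), of k] unfolding carrier_power_cyclic[OF assms(1)] .
    then show ?thesis using False by (auto simp: PiE_iff extensional_def)
  qed
qed

lemma twisted_power_semidirect:
  assumes M: "1 < M" and L: "1 < L" and q: "[q ^ L = 1] (mod int M)"
  shows "twisted_power (semidirect_group (power_group I (cyclic M)) (cyclic L)
    (\<lambda>x y. y [^]\<^bsub>power_group I (cyclic M)\<^esub> (q ^ nat x))) I M L q"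
proof
  let ?N = "power_group I (cyclic M)"
  let ?G = "semidirect_group ?N (cyclic L) (\<lambda>x y. y [^]\<^bsub>?N\<^esub> (q ^ nat x))"
  show carrier: "carrier ?G = (I \<rightarrow>\<^sub>E {0..<int M}) \<times> {0..<int L}"
    using M L by (simp add: semidirect_group_def carrier_power_cyclic carrier_cyclic)
  show "topol ?G = prod_topology (product_topology (\<lambda>_. discrete_topology {0..<int M}) I) (discrete_topology {0..<int L})"
    using M L by (simp add: semidirect_group_def topol_power_cyclic topol_cyclic)
  show "\<one>\<^bsub>?G\<^esub> = (\<lambda>i\<in>I. 0, 0)"
    by (simp add: semidirect_group_def one_power_cyclic one_cyclic)
  fix u v assume "u \<in> carrier ?G" "v \<in> carrier ?G"
  then have v: "fst v \<in> carrier ?N"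
    using M unfolding carrier by (auto simp: carrier_power_cyclic)
  have "u \<otimes>\<^bsub>?G\<^esub> v = (fst u \<otimes>\<^bsub>?N\<^esub> fst v [^]\<^bsub>?N\<^esub> (q ^ nat (snd u)), snd u \<otimes>\<^bsub>cyclic L\<^esub> snd v)"
    by (simp add: semidirect_group_def split_beta)
  also have "fst v [^]\<^bsub>?N\<^esub> (q ^ nat (snd u)) = (\<lambda>i\<in>I. (q ^ nat (snd u) * fst v i) mod int M)"
    using M by (intro int_pow_power_cyclic v) simp
  finally show "u \<otimes>\<^bsub>?G\<^esub> v =
      (\<lambda>i\<in>I. (fst u i + q ^ nat (snd u) * fst v i) mod int M, (snd u + snd v) mod int L)"
    unfolding mult_power_cyclic mult_cyclic by (auto simp: mod_add_right_eq intro!: restrict_ext)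
qed (use assms in auto)

text \<open>\<open>a\<^sup>p - 1 = (a - 1) (1 + a + \<dots> + a\<^bsup>p-1\<^esup>)\<close>, and for \<open>a \<equiv> 1\<close> modulo \<open>p\<close> the second factor is divisible
  by \<open>p\<close>. So each \<open>p\<close>-th power gains one more factor \<open>p\<close>.\<close>

lemma cong_pow_power_of_prime_power:
  fixes q :: int
  assumes "[q = 1] (mod int p)"
  shows "[q ^ p ^ n = 1] (mod int p ^ Suc n)"
proof (induction n)
  case 0
  then show ?case using assms by simp
next
  case (Suc n)
  let ?a = "q ^ p ^ n"
  have "[(\<Sum>i<p. ?a ^ i) = (\<Sum>i<p. 1 ^ i)] (mod int p)"
    by (intro cong_sum cong_pow cong_dvd_modulus[OF Suc.IH]) simp
  then have "int p dvd (\<Sum>i<p. ?a ^ i)" by (simp add: cong_def dvd_eq_mod_eq_0)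
  moreover have "int p ^ Suc n dvd ?a - 1" using Suc.IH by (simp add: cong_iff_dvd_diff)
  ultimately have "int p ^ Suc n * int p dvd (?a - 1) * (\<Sum>i<p. ?a ^ i)" by (rule mult_dvd_mono[rotated])
  also have "(?a - 1) * (\<Sum>i<p. ?a ^ i) = ?a ^ p - 1" by (rule power_diff_1_eq[symmetric])
  also have "?a ^ p = q ^ p ^ Suc n" by (simp add: power_mult[symmetric] mult.commute)
  finally show ?case by (simp add: cong_iff_dvd_diff mult.commute)
qed

lemma twisted_power_A_group:
  assumes "1 \<le> n"
  shows "twisted_power (A_group I n) I (2 ^ n) 2 (- 1)"
  unfolding A_group_def Let_def
  by (rule twisted_power_semidirect) (use assms one_less_power[of "2::nat" n] in simp_all)

lemma twisted_power_B_group: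
  assumes "1 < p" "1 \<le> n" "[action_exponent p k = 1] (mod int p)"
  shows "twisted_power (B_group p I k n) I (p ^ n) (p ^ n) (action_exponent p k)"
  unfolding B_group_def Let_def
proof (rule twisted_power_semidirect)
  show "[action_exponent p k ^ p ^ n = 1] (mod int (p ^ n))"
    by (rule cong_dvd_modulus[OF cong_pow_power_of_prime_power[OF assms(3)]]) simp
qed (use assms one_less_power[of p n] in simp_all)

lemma action_exponent_cong:
  assumes "1 \<le> k"
  shows "[action_exponent p k = 1] (mod int p)"
proof (cases k)
  case (enat l)
  then have "0 < l" using assms by (simp add: one_enat_def)
  then show ?thesis by (simp add: action_exponent_def enat cong_iff_dvd_diff)
qed (simp add: action_exponent_def)

text \<open>On the carrier the outer coordinate is already reduced modulo \<open>2\<close>, so \<open>A_projection\<close>, which leaves it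
  unchanged, agrees there with the projection of the tower.\<close>

lemma A_group_inflation_fully_decomposes:
  assumes n: "1 \<le> n" and \<gamma>: "\<gamma> \<in> carrier (cohomology 2 2 (A_group I n))"
  shows "fully_decomposes 2 (A_group I (n + 1)) (inflation 2 2 (A_group I (n + 1)) (A_projection I n) \<gamma>)"
proof -
  have "twisted_power (A_group I (n + 1)) I (2 * 2 ^ n) 2 (- 1)"
    using twisted_power_A_group[of "n + 1" I] by simp
  then interpret T: twisted_power_tower "A_group I n" "A_group I (n + 1)" I "2 ^ n" 2 2 "- 1" 2
    using twisted_power_A_group[OF n, of I]
    by (intro twisted_power_tower.intro twisted_power_tower_axioms.intro) (simp_all add: cong_def)
  have "T.\<pi> u = A_projection I n u" if "u \<in> carrier (A_group I (n + 1))" for u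
    using T.G.carrierD(3,4)[OF that] by (simp add: T.\<pi>_def A_projection_def split_beta)
  then have "inflation 2 2 (A_group I (n + 1)) T.\<pi> \<gamma> = inflation 2 2 (A_group I (n + 1)) (A_projection I n) \<gamma>"
    by (rule inflation_cong)
  then show ?thesis using T.inflation_fully_decomposes[OF \<gamma>] by simp
qed

lemma B_group_inflation_fully_decomposes:
  assumes p: "1 < p" and n: "1 \<le> n" and k: "1 \<le> k"
    and \<gamma>: "\<gamma> \<in> carrier (cohomology p 2 (B_group p I k n))"
  shows "fully_decomposes p (B_group p I k (n + 1)) (inflation p 2 (B_group p I k (n + 1)) (B_projection p I n) \<gamma>)"
proof -
  note q = action_exponent_cong[OF k, of p]
  have "twisted_power (B_group p I k (n + 1)) I (p * p ^ n) (p * p ^ n) (action_exponent p k)"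
    using twisted_power_B_group[OF p _ q, of "n + 1" I] by simp
  then interpret T: twisted_power_tower "B_group p I k n" "B_group p I k (n + 1)" I "p ^ n" "p ^ n" "p * p ^ n"
      "action_exponent p k" p
    using twisted_power_B_group[OF p n q, of I] p q
    by (intro twisted_power_tower.intro twisted_power_tower_axioms.intro) simp_all
  have "T.\<pi> = B_projection p I n"
    by (rule ext) (simp add: T.\<pi>_def B_projection_def split_beta)
  then show ?thesis using T.inflation_fully_decomposes[OF \<gamma>] by simp
qed

theorem theorem1p6:
  fixes p n :: nat
    and P :: "nat \<Rightarrow> (('i \<Rightarrow> int) \<times> int) topological_group"
    and \<pi> :: "nat \<Rightarrow> ('i \<Rightarrow> int) \<times> int \<Rightarrow> ('i \<Rightarrow> int) \<times> int"
  assumes field: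
    "superpythagorean TYPE('a::field) \<and> p = 2 \<and> superpythagorean_tower TYPE('a) P \<pi> \<or>
     prime p \<and> odd p \<and> p_rigid_field TYPE('a) p \<and> has_primitive_root_of_unity TYPE('a) p \<and>
       rigid_tower TYPE('a) p P \<pi>"
    and n: "1 \<le> n"
    and \<gamma>: "\<gamma> \<in> carrier (cohomology p 2 (P n))"
  shows "fully_decomposes p (P (n + 1)) (inflation p 2 (P (n + 1)) (\<pi> n) \<gamma>)"
  using field
proof
  assume "superpythagorean TYPE('a) \<and> p = 2 \<and> superpythagorean_tower TYPE('a) P \<pi>"
  then obtain I where "p = 2" "P = A_group I" "\<pi> = A_projection I"
    unfolding superpythagorean_tower_def by blast
  then show ?thesis using A_group_inflation_fully_decomposes[OF n] \<gamma> by simp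
next
  assume rigid: "prime p \<and> odd p \<and> p_rigid_field TYPE('a) p \<and> has_primitive_root_of_unity TYPE('a) p \<and>
    rigid_tower TYPE('a) p P \<pi>"
  then obtain I k where "1 \<le> k" "P = B_group p I k" "\<pi> = B_projection p I"
    unfolding rigid_tower_def by blast
  moreover have "1 < p" using rigid prime_gt_1_nat by blast
  ultimately show ?thesis using B_group_inflation_fully_decomposes[OF _ n] \<gamma> by simp
qed

end
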